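(* Let $M$ be a connected orientable hypersurface of the unit sphere $\mathbb{S}^{n+1}\subset\mathbb{R}^{n+2}$, let $\mu$ be the position vector of $M$ in $\mathbb{R}^{n+2}$, let $\eta$ be a unit normal section of $M$ in $\mathbb{R}^{n+2}$ parallel in the normal connection, and let $\theta\in[0,\pi)$ be the (constant) angle between $\eta$ and $\mu$. Let $\nu$ be a unit normal section of $M$ in $\mathbb{S}^{n+1}$ such that $\eta=\sin\theta\,\nu+\cos\theta\,\mu$. (1) If $\theta=0$ or $\theta=\frac{\pi}{2}$, then the Gauss map $\gamma_\eta$ is harmonic if and only if $M$ is a minimal hypersurface of $\mathbb{S}^{n+1}$. (2) If $\theta\neq0$ and $\theta\neq\frac{\pi}{2}$, then the Gauss map $\gamma_\eta$ is harmonic if and only if $M$ is a constant mean curvature hypersurface of $\mathbb{S}^{n+1}$ and the second fundamental form of $M$ in $\mathbb{S}^{n+1}$ has constant length and satisfies $$\|S_\nu\|^2=nH(\cot\theta-\tan\theta)+n,$$ where $H$ is the mean curvature of $M$ with respect to $\nu$.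
   Context: A normal section of $M$ in $\mathbb{R}^{n+2}$ is parallel in the normal connection iff it is of the form $a\nu+b\mu$ with $a,b$ constants, $\nu$ a unit normal section of $M$ in $\mathbb{S}^{n+1}$. The Gauss map is $\gamma_\eta:M\to\mathbb{S}^{n+1}$, $\gamma_\eta(p)=\eta(p)$. A map from $M$ to a unit sphere is harmonic if it is a critical point of $f\mapsto\int_D\|df\|^2$ on compact subdomains $D\subset M$ among maps into that sphere (equivalently $\Delta f=-\|df\|^2 f$). $S_\nu(X)=-\nabla_X\nu$ is the shape operator of $M$ in $\mathbb{S}^{n+1}$, $\|S_\nu\|$ its Hilbert–Schmidt norm and $H=\frac1n\mathrm{tr}\,S_\nu$. *)

theory Defs
  imports "HOL-Analysis.Analysis"
begin

section \<open>Smooth maps between open subsets of normed spaces\<close>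

primrec Ck_on :: "nat \<Rightarrow> 'a::real_normed_vector set \<Rightarrow> ('a \<Rightarrow> 'b::real_normed_vector) \<Rightarrow> bool" where
  "Ck_on 0 U f \<longleftrightarrow> continuous_on U f"
| "Ck_on (Suc k) U f \<longleftrightarrow>
     (\<forall>x\<in>U. f differentiable (at x)) \<and> (\<forall>v. Ck_on k U (\<lambda>x. frechet_derivative f (at x) v))"

text \<open>Only used for open \<open>U\<close>.\<close>
definition smooth_on :: "'a::real_normed_vector set \<Rightarrow> ('a \<Rightarrow> 'b::real_normed_vector) \<Rightarrow> bool" where
  "smooth_on U f \<longleftrightarrow> (\<forall>k. Ck_on k U f)"


section \<open>Linear algebra on subspaces of a Euclidean space\<close>

text \<open>A chosen orthonormal basis of a subspace; the quantities defined from it below do not depend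
  on the choice.\<close>
definition onb :: "'v::euclidean_space set \<Rightarrow> 'v set" where
  "onb T = (SOME B. B \<subseteq> T \<and> pairwise orthogonal B \<and> (\<forall>b\<in>B. norm b = 1) \<and> span B = T)"

definition orth_proj :: "'v::euclidean_space set \<Rightarrow> 'v \<Rightarrow> 'v" where
  "orth_proj T w = (\<Sum>b\<in>onb T. (w \<bullet> b) *\<^sub>R b)"

definition trace_on :: "'v::euclidean_space set \<Rightarrow> ('v \<Rightarrow> 'v) \<Rightarrow> real" where
  "trace_on T L = (\<Sum>b\<in>onb T. L b \<bullet> b)"

text \<open>Hilbert-Schmidt norm of a linear map defined on the subspace \<open>T\<close>.\<close>
definition hs_norm :: "'v::euclidean_space set \<Rightarrow> ('v \<Rightarrow> 'w::real_normed_vector) \<Rightarrow> real" where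
  "hs_norm T L = sqrt (\<Sum>b\<in>onb T. (norm (L b))\<^sup>2)"

definition vec_angle :: "'v::real_inner \<Rightarrow> 'v \<Rightarrow> real" where
  "vec_angle u v = arccos ((u \<bullet> v) / (norm u * norm v))"


section \<open>Immersed hypersurfaces of the unit sphere\<close>

text \<open>
  A hypersurface of the sphere is a second countable Hausdorff space \<open>M\<close> with an immersion
  \<open>\<mu>\<close> of \<open>M\<close> into the unit sphere of \<open>\<real>\<^sup>n\<^sup>+\<^sup>2\<close>, written \<open>real ^ ('n + 2)\<close> with \<open>n = CARD('n)\<close>
  (\<open>'n + 2\<close> is the disjoint sum of \<open>'n\<close> and a two-element type). Embedded hypersurfaces are the
  case where \<open>M\<close> is a subset of \<open>real ^ ('n + 2)\<close> and \<open>\<mu>\<close> is the identity.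

  The smooth structure of \<open>M\<close> need not be given separately: a homeomorphism \<open>\<phi>\<close> from an open
  subset of \<open>\<real>\<^sup>n\<close> onto an open subset of \<open>M\<close> is a local parametrization of \<open>M\<close> iff \<open>\<mu> \<circ> \<phi>\<close> is a
  smooth immersion, and transitions between two such maps are automatically smooth.
\<close>

definition local_param ::
    "'m::{t2_space,second_countable_topology} set \<Rightarrow> ('m \<Rightarrow> real ^ ('n::finite + 2)) \<Rightarrow>
     (real ^ 'n) set \<Rightarrow> (real ^ 'n \<Rightarrow> 'm) \<Rightarrow> bool" where
  "local_param M \<mu> U \<phi> \<longleftrightarrow>
     open U \<and> openin (top_of_set M) (\<phi> ` U) \<and> (\<exists>\<psi>. homeomorphism U (\<phi> ` U) \<phi> \<psi>) \<and>
     smooth_on U (\<mu> \<circ> \<phi>) \<and> (\<forall>x\<in>U. inj (frechet_derivative (\<mu> \<circ> \<phi>) (at x)))"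

definition sphere_hypersurface ::
    "'m::{t2_space,second_countable_topology} set \<Rightarrow> ('m \<Rightarrow> real ^ ('n::finite + 2)) \<Rightarrow> bool" where
  "sphere_hypersurface M \<mu> \<longleftrightarrow>
     \<mu> ` M \<subseteq> sphere 0 1 \<and> (\<forall>p\<in>M. \<exists>U \<phi>. local_param M \<mu> U \<phi> \<and> p \<in> \<phi> ` U)"

definition orientable ::
    "'m::{t2_space,second_countable_topology} set \<Rightarrow> ('m \<Rightarrow> real ^ ('n::finite + 2)) \<Rightarrow> bool" where
  "orientable M \<mu> \<longleftrightarrow>
     (\<exists>A. (\<forall>(U, \<phi>)\<in>A. local_param M \<mu> U \<phi>) \<and> M = (\<Union>(U, \<phi>)\<in>A. \<phi> ` U) \<and>
        (\<forall>(U, \<phi>)\<in>A. \<forall>(V, \<psi>)\<in>A. \<forall>x\<in>U. \<phi> x \<in> \<psi> ` V \<longrightarrow>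
           det (matrix (frechet_derivative (\<lambda>z. inv_into V \<psi> (\<phi> z)) (at x))) > 0))"

definition smooth_map ::
    "'m::{t2_space,second_countable_topology} set \<Rightarrow> ('m \<Rightarrow> real ^ ('n::finite + 2)) \<Rightarrow>
     ('m \<Rightarrow> 'c::real_normed_vector) \<Rightarrow> bool" where
  "smooth_map M \<mu> f \<longleftrightarrow> (\<forall>U \<phi>. local_param M \<mu> U \<phi> \<longrightarrow> smooth_on U (f \<circ> \<phi>))"

text \<open>Tangent spaces are identified with their images in \<open>\<real>\<^sup>n\<^sup>+\<^sup>2\<close> under the differential of \<open>\<mu>\<close>.\<close>
definition tangent_space ::
    "'m::{t2_space,second_countable_topology} set \<Rightarrow> ('m \<Rightarrow> real ^ ('n::finite + 2)) \<Rightarrow> 'm \<Rightarrow>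
     (real ^ ('n + 2)) set" where
  "tangent_space M \<mu> p =
     {frechet_derivative (\<mu> \<circ> \<phi>) (at x) v | U \<phi> x v. local_param M \<mu> U \<phi> \<and> x \<in> U \<and> \<phi> x = p}"

text \<open>The differential \<open>df\<^sub>p(X)\<close> for \<open>X\<close> in the tangent space at \<open>p\<close>.\<close>
definition dmap ::
    "'m::{t2_space,second_countable_topology} set \<Rightarrow> ('m \<Rightarrow> real ^ ('n::finite + 2)) \<Rightarrow>
     ('m \<Rightarrow> 'c::real_normed_vector) \<Rightarrow> 'm \<Rightarrow> real ^ ('n + 2) \<Rightarrow> 'c" where
  "dmap M \<mu> f p X =
     (THE w. \<exists>U \<phi> x v. local_param M \<mu> U \<phi> \<and> x \<in> U \<and> \<phi> x = p \<and>
        X = frechet_derivative (\<mu> \<circ> \<phi>) (at x) v \<and> w = frechet_derivative (f \<circ> \<phi>) (at x) v)"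


section \<open>Normal sections, shape operator, mean curvature\<close>

definition unit_normal_section ::
    "'m::{t2_space,second_countable_topology} set \<Rightarrow> ('m \<Rightarrow> real ^ ('n::finite + 2)) \<Rightarrow>
     ('m \<Rightarrow> real ^ ('n + 2)) \<Rightarrow> bool" where
  "unit_normal_section M \<mu> \<eta> \<longleftrightarrow>
     smooth_map M \<mu> \<eta> \<and> (\<forall>p\<in>M. norm (\<eta> p) = 1 \<and> (\<forall>X\<in>tangent_space M \<mu> p. orthogonal (\<eta> p) X))"

text \<open>Normal to \<open>M\<close> and tangent to the sphere, whose tangent space at \<open>\<mu> p\<close> is \<open>{\<mu> p}\<^sup>\<bottom>\<close>.\<close>
definition unit_normal_section_in_sphere ::
    "'m::{t2_space,second_countable_topology} set \<Rightarrow> ('m \<Rightarrow> real ^ ('n::finite + 2)) \<Rightarrow>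
     ('m \<Rightarrow> real ^ ('n + 2)) \<Rightarrow> bool" where
  "unit_normal_section_in_sphere M \<mu> \<nu> \<longleftrightarrow>
     unit_normal_section M \<mu> \<nu> \<and> (\<forall>p\<in>M. orthogonal (\<nu> p) (\<mu> p))"

definition normal_connection ::
    "'m::{t2_space,second_countable_topology} set \<Rightarrow> ('m \<Rightarrow> real ^ ('n::finite + 2)) \<Rightarrow>
     ('m \<Rightarrow> real ^ ('n + 2)) \<Rightarrow> 'm \<Rightarrow> real ^ ('n + 2) \<Rightarrow> real ^ ('n + 2)" where
  "normal_connection M \<mu> \<eta> p X =
     orth_proj (orthogonal_comp (tangent_space M \<mu> p)) (dmap M \<mu> \<eta> p X)"

definition parallel_normal ::
    "'m::{t2_space,second_countable_topology} set \<Rightarrow> ('m \<Rightarrow> real ^ ('n::finite + 2)) \<Rightarrow>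
     ('m \<Rightarrow> real ^ ('n + 2)) \<Rightarrow> bool" where
  "parallel_normal M \<mu> \<eta> \<longleftrightarrow>
     (\<forall>p\<in>M. \<forall>X\<in>tangent_space M \<mu> p. normal_connection M \<mu> \<eta> p X = 0)"

text \<open>Levi-Civita connection of the sphere: the part of the ambient derivative tangent to it.\<close>
definition sphere_connection ::
    "'m::{t2_space,second_countable_topology} set \<Rightarrow> ('m \<Rightarrow> real ^ ('n::finite + 2)) \<Rightarrow>
     ('m \<Rightarrow> real ^ ('n + 2)) \<Rightarrow> 'm \<Rightarrow> real ^ ('n + 2) \<Rightarrow> real ^ ('n + 2)" where
  "sphere_connection M \<mu> \<nu> p X = orth_proj (orthogonal_comp {\<mu> p}) (dmap M \<mu> \<nu> p X)"

definition shape_operator ::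
    "'m::{t2_space,second_countable_topology} set \<Rightarrow> ('m \<Rightarrow> real ^ ('n::finite + 2)) \<Rightarrow>
     ('m \<Rightarrow> real ^ ('n + 2)) \<Rightarrow> 'm \<Rightarrow> real ^ ('n + 2) \<Rightarrow> real ^ ('n + 2)" where
  "shape_operator M \<mu> \<nu> p X = - sphere_connection M \<mu> \<nu> p X"

definition shape_norm ::
    "'m::{t2_space,second_countable_topology} set \<Rightarrow> ('m \<Rightarrow> real ^ ('n::finite + 2)) \<Rightarrow>
     ('m \<Rightarrow> real ^ ('n + 2)) \<Rightarrow> 'm \<Rightarrow> real" where
  "shape_norm M \<mu> \<nu> p = hs_norm (tangent_space M \<mu> p) (shape_operator M \<mu> \<nu> p)"

definition mean_curvature ::
    "'m::{t2_space,second_countable_topology} set \<Rightarrow> ('m \<Rightarrow> real ^ ('n::finite + 2)) \<Rightarrow>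
     ('m \<Rightarrow> real ^ ('n + 2)) \<Rightarrow> 'm \<Rightarrow> real" where
  "mean_curvature M \<mu> \<nu> p =
     trace_on (tangent_space M \<mu> p) (shape_operator M \<mu> \<nu> p) / real CARD('n)"

definition minimal_hypersurface ::
    "'m::{t2_space,second_countable_topology} set \<Rightarrow> ('m \<Rightarrow> real ^ ('n::finite + 2)) \<Rightarrow>
     ('m \<Rightarrow> real ^ ('n + 2)) \<Rightarrow> bool" where
  "minimal_hypersurface M \<mu> \<nu> \<longleftrightarrow> (\<forall>p\<in>M. mean_curvature M \<mu> \<nu> p = 0)"

definition cmc_hypersurface ::
    "'m::{t2_space,second_countable_topology} set \<Rightarrow> ('m \<Rightarrow> real ^ ('n::finite + 2)) \<Rightarrow>
     ('m \<Rightarrow> real ^ ('n + 2)) \<Rightarrow> bool" where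
  "cmc_hypersurface M \<mu> \<nu> \<longleftrightarrow> (\<exists>c. \<forall>p\<in>M. mean_curvature M \<mu> \<nu> p = c)"


section \<open>Energy and harmonic maps into spheres\<close>

text \<open>First fundamental form \<open>g\<^sub>i\<^sub>j = \<partial>\<^sub>i(\<mu> \<circ> \<phi>) \<bullet> \<partial>\<^sub>j(\<mu> \<circ> \<phi>)\<close>.\<close>
definition gram ::
    "('m \<Rightarrow> real ^ ('n::finite + 2)) \<Rightarrow> (real ^ 'n \<Rightarrow> 'm) \<Rightarrow> real ^ 'n \<Rightarrow> real ^ 'n ^ 'n" where
  "gram \<mu> \<phi> x = (\<chi> i j. frechet_derivative (\<mu> \<circ> \<phi>) (at x) (axis i 1) \<bullet>
                         frechet_derivative (\<mu> \<circ> \<phi>) (at x) (axis j 1))"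

text \<open>The Riemannian measure: the Borel measure on \<open>M\<close> equal to \<open>\<surd>(det g) dx\<close> in every local
  parametrization. It exists by the change of variables formula, and is unique since countably
  many parametrizations cover \<open>M\<close>.\<close>
definition riemannian_measure ::
    "'m::{t2_space,second_countable_topology} set \<Rightarrow> ('m \<Rightarrow> real ^ ('n::finite + 2)) \<Rightarrow> 'm measure" where
  "riemannian_measure M \<mu> =
     (SOME V. space V = M \<and> sets V = sets (restrict_space borel M) \<and>
        (\<forall>U \<phi> A. local_param M \<mu> U \<phi> \<and> A \<in> sets borel \<and> A \<subseteq> U \<longrightarrow>
           emeasure V (\<phi> ` A) = (\<integral>\<^sup>+x\<in>A. ennreal (sqrt (det (gram \<mu> \<phi> x))) \<partial>lborel)))"

definition energy ::
    "'m::{t2_space,second_countable_topology} set \<Rightarrow> ('m \<Rightarrow> real ^ ('n::finite + 2)) \<Rightarrow> 'm set \<Rightarrow>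
     ('m \<Rightarrow> 'c::euclidean_space) \<Rightarrow> real" where
  "energy M \<mu> D f =
     (LINT p:D|riemannian_measure M \<mu>. (hs_norm (tangent_space M \<mu> p) (dmap M \<mu> f p))\<^sup>2)"

text \<open>Smooth one-parameter variations \<open>F t\<close> (\<open>\<bar>t\<bar> < \<epsilon>\<close>) of \<open>f\<close> through maps into the unit sphere,
  supported in \<open>D\<close>.\<close>
definition sphere_variation ::
    "'m::{t2_space,second_countable_topology} set \<Rightarrow> ('m \<Rightarrow> real ^ ('n::finite + 2)) \<Rightarrow> 'm set \<Rightarrow>
     ('m \<Rightarrow> 'c::euclidean_space) \<Rightarrow> real \<Rightarrow> (real \<Rightarrow> 'm \<Rightarrow> 'c) \<Rightarrow> bool" where
  "sphere_variation M \<mu> D f \<epsilon> F \<longleftrightarrow>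
     \<epsilon> > 0 \<and>
     (\<forall>U \<phi>. local_param M \<mu> U \<phi> \<longrightarrow> smooth_on ({-\<epsilon><..<\<epsilon>} \<times> U) (\<lambda>(t, x). F t (\<phi> x))) \<and>
     (\<forall>t\<in>{-\<epsilon><..<\<epsilon>}. F t ` M \<subseteq> sphere 0 1) \<and>
     (\<forall>p\<in>M. F 0 p = f p) \<and>
     (\<forall>t\<in>{-\<epsilon><..<\<epsilon>}. \<forall>p\<in>M - D. F t p = f p)"

definition harmonic_map ::
    "'m::{t2_space,second_countable_topology} set \<Rightarrow> ('m \<Rightarrow> real ^ ('n::finite + 2)) \<Rightarrow>
     ('m \<Rightarrow> 'c::euclidean_space) \<Rightarrow> bool" where
  "harmonic_map M \<mu> f \<longleftrightarrow>
     smooth_map M \<mu> f \<and> f ` M \<subseteq> sphere 0 1 \<and>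
     (\<forall>D \<epsilon> F. compact D \<and> D \<subseteq> M \<and> sphere_variation M \<mu> D f \<epsilon> F \<longrightarrow>
        ((\<lambda>t. energy M \<mu> D (F t)) has_real_derivative 0) (at 0))"

definition gauss_map :: "('m \<Rightarrow> real ^ ('n::finite + 2)) \<Rightarrow> 'm \<Rightarrow> real ^ ('n + 2)" where
  "gauss_map \<eta> p = \<eta> p"

end

theory Submission
  imports Defs
begin

text \<open>
  A map \<open>f\<close> from \<open>M\<close> into a unit sphere is harmonic iff \<open>\<Delta>f\<close> is everywhere a multiple of \<open>f\<close>
  (\<open>harmonic_map_iff_euler_lagrange\<close>), where \<open>\<Delta>\<close> is the Laplacian of the metric induced by \<open>\<mu>\<close>,
  applied to the components of \<open>f\<close>. For the Gauss map \<open>\<eta> = sin \<theta> \<nu> + cos \<theta> \<mu>\<close> this Laplacian is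
  explicit. With \<open>H\<close> the mean curvature and \<open>S\<close> the shape operator of \<open>M\<close> in the sphere,
  \<open>\<Delta>\<mu> = n H \<nu> - n \<mu>\<close> and \<open>\<Delta>\<nu> = - n \<nabla>H - \<parallel>S\<parallel>\<^sup>2 \<nu> + n H \<mu>\<close>
  (\<open>lap_y\<close> and \<open>lap_nu\<close>; the gradient term is the contracted Codazzi equation). Hence \<open>\<Delta>\<eta>\<close> is
  a multiple of \<open>\<eta>\<close> iff its tangential part \<open>- n sin \<theta> \<nabla>H\<close> vanishes and so does its component
  along \<open>cos \<theta> \<nu> - sin \<theta> \<mu>\<close>, which reads
  \<open>sin \<theta> cos \<theta> (\<parallel>S\<parallel>\<^sup>2 - n) = (cos\<^sup>2 \<theta> - sin\<^sup>2 \<theta>) n H\<close>. For \<open>\<theta> = 0\<close> and \<open>\<theta> = \<pi>/2\<close> the second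
  equation says \<open>H = 0\<close> and implies the first. For the other angles division by
  \<open>sin \<theta> cos \<theta>\<close> turns it into the asserted formula for \<open>\<parallel>S\<parallel>\<^sup>2\<close>, and the first equation says
  that \<open>H\<close> is locally constant, hence constant on the connected space \<open>M\<close>; the length of the
  second fundamental form is then constant as well.

  The Laplacian is taken in coordinates, for an immersion \<open>y = \<mu> \<circ> \<phi>\<close> of an open subset of
  \<open>\<real>\<^sup>n\<close> and the frame \<open>\<partial>\<^sub>i y\<close> with its dual frame in the tangent space. Index computations are
  short in this setting: the Christoffel symbols are the inner products of the dual frame with
  the second derivatives of \<open>y\<close>, and the derivative of the volume density is a trace of them,
  by Jacobi's formula for determinants. This gives Green's identity for test maps supported in
  a chart, because derivatives of compactly supported functions on \<open>\<real>\<^sup>n\<close> have integral zero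
  (\<open>green_identity\<close>).

  Passing from charts to \<open>M\<close> takes three facts. Transition maps are differentiable, so
  that differentials, tangent spaces and the energy density do not depend on the chart
  (\<open>transition_properties\<close>, \<open>dirichlet_form_chart\<close>). The Riemannian measure exists, by the change
  of variables formula (\<open>riemannian_measure_exists\<close>). Cut-offs of the distance to a point,
  measured by \<open>\<mu>\<close> in the ambient space, are bump functions that are smooth on all of \<open>M\<close>
  (\<open>bump_function_exists\<close>). The energy is then differentiated under the integral sign
  (\<open>first_variation\<close>). Bump functions turn its vanishing into a pointwise equation in one
  direction, and in the other one they form the partition of unity that reduces an arbitrary
  variation to Green's identity in charts.
\<close>

section \<open>Calculus of smooth maps\<close>

named_theorems smooth_intros

text \<open>Any pointwise derivatives of \<open>f\<close>, in whatever form they were computed, may stand in for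
  \<open>frechet_derivative\<close>.\<close>

lemma Ck_on_SucI:
  assumes "\<And>x. x \<in> U \<Longrightarrow> (f has_derivative f' x) (at x)"
    and "\<And>v. Ck_on k U (\<lambda>x. f' x v)" and "open U"
  shows "Ck_on (Suc k) U f"
proof -
  have *: "frechet_derivative f (at x) = f' x" if "x \<in> U" for x
    using frechet_derivative_at[OF assms(1)[OF that]] by simp
  have "Ck_on k U (\<lambda>x. frechet_derivative f (at x) v)" for v
  proof (cases k)
    case 0
    then show ?thesis
      using assms(2)[of v] * by (auto cong: continuous_on_cong)
  next
    case (Suc m)
    have cong: "Ck_on m U f \<Longrightarrow> (\<And>x. x \<in> U \<Longrightarrow> f x = g x) \<Longrightarrow> Ck_on m U g" for m f and g :: "'a \<Rightarrow> 'b"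
    proof (induction m arbitrary: f g)
      case 0
      then show ?case by (auto cong: continuous_on_cong)
    next
      case (Suc m)
      have d: "g differentiable (at x)" "frechet_derivative g (at x) = frechet_derivative f (at x)"
        if "x \<in> U" for x
      proof -
        have "(f has_derivative frechet_derivative f (at x)) (at x)"
          using Suc.prems(1) that by (simp add: frechet_derivative_works)
        then have "(g has_derivative frechet_derivative f (at x)) (at x)"
          using has_derivative_transform_within_open[OF _ \<open>open U\<close> that] Suc.prems(2) by blast
        then show "g differentiable (at x)" "frechet_derivative g (at x) = frechet_derivative f (at x)"
          by (auto simp: differentiable_def frechet_derivative_at[symmetric])
      qed
      have "Ck_on m U (\<lambda>x. frechet_derivative g (at x) v)" for v
        by (rule Suc.IH[of "\<lambda>x. frechet_derivative f (at x) v"]) (use Suc.prems d in auto)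
      then show ?case using d by auto
    qed
    show ?thesis by (rule cong[OF assms(2)[of v]]) (simp add: *)
  qed
  then show ?thesis
    using assms(1) by (auto simp: differentiable_def)
qed

lemma Ck_on_SucD: "Ck_on (Suc k) U f \<Longrightarrow> x \<in> U \<Longrightarrow> (f has_derivative frechet_derivative f (at x)) (at x)"
  by (simp add: frechet_derivative_works)

lemma Ck_on_cong:
  assumes "Ck_on k U f" "\<And>x. x \<in> U \<Longrightarrow> f x = g x" "open U"
  shows "Ck_on k U g"
proof (cases k)
  case 0
  then show ?thesis using assms by (auto cong: continuous_on_cong)
next
  case (Suc m)
  show ?thesis unfolding Suc
  proof (rule Ck_on_SucI)
    show "(g has_derivative frechet_derivative f (at x)) (at x)" if "x \<in> U" for x
      using has_derivative_transform_within_open[OF Ck_on_SucD[OF assms(1)[unfolded Suc] that] \<open>open U\<close> that] assms(2)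
      by blast
    show "Ck_on m U (\<lambda>x. frechet_derivative f (at x) v)" for v
      using assms(1) by (simp add: Suc)
  qed (rule assms)
qed

lemma Ck_on_subset: "Ck_on k V f \<Longrightarrow> U \<subseteq> V \<Longrightarrow> Ck_on k U f"
  by (induction k arbitrary: f) (auto intro: continuous_on_subset)

lemma Ck_on_Suc_imp: "Ck_on (Suc k) U f \<Longrightarrow> Ck_on k U f"
proof (induction k arbitrary: f)
  case 0
  then show ?case
    by (auto intro!: continuous_at_imp_continuous_on differentiable_imp_continuous_within)
next
  case (Suc k)
  then show ?case by (metis Ck_on.simps(2))
qed

text \<open>Being of class \<open>C\<^sup>k\<close> is a local property, so that a map may be shown to be smooth by
  different formulas on different parts of its domain.\<close>

lemma Ck_on_local:
  assumes "\<And>x. x \<in> U \<Longrightarrow> \<exists>V. open V \<and> x \<in> V \<and> Ck_on k V f"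
  shows "Ck_on k U f"
  using assms
proof (induction k arbitrary: f)
  case 0
  show ?case unfolding Ck_on.simps
  proof (rule continuous_at_imp_continuous_on, rule ballI)
    fix x assume "x \<in> U"
    then obtain V where "open V" "x \<in> V" "continuous_on V f" using 0 by force
    then show "isCont f x" by (simp add: continuous_on_eq_continuous_at)
  qed
next
  case (Suc k)
  have "f differentiable (at x)" if "x \<in> U" for x
    using Suc.prems[OF that] by auto
  moreover have "Ck_on k U (\<lambda>x. frechet_derivative f (at x) v)" for v
    by (rule Suc.IH) (use Suc.prems in fastforce)
  ultimately show ?case by simp
qed

lemma Ck_on_const: "Ck_on k U (\<lambda>x. c)"
  by (induction k arbitrary: c) auto

lemma Ck_on_bounded_linear: "bounded_linear L \<Longrightarrow> open U \<Longrightarrow> Ck_on k U L"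
proof (cases k)
  case 0
  assume "bounded_linear L" then show ?thesis
    using 0 by (simp add: linear_continuous_on)
next
  case (Suc m)
  assume L: "bounded_linear L" "open U"
  show ?thesis unfolding Suc
    by (rule Ck_on_SucI[where f' = "\<lambda>x. L"]) (use L in \<open>auto intro: Ck_on_const bounded_linear_imp_has_derivative\<close>)
qed

lemma Ck_on_add:
  assumes "open U" "Ck_on k U f" "Ck_on k U g"
  shows "Ck_on k U (\<lambda>x. f x + g x)"
  using assms(2,3)
proof (induction k arbitrary: f g)
  case 0 then show ?case by (auto intro: continuous_on_add)
next
  case (Suc k)
  show ?case
    by (rule Ck_on_SucI[where f'="\<lambda>x v. frechet_derivative f (at x) v + frechet_derivative g (at x) v"])
       (use Suc.prems in \<open>auto intro!: has_derivative_add Ck_on_SucD Suc.IH assms\<close>)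
qed

lemma Ck_on_bilinear:
  assumes "open U" "bounded_bilinear B" "Ck_on k U f" "Ck_on k U g"
  shows "Ck_on k U (\<lambda>x. B (f x) (g x))"
  using assms(3,4)
proof (induction k arbitrary: f g)
  case 0 then show ?case using bounded_bilinear.continuous_on[OF assms(2)] by auto
next
  case (Suc k)
  show ?case
    by (rule Ck_on_SucI[where f'="\<lambda>x v. B (f x) (frechet_derivative g (at x) v) + B (frechet_derivative f (at x) v) (g x)"])
       (use Suc.prems Ck_on_Suc_imp[OF Suc.prems(1)] Ck_on_Suc_imp[OF Suc.prems(2)] in
         \<open>auto intro!: bounded_bilinear.FDERIV[OF assms(2)] Ck_on_SucD Suc.IH assms Ck_on_add\<close>)
qed

lemma Ck_on_sum:
  assumes "open U" "\<And>i. i \<in> I \<Longrightarrow> Ck_on k U (f i)"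
  shows "Ck_on k U (\<lambda>x. \<Sum>i\<in>I. f i x)"
  using assms(2) by (induction I rule: infinite_finite_induct) (auto intro: Ck_on_const Ck_on_add assms(1))

text \<open>Expanding the inner derivative in an orthonormal basis writes the derivative of \<open>g \<circ> f\<close> as a finite
  sum of products, to which the induction on the order of differentiability applies.\<close>

lemma Ck_on_compose:
  fixes f :: "'a::real_normed_vector \<Rightarrow> 'b::euclidean_space"
  assumes "open U" "Ck_on k U f" "Ck_on k V g" "f ` U \<subseteq> V"
  shows "Ck_on k U (\<lambda>x. g (f x))"
  using assms(2,3)
proof (induction k arbitrary: g)
  case 0
  then show ?case using continuous_on_compose2[OF _ _ assms(4)] by simp
next
  case (Suc k)
  show ?case
  proof (rule Ck_on_SucI)
    fix x assume "x \<in> U"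
    then show "((\<lambda>x. g (f x)) has_derivative
        (\<lambda>v. \<Sum>b\<in>Basis. (frechet_derivative f (at x) v \<bullet> b) *\<^sub>R frechet_derivative g (at (f x)) b)) (at x)"
    proof -
      have g: "(g has_derivative frechet_derivative g (at (f x))) (at (f x))"
        using Ck_on_SucD[OF Suc.prems(2)] \<open>x \<in> U\<close> assms(4) by blast
      have f: "(f has_derivative frechet_derivative f (at x)) (at x)"
        using Ck_on_SucD[OF Suc.prems(1) \<open>x \<in> U\<close>] .
      have lin: "linear (frechet_derivative g (at (f x)))"
        using g has_derivative_linear by blast
      let ?F = "frechet_derivative f (at x)" and ?G = "frechet_derivative g (at (f x))"
      have expand: "?G w = (\<Sum>b\<in>Basis. (w \<bullet> b) *\<^sub>R ?G b)" for w
      proof -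
        have "?G (\<Sum>b\<in>Basis. (w \<bullet> b) *\<^sub>R b) = (\<Sum>b\<in>Basis. ?G ((w \<bullet> b) *\<^sub>R b))"
          by (rule linear_sum[OF lin])
        then show ?thesis
          by (simp only: euclidean_representation linear_cmul[OF lin])
      qed
      have eq: "(\<lambda>v. ?G (?F v)) = (\<lambda>v. \<Sum>b\<in>Basis. (?F v \<bullet> b) *\<^sub>R ?G b)"
        by (rule ext) (rule expand)
      show ?thesis
        by (rule subst[where P = "\<lambda>h. ((\<lambda>x. g (f x)) has_derivative h) (at x)", OF eq])
           (rule has_derivative_compose[OF f g])
    qed
  next
    fix v
    show "Ck_on k U (\<lambda>x. \<Sum>b\<in>Basis. (frechet_derivative f (at x) v \<bullet> b) *\<^sub>R frechet_derivative g (at (f x)) b)"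
    proof (intro Ck_on_sum Ck_on_bilinear[OF \<open>open U\<close> bounded_bilinear_scaleR] \<open>open U\<close>)
      fix b :: 'b assume "b \<in> Basis"
      show "Ck_on k U (\<lambda>x. frechet_derivative f (at x) v \<bullet> b)"
        using Suc.prems(1) by (intro Ck_on_bilinear[OF \<open>open U\<close> bounded_bilinear_inner] Ck_on_const) auto
      show "Ck_on k U (\<lambda>x. frechet_derivative g (at (f x)) b)"
        using Suc.prems by (intro Suc.IH Ck_on_Suc_imp[of k U f]) auto
    qed
  qed (rule assms)
qed

lemma smooth_on_cong: "smooth_on U f \<Longrightarrow> open U \<Longrightarrow> (\<And>x. x \<in> U \<Longrightarrow> f x = g x) \<Longrightarrow> smooth_on U g"
  unfolding smooth_on_def using Ck_on_cong by metis

lemma smooth_on_subset: "smooth_on V f \<Longrightarrow> U \<subseteq> V \<Longrightarrow> smooth_on U f"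
  unfolding smooth_on_def using Ck_on_subset by metis

lemma smooth_on_local:
  assumes "\<And>x. x \<in> U \<Longrightarrow> \<exists>V. open V \<and> x \<in> V \<and> smooth_on V f"
  shows "smooth_on U f"
  unfolding smooth_on_def by (intro allI Ck_on_local) (use assms in \<open>auto simp: smooth_on_def\<close>)

lemma smooth_on_has_derivative:
  "smooth_on U f \<Longrightarrow> x \<in> U \<Longrightarrow> (f has_derivative frechet_derivative f (at x)) (at x)"
  using Ck_on_SucD unfolding smooth_on_def by blast

lemma smooth_on_differentiable: "smooth_on U f \<Longrightarrow> x \<in> U \<Longrightarrow> f differentiable (at x)"
  using smooth_on_has_derivative differentiable_def by blast

lemma smooth_on_imp_continuous_on: "smooth_on U f \<Longrightarrow> continuous_on U f"
  unfolding smooth_on_def by (metis Ck_on.simps(1))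

lemma smooth_on_frechet [smooth_intros]: "smooth_on U f \<Longrightarrow> smooth_on U (\<lambda>x. frechet_derivative f (at x) v)"
  unfolding smooth_on_def by (metis Ck_on.simps(2))

lemma smooth_on_const [smooth_intros]: "smooth_on U (\<lambda>x. c)"
  by (simp add: smooth_on_def Ck_on_const)

lemma smooth_on_bounded_linear: "open U \<Longrightarrow> bounded_linear L \<Longrightarrow> smooth_on U L"
  by (simp add: smooth_on_def Ck_on_bounded_linear)

lemma smooth_on_add [smooth_intros]:
  "open U \<Longrightarrow> smooth_on U f \<Longrightarrow> smooth_on U g \<Longrightarrow> smooth_on U (\<lambda>x. f x + g x)"
  by (simp add: smooth_on_def Ck_on_add)

lemma smooth_on_inner [smooth_intros]:
  "open U \<Longrightarrow> smooth_on U f \<Longrightarrow> smooth_on U g \<Longrightarrow> smooth_on U (\<lambda>x. f x \<bullet> g x)"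
  by (simp add: smooth_on_def Ck_on_bilinear[OF _ bounded_bilinear_inner])

lemma smooth_on_scaleR [smooth_intros]:
  "open U \<Longrightarrow> smooth_on U f \<Longrightarrow> smooth_on U g \<Longrightarrow> smooth_on U (\<lambda>x. f x *\<^sub>R g x)"
  by (simp add: smooth_on_def Ck_on_bilinear[OF _ bounded_bilinear_scaleR])

lemma smooth_on_mult [smooth_intros]:
  fixes f g :: "_ \<Rightarrow> real"
  shows "open U \<Longrightarrow> smooth_on U f \<Longrightarrow> smooth_on U g \<Longrightarrow> smooth_on U (\<lambda>x. f x * g x)"
  by (simp add: smooth_on_def Ck_on_bilinear[OF _ bounded_bilinear_mult])

lemma smooth_on_sum [smooth_intros]:
  "open U \<Longrightarrow> (\<And>i. i \<in> I \<Longrightarrow> smooth_on U (f i)) \<Longrightarrow> smooth_on U (\<lambda>x. \<Sum>i\<in>I. f i x)"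
  by (simp add: smooth_on_def Ck_on_sum)

lemma smooth_on_prod [smooth_intros]:
  fixes f :: "_ \<Rightarrow> _ \<Rightarrow> real"
  shows "open U \<Longrightarrow> (\<And>i. i \<in> I \<Longrightarrow> smooth_on U (f i)) \<Longrightarrow> smooth_on U (\<lambda>x. \<Prod>i\<in>I. f i x)"
  by (induction I rule: infinite_finite_induct) (auto intro: smooth_intros)

lemma smooth_on_minus [smooth_intros]: "open U \<Longrightarrow> smooth_on U f \<Longrightarrow> smooth_on U (\<lambda>x. - f x)"
  using smooth_on_scaleR[of U "\<lambda>x. - 1" f] by (simp add: smooth_on_const)

lemma smooth_on_diff [smooth_intros]:
  "open U \<Longrightarrow> smooth_on U f \<Longrightarrow> smooth_on U g \<Longrightarrow> smooth_on U (\<lambda>x. f x - g x)"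
  using smooth_on_add[of U f "\<lambda>x. - g x"] by (simp add: smooth_on_minus)

lemma smooth_on_compose:
  fixes f :: "'a::real_normed_vector \<Rightarrow> 'b::euclidean_space"
  shows "open U \<Longrightarrow> smooth_on U f \<Longrightarrow> smooth_on V g \<Longrightarrow> f ` U \<subseteq> V \<Longrightarrow> smooth_on U (\<lambda>x. g (f x))"
  unfolding smooth_on_def using Ck_on_compose by blast

lemma smooth_on_inverse_real: "smooth_on (- {0}) (inverse :: real \<Rightarrow> real)"
proof -
  have "Ck_on k (- {0}) (inverse :: real \<Rightarrow> real)" for k
  proof (induction k)
    case 0 then show ?case by (auto intro: continuous_on_inverse continuous_on_id)
  next
    case (Suc k)
    show ?case
    proof (rule Ck_on_SucI[where f' = "\<lambda>x v. (- v) * (inverse x * inverse x)"])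
      show "(inverse has_derivative (\<lambda>v. (- v) * (inverse x * inverse x))) (at x)" if "x \<in> - {0}" for x :: real
        using that by (auto intro!: derivative_eq_intros)
      show "Ck_on k (- {0}) (\<lambda>x. (- v) * (inverse x * inverse x))" for v :: real
        by (intro Ck_on_bilinear[OF _ bounded_bilinear_mult] Ck_on_const Suc) auto
    qed auto
  qed
  then show ?thesis by (simp add: smooth_on_def)
qed

lemma smooth_on_inverse [smooth_intros]:
  fixes f :: "_ \<Rightarrow> real"
  assumes "open U" "smooth_on U f" "\<And>x. x \<in> U \<Longrightarrow> f x \<noteq> 0"
  shows "smooth_on U (\<lambda>x. inverse (f x))"
  using smooth_on_compose[OF assms(1,2) smooth_on_inverse_real] assms(3) by fastforce

lemma smooth_on_divide [smooth_intros]: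
  fixes f g :: "_ \<Rightarrow> real"
  shows "open U \<Longrightarrow> smooth_on U f \<Longrightarrow> smooth_on U g \<Longrightarrow> (\<And>x. x \<in> U \<Longrightarrow> g x \<noteq> 0) \<Longrightarrow> smooth_on U (\<lambda>x. f x / g x)"
  unfolding divide_inverse by (intro smooth_intros) auto

lemma smooth_on_sqrt_real: "smooth_on {0<..} sqrt"
proof -
  have "Ck_on k {0<..} sqrt" for k
  proof (induction k)
    case 0 then show ?case by (auto intro: continuous_on_real_sqrt continuous_on_id)
  next
    case (Suc k)
    have "Ck_on k (- {0}) (inverse :: real \<Rightarrow> real)"
      using smooth_on_inverse_real by (simp add: smooth_on_def)
    then have *: "Ck_on k {0<..} (\<lambda>x. inverse (sqrt x))"
      by (intro Ck_on_compose[OF _ Suc]) auto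
    show ?case
    proof (rule Ck_on_SucI[where f' = "\<lambda>x v. v * (inverse (sqrt x) * (1/2))"])
      show "(sqrt has_derivative (\<lambda>v. v * (inverse (sqrt x) * (1/2)))) (at x)" if "x \<in> {0<..}" for x
        using that by (auto intro!: derivative_eq_intros simp: field_simps)
      show "Ck_on k {0<..} (\<lambda>x. v * (inverse (sqrt x) * (1 / 2)))" for v
        by (intro Ck_on_bilinear[OF _ bounded_bilinear_mult] Ck_on_const *) auto
    qed auto
  qed
  then show ?thesis by (simp add: smooth_on_def)
qed

lemma smooth_on_sqrt [smooth_intros]:
  fixes f :: "_ \<Rightarrow> real"
  assumes "open U" "smooth_on U f" "\<And>x. x \<in> U \<Longrightarrow> f x > 0"
  shows "smooth_on U (\<lambda>x. sqrt (f x))"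
  using smooth_on_compose[OF assms(1,2) smooth_on_sqrt_real] assms(3) by fastforce

lemma smooth_on_det [smooth_intros]:
  fixes A :: "_ \<Rightarrow> real ^ 'n ^ 'n"
  shows "open U \<Longrightarrow> (\<And>i j. smooth_on U (\<lambda>x. A x $ i $ j)) \<Longrightarrow> smooth_on U (\<lambda>x. det (A x))"
  unfolding det_def by (intro smooth_intros) auto

text \<open>The functions \<open>x\<^sup>-\<^sup>k e\<^sup>-\<^sup>1\<^sup>/\<^sup>x\<close>, extended by zero to \<open>x \<le> 0\<close>. Differentiation sends each of them to
  a combination of two others, which makes all of them smooth at once; \<open>k = 0\<close> is the usual cut-off.\<close>

definition exp_cutoff :: "nat \<Rightarrow> real \<Rightarrow> real" where
  "exp_cutoff k x = (if x > 0 then exp (- inverse x) * inverse x ^ k else 0)"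

lemma exp_cutoff_tendsto_0: "(exp_cutoff k \<longlongrightarrow> 0) (at 0)"
proof -
  have "((\<lambda>y. y ^ k / exp y) \<longlongrightarrow> (0::real)) at_top"
    by (rule tendsto_power_div_exp_0)
  then have "((\<lambda>x. inverse x ^ k / exp (inverse x)) \<longlongrightarrow> (0::real)) (at_right 0)"
    by (rule filterlim_compose[OF _ filterlim_inverse_at_top_right])
  then have "(exp_cutoff k \<longlongrightarrow> 0) (at_right 0)"
    by (rule Lim_transform_eventually)
       (auto simp: exp_cutoff_def eventually_at_filter exp_minus field_simps)
  moreover have "(exp_cutoff k \<longlongrightarrow> 0) (at_left 0)"
    by (rule Lim_transform_eventually[OF tendsto_const]) (auto simp: exp_cutoff_def eventually_at_filter)
  ultimately show ?thesis by (simp add: filterlim_at_split)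
qed

lemma exp_cutoff_has_real_derivative:
  "(exp_cutoff k has_real_derivative exp_cutoff (k + 2) x - real k * exp_cutoff (k + 1) x) (at x)"
proof -
  consider "x > 0" | "x < 0" | "x = 0" by linarith
  then show ?thesis
  proof cases
    case 1
    let ?y = "inverse x"
    have "((\<lambda>y. exp (- y) * y ^ k) has_real_derivative exp (- ?y) * (real k * ?y ^ (k - 1)) - exp (- ?y) * ?y ^ k) (at ?y)"
      by (auto intro!: derivative_eq_intros)
    moreover have "(inverse has_real_derivative - (?y ^ 2)) (at x)"
      using 1 by (auto intro!: derivative_eq_intros simp: power2_eq_square)
    ultimately have D: "((\<lambda>x. exp (- inverse x) * inverse x ^ k) has_real_derivative
        (exp (- ?y) * (real k * ?y ^ (k - 1)) - exp (- ?y) * ?y ^ k) * - (?y ^ 2)) (at x)"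
      using DERIV_chain2[where f = "\<lambda>y. exp (- y) * y ^ k" and g = inverse] by blast
    have "(exp (- ?y) * (real k * ?y ^ (k - 1)) - exp (- ?y) * ?y ^ k) * - (?y ^ 2) =
        exp_cutoff (k + 2) x - real k * exp_cutoff (k + 1) x"
      using 1 by (cases k) (auto simp: exp_cutoff_def algebra_simps power2_eq_square)
    from D[unfolded this] have "((\<lambda>x. exp (- inverse x) * inverse x ^ k) has_real_derivative
        exp_cutoff (k + 2) x - real k * exp_cutoff (k + 1) x) (at x)" .
    then show ?thesis
      by (rule has_field_derivative_transform_within_open[where S = "{0<..}"])
         (use 1 in \<open>auto simp: exp_cutoff_def\<close>)
  next
    case 2
    have "((\<lambda>x. 0) has_real_derivative exp_cutoff (k + 2) x - real k * exp_cutoff (k + 1) x) (at x)"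
      using 2 by (simp add: exp_cutoff_def)
    then show ?thesis
      by (rule has_field_derivative_transform_within_open[where S = "{..<0}"])
         (use 2 in \<open>auto simp: exp_cutoff_def\<close>)
  next
    case 3
    have "((\<lambda>h. (exp_cutoff k h - exp_cutoff k 0) / (h - 0)) \<longlongrightarrow> 0) (at 0)"
      by (rule Lim_transform_eventually[OF exp_cutoff_tendsto_0[of "k + 1"]])
         (auto simp: exp_cutoff_def eventually_at_filter divide_inverse)
    then show ?thesis using 3 by (simp add: has_field_derivative_iff exp_cutoff_def)
  qed
qed

lemma smooth_on_exp_cutoff: "smooth_on UNIV (exp_cutoff k)"
proof -
  have "Ck_on m UNIV (exp_cutoff k)" for m
  proof (induction m arbitrary: k)
    case 0
    then show ?case
      using exp_cutoff_has_real_derivative DERIV_isCont by (force intro: continuous_at_imp_continuous_on)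
  next
    case (Suc m)
    have *: "Ck_on m UNIV (\<lambda>x. exp_cutoff (k + 2) x + (- real k) * exp_cutoff (k + 1) x)"
      by (intro Ck_on_add Ck_on_bilinear[OF _ bounded_bilinear_mult] Ck_on_const Suc) auto
    show ?case
    proof (rule Ck_on_SucI)
      show "(exp_cutoff k has_derivative (\<lambda>v. (exp_cutoff (k + 2) x + (- real k) * exp_cutoff (k + 1) x) * v)) (at x)" for x
        using exp_cutoff_has_real_derivative[of k x] by (simp add: has_field_derivative_def)
      show "Ck_on m UNIV (\<lambda>x. (exp_cutoff (k + 2) x + (- real k) * exp_cutoff (k + 1) x) * v)" for v
        by (intro Ck_on_bilinear[OF _ bounded_bilinear_mult] Ck_on_const *) auto
    qed auto
  qed
  then show ?thesis by (simp add: smooth_on_def)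
qed

lemma exp_cutoff_0_bounds: "0 \<le> exp_cutoff 0 x" "exp_cutoff 0 x \<le> 1" "exp_cutoff 0 x > 0 \<longleftrightarrow> x > 0"
  by (auto simp: exp_cutoff_def)

subsection \<open>Symmetry of second derivatives\<close>

text \<open>The second difference of \<open>f\<close> over a small parallelogram does not depend on the order of its two
  directions. By the mean value theorem it is, up to the factor \<open>s\<^sup>2\<close>, a mixed second derivative at a
  point of the parallelogram, for either order; continuity of these derivatives gives their equality.\<close>

lemma second_difference_mvt:
  fixes f :: "'a::real_normed_vector \<Rightarrow> real"
  assumes f: "smooth_on U f" and s: "s > 0"
    and seg: "\<And>a b. 0 \<le> a \<Longrightarrow> a \<le> s \<Longrightarrow> 0 \<le> b \<Longrightarrow> b \<le> s \<Longrightarrow> x + a *\<^sub>R u + b *\<^sub>R v \<in> U"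
  shows "\<exists>a b. 0 < a \<and> a < s \<and> 0 < b \<and> b < s \<and>
    f (x + s *\<^sub>R u + s *\<^sub>R v) - f (x + s *\<^sub>R u) - f (x + s *\<^sub>R v) + f x =
      s * s * frechet_derivative (\<lambda>z. frechet_derivative f (at z) u) (at (x + a *\<^sub>R u + b *\<^sub>R v)) v"
proof -
  let ?D = "\<lambda>z. frechet_derivative f (at z) u"
  have D: "smooth_on U ?D" by (intro smooth_intros f)
  have d1: "((\<lambda>a. f (x + a *\<^sub>R u + b *\<^sub>R v)) has_real_derivative ?D (x + a *\<^sub>R u + b *\<^sub>R v)) (at a)"
    if "0 \<le> a" "a \<le> s" "0 \<le> b" "b \<le> s" for a b
  proof -
    have "((\<lambda>a. x + a *\<^sub>R u + b *\<^sub>R v) has_derivative (\<lambda>h. h *\<^sub>R u)) (at a)"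
      by (auto intro!: derivative_eq_intros)
    from has_derivative_compose[OF this smooth_on_has_derivative[OF f seg[OF that]]]
    show ?thesis
      using linear_cmul[OF has_derivative_linear[OF smooth_on_has_derivative[OF f seg[OF that]]]]
      by (simp add: has_field_derivative_def mult.commute[of _ "frechet_derivative _ _ _"])
  qed
  have d2: "((\<lambda>b. ?D (x + a *\<^sub>R u + b *\<^sub>R v)) has_real_derivative
      frechet_derivative ?D (at (x + a *\<^sub>R u + b *\<^sub>R v)) v) (at b)"
    if "0 \<le> a" "a \<le> s" "0 \<le> b" "b \<le> s" for a b
  proof -
    have "((\<lambda>b. x + a *\<^sub>R u + b *\<^sub>R v) has_derivative (\<lambda>h. h *\<^sub>R v)) (at b)"
      by (auto intro!: derivative_eq_intros)
    from has_derivative_compose[OF this smooth_on_has_derivative[OF D seg[OF that]]]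
    show ?thesis
      using linear_cmul[OF has_derivative_linear[OF smooth_on_has_derivative[OF D seg[OF that]]]]
      by (simp add: has_field_derivative_def mult.commute[of _ "frechet_derivative _ _ _"])
  qed
  let ?g = "\<lambda>a. f (x + a *\<^sub>R u + s *\<^sub>R v) - f (x + a *\<^sub>R u + 0 *\<^sub>R v)"
  have "\<exists>a. 0 < a \<and> a < s \<and> ?g s - ?g 0 = (s - 0) * (?D (x + a *\<^sub>R u + s *\<^sub>R v) - ?D (x + a *\<^sub>R u + 0 *\<^sub>R v))"
    by (rule MVT2[OF s]) (use s in \<open>auto intro!: DERIV_diff d1[of _ s] d1[of _ 0, simplified]\<close>)
  then obtain a where a: "0 < a" "a < s"
    "?g s - ?g 0 = s * (?D (x + a *\<^sub>R u + s *\<^sub>R v) - ?D (x + a *\<^sub>R u + 0 *\<^sub>R v))" by auto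
  have "\<exists>b. 0 < b \<and> b < s \<and> ?D (x + a *\<^sub>R u + s *\<^sub>R v) - ?D (x + a *\<^sub>R u + 0 *\<^sub>R v) =
      (s - 0) * frechet_derivative ?D (at (x + a *\<^sub>R u + b *\<^sub>R v)) v"
    by (rule MVT2[OF s]) (use a in \<open>auto intro!: d2\<close>)
  then obtain b where b: "0 < b" "b < s" "?D (x + a *\<^sub>R u + s *\<^sub>R v) - ?D (x + a *\<^sub>R u + 0 *\<^sub>R v) =
      s * frechet_derivative ?D (at (x + a *\<^sub>R u + b *\<^sub>R v)) v" by auto
  have "f (x + s *\<^sub>R u + s *\<^sub>R v) - f (x + s *\<^sub>R u) - f (x + s *\<^sub>R v) + f x = ?g s - ?g 0" by simp
  also have "\<dots> = s * s * frechet_derivative ?D (at (x + a *\<^sub>R u + b *\<^sub>R v)) v"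
    unfolding a(3) b(3) by simp
  finally show ?thesis using a b by blast
qed

lemma frechet_derivative_symmetric_real:
  fixes f :: "'a::real_normed_vector \<Rightarrow> real"
  assumes f: "smooth_on U f" and "open U" "x \<in> U"
  shows "frechet_derivative (\<lambda>z. frechet_derivative f (at z) u) (at x) v =
         frechet_derivative (\<lambda>z. frechet_derivative f (at z) v) (at x) u" (is "?P x = ?Q x")
proof (rule ccontr)
  assume ne: "?P x \<noteq> ?Q x"
  define e where "e = \<bar>?P x - ?Q x\<bar> / 2"
  have e: "e > 0" using ne by (simp add: e_def)
  have cont: "isCont ?P x" "isCont ?Q x"
    using smooth_on_imp_continuous_on[of U ?P] smooth_on_imp_continuous_on[of U ?Q] assms
    by (auto intro!: smooth_intros simp: continuous_on_eq_continuous_at)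
  obtain d1 where d1: "d1 > 0" "\<And>z. dist z x < d1 \<Longrightarrow> dist (?P z) (?P x) < e"
    using cont(1) e unfolding continuous_at_eps_delta by blast
  obtain d2 where d2: "d2 > 0" "\<And>z. dist z x < d2 \<Longrightarrow> dist (?Q z) (?Q x) < e"
    using cont(2) e unfolding continuous_at_eps_delta by blast
  obtain d3 where d3: "d3 > 0" "ball x d3 \<subseteq> U" using assms open_contains_ball by blast
  define d where "d = min d1 (min d2 d3)"
  define s where "s = d / (2 * (norm u + norm v + 1))"
  have d: "d > 0" using d1 d2 d3 by (simp add: d_def)
  have np: "norm u + norm v + 1 > 0" by (smt (verit) norm_ge_zero)
  have s: "s > 0" using d np by (simp add: s_def)
  have near: "dist (x + a *\<^sub>R u + b *\<^sub>R v) x < d" if "0 \<le> a" "a \<le> s" "0 \<le> b" "b \<le> s" for a b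
  proof -
    have "dist (x + a *\<^sub>R u + b *\<^sub>R v) x \<le> norm (a *\<^sub>R u) + norm (b *\<^sub>R v)"
      by (simp add: dist_norm) (metis norm_scaleR norm_triangle_ineq)
    also have "\<dots> \<le> s * norm u + s * norm v"
      using that by (auto intro!: add_mono mult_right_mono)
    also have "\<dots> \<le> s * (norm u + norm v + 1)" using s by (simp add: algebra_simps)
    also have "\<dots> = d / 2" using np unfolding s_def by (simp add: field_simps)
    also have "\<dots> < d" using d by simp
    finally show ?thesis .
  qed
  have sym: "x + a *\<^sub>R v + b *\<^sub>R u = x + b *\<^sub>R u + a *\<^sub>R v" for a b by simp
  have inU: "x + a *\<^sub>R u + b *\<^sub>R v \<in> U" if "0 \<le> a" "a \<le> s" "0 \<le> b" "b \<le> s" for a b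
    using near[OF that] d3 by (auto simp: d_def dist_commute subset_iff)
  obtain a b where ab: "0 < a" "a < s" "0 < b" "b < s"
    "f (x + s *\<^sub>R u + s *\<^sub>R v) - f (x + s *\<^sub>R u) - f (x + s *\<^sub>R v) + f x = s * s * ?P (x + a *\<^sub>R u + b *\<^sub>R v)"
    using second_difference_mvt[OF f s inU] by blast
  obtain a' b' where ab': "0 < a'" "a' < s" "0 < b'" "b' < s"
    "f (x + s *\<^sub>R v + s *\<^sub>R u) - f (x + s *\<^sub>R v) - f (x + s *\<^sub>R u) + f x = s * s * ?Q (x + a' *\<^sub>R v + b' *\<^sub>R u)"
    using second_difference_mvt[OF f s, of x v u] inU unfolding sym by blast
  have "s * s * ?P (x + a *\<^sub>R u + b *\<^sub>R v) = s * s * ?Q (x + b' *\<^sub>R u + a' *\<^sub>R v)"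
    using ab(5) ab'(5) unfolding sym by linarith
  then have "?P (x + a *\<^sub>R u + b *\<^sub>R v) = ?Q (x + b' *\<^sub>R u + a' *\<^sub>R v)"
    using s by simp
  moreover have "dist (?P (x + a *\<^sub>R u + b *\<^sub>R v)) (?P x) < e"
    using near[of a b] ab by (intro d1) (auto simp: d_def)
  moreover have "dist (?Q (x + b' *\<^sub>R u + a' *\<^sub>R v)) (?Q x) < e"
    using near[of b' a'] ab' by (intro d2) (auto simp: d_def)
  ultimately show False unfolding dist_real_def e_def by argo
qed

lemma frechet_derivative_symmetric:
  fixes f :: "'a::real_normed_vector \<Rightarrow> 'b::euclidean_space"
  assumes f: "smooth_on U f" and U: "open U" "x \<in> U"
  shows "frechet_derivative (\<lambda>z. frechet_derivative f (at z) u) (at x) v =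
         frechet_derivative (\<lambda>z. frechet_derivative f (at z) v) (at x) u"
proof -
  have comp: "frechet_derivative (\<lambda>z. g z \<bullet> w) (at z) a = frechet_derivative g (at z) a \<bullet> w"
    if "smooth_on U g" "z \<in> U" for g :: "'a \<Rightarrow> 'b" and z a w
    using frechet_derivative_at[OF has_derivative_inner_left[OF smooth_on_has_derivative[OF that], of w], symmetric]
    by simp
  have second: "frechet_derivative (\<lambda>z. frechet_derivative (\<lambda>z. f z \<bullet> w) (at z) a) (at x) b =
      frechet_derivative (\<lambda>z. frechet_derivative f (at z) a) (at x) b \<bullet> w" for a b w
  proof -
    have "frechet_derivative (\<lambda>z. frechet_derivative (\<lambda>z. f z \<bullet> w) (at z) a) (at x) =
        frechet_derivative (\<lambda>z. frechet_derivative f (at z) a \<bullet> w) (at x)"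
      by (rule frechet_derivative_transform_within_open[OF _ U])
         (use comp[OF f] in \<open>auto intro!: smooth_on_differentiable[OF _ U(2)] smooth_intros f U\<close>)
    then show ?thesis using comp[OF smooth_on_frechet[OF f] U(2)] by simp
  qed
  show ?thesis
  proof (rule euclidean_eqI)
    fix w :: 'b
    have "smooth_on U (\<lambda>z. f z \<bullet> w)" by (intro smooth_intros f U)
    from frechet_derivative_symmetric_real[OF this U, of u v]
    show "frechet_derivative (\<lambda>z. frechet_derivative f (at z) u) (at x) v \<bullet> w =
         frechet_derivative (\<lambda>z. frechet_derivative f (at z) v) (at x) u \<bullet> w"
      unfolding second .
  qed
qed

section \<open>Frames, Gram matrices and determinants\<close>

definition gram_matrix :: "('n::finite \<Rightarrow> 'v::real_inner) \<Rightarrow> real ^ 'n ^ 'n" where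
  "gram_matrix e = (\<chi> i j. e i \<bullet> e j)"

definition dual_frame :: "('n::finite \<Rightarrow> 'v::real_inner) \<Rightarrow> 'n \<Rightarrow> 'v" where
  "dual_frame e i = (\<Sum>j\<in>UNIV. matrix_inv (gram_matrix e) $ i $ j *\<^sub>R e j)"

definition indep_frame :: "('n::finite \<Rightarrow> 'v::real_vector) \<Rightarrow> bool" where
  "indep_frame e \<longleftrightarrow> (\<forall>c. (\<Sum>i\<in>UNIV. c i *\<^sub>R e i) = 0 \<longrightarrow> (\<forall>i. c i = 0))"

lemma gram_matrix_quadratic_form:
  "v \<bullet> (gram_matrix e *v v) = (norm (\<Sum>i\<in>UNIV. (v $ i) *\<^sub>R e i))\<^sup>2"
  unfolding power2_norm_eq_inner
  by (simp add: gram_matrix_def matrix_vector_mult_def inner_vec_def inner_sum_left inner_sum_right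
      sum_distrib_left inner_commute mult_ac)

text \<open>The determinant cannot change sign on the segment from the identity to the Gram matrix,
  because all matrices on it are positive definite.\<close>

lemma det_gram_matrix_pos:
  assumes "indep_frame e"
  shows "det (gram_matrix e) > 0"
proof (rule ccontr)
  assume neg: "\<not> det (gram_matrix e) > 0"
  define A where "A t = (1 - t) *\<^sub>R mat 1 + t *\<^sub>R gram_matrix e" for t :: real
  have "smooth_on UNIV (\<lambda>t. det (A t))"
    unfolding A_def by (intro smooth_intros open_UNIV)
      (simp, intro smooth_intros open_UNIV smooth_on_bounded_linear[of UNIV "\<lambda>x. x"] bounded_linear_ident)
  then have "continuous_on {0..1} (\<lambda>t. det (A t))"
    by (rule continuous_on_subset[OF smooth_on_imp_continuous_on]) simp
  moreover have "det (A 1) \<le> 0" "0 \<le> det (A 0)" using neg by (auto simp: A_def)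
  ultimately obtain t where t: "0 \<le> t" "t \<le> 1" "det (A t) = 0"
    using IVT2'[of "\<lambda>t. det (A t)" 1 0 0] by auto
  then have "\<not> invertible (A t)" by (simp add: invertible_det_nz)
  then obtain v where v: "A t *v v = 0" "v \<noteq> 0"
    using matrix_left_invertible_ker[of "A t"] by (auto simp: invertible_left_inverse)
  have "0 = v \<bullet> (A t *v v)" using v by simp
  also have "\<dots> = (1 - t) * (v \<bullet> v) + t * (v \<bullet> (gram_matrix e *v v))"
    by (simp add: A_def matrix_vector_mult_add_rdistrib scaleR_matrix_vector_assoc[symmetric] inner_add_right)
  finally have sum0: "(1 - t) * (v \<bullet> v) + t * (norm (\<Sum>i\<in>UNIV. (v $ i) *\<^sub>R e i))\<^sup>2 = 0"
    by (simp add: gram_matrix_quadratic_form)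
  have "(1 - t) * (v \<bullet> v) = 0" "t * (norm (\<Sum>i\<in>UNIV. (v $ i) *\<^sub>R e i))\<^sup>2 = 0"
    using sum0 t by (smt (verit) inner_ge_zero mult_nonneg_nonneg zero_le_power2)+
  then have "t = 1" "(\<Sum>i\<in>UNIV. (v $ i) *\<^sub>R e i) = 0" using v(2) by auto
  then have "v = 0" using assms by (auto simp: indep_frame_def vec_eq_iff)
  then show False using v by simp
qed

lemma matrix_inv_inverse:
  fixes A :: "'a::semiring_1 ^ 'n::finite ^ 'n"
  assumes "invertible A"
  shows "matrix_inv A ** A = mat 1" and "A ** matrix_inv A = mat 1"
  using assms unfolding invertible_def matrix_inv_def by (metis (mono_tags, lifting) someI_ex)+

lemma gram_matrix_inverse:
  assumes "indep_frame e"
  shows "matrix_inv (gram_matrix e) ** gram_matrix e = mat 1"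
    and "gram_matrix e ** matrix_inv (gram_matrix e) = mat 1"
proof -
  have "invertible (gram_matrix e)"
    using det_gram_matrix_pos[OF assms] by (simp add: invertible_det_nz)
  then show "matrix_inv (gram_matrix e) ** gram_matrix e = mat 1"
    "gram_matrix e ** matrix_inv (gram_matrix e) = mat 1"
    by (rule matrix_inv_inverse)+
qed

lemma dual_frame_inner:
  assumes "indep_frame e"
  shows "dual_frame e i \<bullet> e j = (if i = j then 1 else 0)"
proof -
  have "dual_frame e i \<bullet> e j = (matrix_inv (gram_matrix e) ** gram_matrix e) $ i $ j"
    by (simp add: dual_frame_def gram_matrix_def matrix_matrix_mult_def inner_sum_left)
  then show ?thesis by (simp add: gram_matrix_inverse[OF assms] mat_def)
qed

lemma dual_frame_in_span: "dual_frame e i \<in> span (range e)"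
  unfolding dual_frame_def by (intro span_sum span_mul span_base) auto

lemma span_range_frame:
  fixes e :: "'n::finite \<Rightarrow> 'v::real_vector"
  assumes "w \<in> span (range e)"
  obtains c where "w = (\<Sum>i\<in>UNIV. c i *\<^sub>R e i)"
proof -
  have "\<exists>c. w = (\<Sum>i\<in>UNIV. c i *\<^sub>R e i)"
    using assms
  proof (induction rule: span_induct_alt)
    case base
    show ?case by (rule exI[of _ "\<lambda>_. 0"]) simp
  next
    case (step a x y)
    obtain i c where "x = e i" "y = (\<Sum>i\<in>UNIV. c i *\<^sub>R e i)" using step by auto
    then have "a *\<^sub>R x + y = (\<Sum>j\<in>UNIV. (c j + (if j = i then a else 0)) *\<^sub>R e j)"
      by (simp add: scaleR_add_left sum.distrib if_distrib[of "\<lambda>a. a *\<^sub>R _"] sum.delta cong: if_cong)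
    then show ?case by (intro exI[of _ "\<lambda>j. c j + (if j = i then a else 0)"])
  qed
  then show ?thesis using that by blast
qed

lemma frame_expansion:
  assumes "indep_frame e" "w \<in> span (range e)"
  shows "w = (\<Sum>i\<in>UNIV. (w \<bullet> dual_frame e i) *\<^sub>R e i)"
proof -
  obtain c where c: "w = (\<Sum>i\<in>UNIV. c i *\<^sub>R e i)" using span_range_frame[OF assms(2)] .
  have "w \<bullet> dual_frame e i = c i" for i
    unfolding c inner_commute[of _ "dual_frame e i"]
    by (simp add: inner_sum_right dual_frame_inner[OF assms(1)] if_distrib[of "\<lambda>a. _ * a"] cong: if_cong)
  then show ?thesis using c by simp
qed

text \<open>A pair of dual frames resolves the identity on the space that they span, so that the inner
  product with a vector of that space can be computed in coordinates.\<close>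

lemma dual_frame_inner_expansion:
  assumes "indep_frame e" "w \<in> span (range e)"
  shows "(\<Sum>i\<in>UNIV. (dual_frame e i \<bullet> z) * (e i \<bullet> w)) = z \<bullet> w"
    and "(\<Sum>i\<in>UNIV. (e i \<bullet> z) * (dual_frame e i \<bullet> w)) = z \<bullet> w"
proof -
  show "(\<Sum>i\<in>UNIV. (e i \<bullet> z) * (dual_frame e i \<bullet> w)) = z \<bullet> w"
    by (subst (2) frame_expansion[OF assms]) (simp add: inner_sum_right inner_commute mult.commute)
  have "(\<Sum>i\<in>UNIV. (dual_frame e i \<bullet> z) * (e i \<bullet> w)) =
      (\<Sum>i\<in>UNIV. \<Sum>j\<in>UNIV. matrix_inv (gram_matrix e) $ i $ j * (e j \<bullet> z) * (e i \<bullet> w))"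
    by (simp add: dual_frame_def inner_sum_left sum_distrib_right)
  also have "\<dots> = (\<Sum>j\<in>UNIV. \<Sum>i\<in>UNIV. matrix_inv (gram_matrix e) $ i $ j * (e j \<bullet> z) * (e i \<bullet> w))"
    by (rule sum.swap)
  also have "\<dots> = (\<Sum>j\<in>UNIV. (e j \<bullet> z) * (dual_frame e j \<bullet> w))"
  proof (rule sum.cong[OF refl])
    fix j
    obtain c where c: "w = (\<Sum>i\<in>UNIV. c i *\<^sub>R e i)" using span_range_frame[OF assms(2)] .
    have "(\<Sum>i\<in>UNIV. matrix_inv (gram_matrix e) $ i $ j * (e i \<bullet> w)) =
        (\<Sum>i\<in>UNIV. \<Sum>k\<in>UNIV. matrix_inv (gram_matrix e) $ i $ j * (e i \<bullet> e k) * c k)"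
      unfolding c by (simp add: inner_sum_right sum_distrib_left mult_ac)
    also have "\<dots> = (\<Sum>k\<in>UNIV. \<Sum>i\<in>UNIV. matrix_inv (gram_matrix e) $ i $ j * (e i \<bullet> e k) * c k)"
      by (rule sum.swap)
    also have "\<dots> = (\<Sum>k\<in>UNIV. (gram_matrix e ** matrix_inv (gram_matrix e)) $ k $ j * c k)"
      by (simp add: matrix_matrix_mult_def gram_matrix_def sum_distrib_left sum_distrib_right inner_commute mult_ac)
    also have "\<dots> = dual_frame e j \<bullet> w"
      by (simp add: gram_matrix_inverse[OF assms(1)] mat_def c inner_sum_right dual_frame_inner[OF assms(1)]
          if_distrib[of "\<lambda>a. a * _"] if_distrib[of "\<lambda>a. _ * a"] sum.delta sum.delta' cong: if_cong)
    finally have "(e j \<bullet> z) * (\<Sum>i\<in>UNIV. matrix_inv (gram_matrix e) $ i $ j * (e i \<bullet> w)) =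
        (e j \<bullet> z) * (dual_frame e j \<bullet> w)" by simp
    then show "(\<Sum>i\<in>UNIV. matrix_inv (gram_matrix e) $ i $ j * (e j \<bullet> z) * (e i \<bullet> w)) =
        (e j \<bullet> z) * (dual_frame e j \<bullet> w)"
      by (simp add: sum_distrib_left mult_ac)
  qed
  also have "\<dots> = z \<bullet> w" by fact
  finally show "(\<Sum>i\<in>UNIV. (dual_frame e i \<bullet> z) * (e i \<bullet> w)) = z \<bullet> w" .
qed

subsection \<open>Orthonormal bases of subspaces\<close>

lemma onb_properties:
  fixes T :: "'v::euclidean_space set"
  assumes "subspace T"
  shows "onb T \<subseteq> T" "pairwise orthogonal (onb T)" "\<And>b. b \<in> onb T \<Longrightarrow> norm b = 1" "span (onb T) = T"
    "finite (onb T)"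
proof -
  have "\<exists>B. B \<subseteq> T \<and> pairwise orthogonal B \<and> (\<forall>b\<in>B. norm b = 1) \<and> span B = T"
    using orthonormal_basis_subspace[OF assms] by metis
  then have *: "onb T \<subseteq> T \<and> pairwise orthogonal (onb T) \<and> (\<forall>b\<in>onb T. norm b = 1) \<and> span (onb T) = T"
    unfolding onb_def by (rule someI_ex)
  then show "onb T \<subseteq> T" "pairwise orthogonal (onb T)" "\<And>b. b \<in> onb T \<Longrightarrow> norm b = 1" "span (onb T) = T"
    by auto
  show "finite (onb T)"
    using * pairwise_orthogonal_imp_finite by blast
qed

text \<open>The difference of \<open>w\<close> and its expansion lies in \<open>T\<close> and is orthogonal to a basis of \<open>T\<close>.\<close>

lemma onb_expansion:
  fixes T :: "'v::euclidean_space set"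
  assumes "subspace T" "w \<in> T"
  shows "(\<Sum>b\<in>onb T. (w \<bullet> b) *\<^sub>R b) = w"
proof -
  note o = onb_properties[OF assms(1)]
  let ?r = "w - (\<Sum>b\<in>onb T. (w \<bullet> b) *\<^sub>R b)"
  have orth: "orthogonal ?r b" if "b \<in> onb T" for b
  proof -
    have "(\<Sum>c\<in>onb T. (w \<bullet> c) * (c \<bullet> b)) = (\<Sum>c\<in>onb T. if c = b then w \<bullet> c else 0)"
      using o(2) o(3) that by (intro sum.cong refl) (auto simp: pairwise_def orthogonal_def norm_eq_1)
    then show ?thesis
      using that o(5) by (simp add: orthogonal_def inner_diff_left inner_sum_left)
  qed
  have "?r \<in> span (onb T)"
    unfolding o(4) using o(1) assms by (intro subspace_diff subspace_sum subspace_scale) auto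
  then have "orthogonal ?r ?r"
    using orthogonal_to_span orth by blast
  then show ?thesis by (simp add: orthogonal_self)
qed

lemma onb_parseval:
  fixes T :: "'v::euclidean_space set"
  assumes "subspace T" "w \<in> T"
  shows "(\<Sum>b\<in>onb T. (w \<bullet> b) * (b \<bullet> z)) = w \<bullet> z"
  by (subst (2) onb_expansion[OF assms, symmetric]) (simp add: inner_sum_left)

lemma orth_proj_ident: "subspace T \<Longrightarrow> w \<in> T \<Longrightarrow> orth_proj T w = w"
  unfolding orth_proj_def by (rule onb_expansion)

text \<open>An orthonormal basis and a pair of dual frames resolve the same identity, so traces over the former
  can be computed in the latter.\<close>

lemma onb_sum_in_frame:
  fixes e :: "'n::finite \<Rightarrow> 'v::euclidean_space" and L K :: "'v \<Rightarrow> 'w::real_inner"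
  assumes e: "indep_frame e" and T: "T = span (range e)"
    and L: "\<And>c. L (\<Sum>i\<in>UNIV. c i *\<^sub>R e i) = (\<Sum>i\<in>UNIV. c i *\<^sub>R L (e i))"
    and K: "\<And>c. K (\<Sum>i\<in>UNIV. c i *\<^sub>R e i) = (\<Sum>i\<in>UNIV. c i *\<^sub>R K (e i))"
  shows "(\<Sum>b\<in>onb T. L b \<bullet> K b) =
    (\<Sum>i\<in>UNIV. \<Sum>j\<in>UNIV. (dual_frame e i \<bullet> dual_frame e j) * (L (e i) \<bullet> K (e j)))"
proof -
  have sub: "subspace T" by (simp add: T)
  note o = onb_properties[OF sub]
  let ?E = "dual_frame e"
  have "(\<Sum>b\<in>onb T. L b \<bullet> K b) =
      (\<Sum>b\<in>onb T. \<Sum>i\<in>UNIV. \<Sum>j\<in>UNIV. ((?E i \<bullet> b) * (b \<bullet> ?E j)) * (L (e i) \<bullet> K (e j)))"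
  proof (rule sum.cong[OF refl])
    fix b assume "b \<in> onb T"
    then have b: "b = (\<Sum>i\<in>UNIV. (b \<bullet> ?E i) *\<^sub>R e i)"
      using o(1) by (intro frame_expansion[OF e]) (auto simp: T)
    have "L b \<bullet> K b = (\<Sum>i\<in>UNIV. (b \<bullet> ?E i) *\<^sub>R L (e i)) \<bullet> (\<Sum>i\<in>UNIV. (b \<bullet> ?E i) *\<^sub>R K (e i))"
      by (subst (1 2) b) (simp only: L K)
    also have "\<dots> = (\<Sum>i\<in>UNIV. \<Sum>j\<in>UNIV. ((?E i \<bullet> b) * (b \<bullet> ?E j)) * (L (e i) \<bullet> K (e j)))"
      unfolding inner_sum_left unfolding inner_sum_right
      by (simp add: inner_commute[of b] mult_ac)
    finally show "L b \<bullet> K b = (\<Sum>i\<in>UNIV. \<Sum>j\<in>UNIV. ((?E i \<bullet> b) * (b \<bullet> ?E j)) * (L (e i) \<bullet> K (e j)))" .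
  qed
  also have "\<dots> = (\<Sum>i\<in>UNIV. \<Sum>b\<in>onb T. \<Sum>j\<in>UNIV. ((?E i \<bullet> b) * (b \<bullet> ?E j)) * (L (e i) \<bullet> K (e j)))"
    by (rule sum.swap)
  also have "\<dots> = (\<Sum>i\<in>UNIV. \<Sum>j\<in>UNIV. \<Sum>b\<in>onb T. ((?E i \<bullet> b) * (b \<bullet> ?E j)) * (L (e i) \<bullet> K (e j)))"
    by (intro sum.cong refl sum.swap)
  also have "\<dots> = (\<Sum>i\<in>UNIV. \<Sum>j\<in>UNIV. (?E i \<bullet> ?E j) * (L (e i) \<bullet> K (e j)))"
    by (intro sum.cong refl)
       (simp add: onb_parseval[OF sub] dual_frame_in_span[of e, folded T] flip: sum_distrib_right)
  finally show ?thesis .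
qed

lemma onb_trace_in_frame:
  fixes e :: "'n::finite \<Rightarrow> 'v::euclidean_space" and L :: "'v \<Rightarrow> 'v"
  assumes e: "indep_frame e" and T: "T = span (range e)"
    and L: "\<And>c. L (\<Sum>i\<in>UNIV. c i *\<^sub>R e i) = (\<Sum>i\<in>UNIV. c i *\<^sub>R L (e i))"
  shows "(\<Sum>b\<in>onb T. L b \<bullet> b) = (\<Sum>i\<in>UNIV. L (e i) \<bullet> dual_frame e i)"
proof -
  have sub: "subspace T" by (simp add: T)
  note o = onb_properties[OF sub]
  let ?E = "dual_frame e"
  have "(\<Sum>b\<in>onb T. L b \<bullet> b) = (\<Sum>b\<in>onb T. \<Sum>i\<in>UNIV. (?E i \<bullet> b) * (b \<bullet> L (e i)))"
  proof (rule sum.cong[OF refl])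
    fix b assume "b \<in> onb T"
    then have b: "b = (\<Sum>i\<in>UNIV. (b \<bullet> ?E i) *\<^sub>R e i)"
      using o(1) by (intro frame_expansion[OF e]) (auto simp: T)
    have "L b = (\<Sum>i\<in>UNIV. (b \<bullet> ?E i) *\<^sub>R L (e i))"
      by (subst b) (simp only: L)
    then show "L b \<bullet> b = (\<Sum>i\<in>UNIV. (?E i \<bullet> b) * (b \<bullet> L (e i)))"
      by (simp add: inner_sum_left inner_commute[of b])
  qed
  also have "\<dots> = (\<Sum>i\<in>UNIV. \<Sum>b\<in>onb T. (?E i \<bullet> b) * (b \<bullet> L (e i)))" by (rule sum.swap)
  also have "\<dots> = (\<Sum>i\<in>UNIV. L (e i) \<bullet> ?E i)"
    by (intro sum.cong refl, subst onb_parseval[OF sub dual_frame_in_span[of e, folded T]]) (rule inner_commute)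
  finally show ?thesis .
qed

subsection \<open>Derivatives of determinants and inverse matrices\<close>

text \<open>A permutation other than the identity moves at least two points, so near the identity matrix
  only the diagonal product contributes to first order.\<close>

lemma has_derivative_det_at_identity:
  fixes A :: "'a::real_normed_vector \<Rightarrow> real ^ 'n::finite ^ 'n"
  assumes "\<And>i j. ((\<lambda>x. A x $ i $ j) has_derivative A' i j) (at x)" and "A x = mat 1"
  shows "((\<lambda>x. det (A x)) has_derivative (\<lambda>v. \<Sum>i\<in>UNIV. A' i i v)) (at x)"
proof -
  let ?P = "{p. p permutes (UNIV :: 'n set)}"
  let ?t = "\<lambda>p v. of_int (sign p) * (\<Sum>i\<in>UNIV. A' i (p i) v * (\<Prod>j\<in>UNIV - {i}. A x $ j $ p j))"
  have "((\<lambda>x. det (A x)) has_derivative (\<lambda>v. \<Sum>p\<in>?P. ?t p v)) (at x)"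
    unfolding det_def
    by (intro has_derivative_sum has_derivative_mult_right has_derivative_prod assms)
  also have "(\<lambda>v. \<Sum>p\<in>?P. ?t p v) = (\<lambda>v. \<Sum>i\<in>UNIV. A' i i v)"
  proof
    fix v
    have zero: "?t p v = 0" if p: "p \<in> ?P - {id}" for p
    proof -
      have "(\<Prod>j\<in>UNIV - {i}. A x $ j $ p j) = 0" for i
      proof -
        have "\<exists>j. j \<noteq> i \<and> p j \<noteq> j"
        proof (rule ccontr)
          assume "\<not> ?thesis"
          then have fix': "\<And>j. j \<noteq> i \<Longrightarrow> p j = j" by blast
          have "inj p" using p permutes_inj by blast
          then have "p i = i" using fix' by (metis injD)
          then have "p = id" using fix' by (intro ext) (metis id_apply)
          then show False using p by simp
        qed
        then obtain j where j: "j \<noteq> i" "p j \<noteq> j" by blast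
        then have "A x $ j $ p j = 0" by (simp add: assms(2) mat_def)
        with j show ?thesis by (intro prod_zero) auto
      qed
      then show ?thesis by (simp only: mult_zero_right sum.neutral_const)
    qed
    have "(\<Sum>p\<in>?P. ?t p v) = ?t id v + (\<Sum>p\<in>?P - {id}. ?t p v)"
      by (rule sum.remove) (auto simp: permutes_id finite_permutations)
    also have "\<dots> = (\<Sum>i\<in>UNIV. A' i i v)"
      using zero by (simp add: assms(2) mat_def sign_id)
    finally show "(\<Sum>p\<in>?P. ?t p v) = (\<Sum>i\<in>UNIV. A' i i v)" .
  qed
  finally show ?thesis .
qed

text \<open>Jacobi's formula. Multiplication by the inverse of the matrix at the point in question moves that
  matrix to the identity.\<close>

lemma has_derivative_det:
  fixes A :: "'a::real_normed_vector \<Rightarrow> real ^ 'n::finite ^ 'n"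
  assumes A: "\<And>i j. ((\<lambda>x. A x $ i $ j) has_derivative A' i j) (at x)"
    and B: "B ** A x = mat 1"
  shows "((\<lambda>x. det (A x)) has_derivative
    (\<lambda>v. det (A x) * (\<Sum>i\<in>UNIV. \<Sum>k\<in>UNIV. B $ i $ k * A' k i v))) (at x)"
proof -
  have AB: "A x ** B = mat 1" using B matrix_left_right_inverse by blast
  have eq: "det (A z) = det (A x) * det (B ** A z)" for z
  proof -
    have "A z = A x ** (B ** A z)" by (simp add: matrix_mul_assoc AB)
    then show ?thesis by (metis det_mul)
  qed
  have "((\<lambda>z. det (B ** A z)) has_derivative (\<lambda>v. \<Sum>i\<in>UNIV. \<Sum>k\<in>UNIV. B $ i $ k * A' k i v)) (at x)"
    by (rule has_derivative_det_at_identity[where A' = "\<lambda>i j v. \<Sum>k\<in>UNIV. B $ i $ k * A' k j v"])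
       (simp add: matrix_matrix_mult_def, intro has_derivative_sum has_derivative_mult_right A, rule B)
  from has_derivative_mult_right[OF this, of "det (A x)"] show ?thesis
    by (rule subst[where P = "\<lambda>h. (h has_derivative _) (at x)", OF ext[OF eq[symmetric]]])
qed

text \<open>The entries of the inverse are quotients of determinants, by Cramer's rule.\<close>

lemma smooth_on_matrix_inv:
  fixes A :: "'a::real_normed_vector \<Rightarrow> real ^ 'n::finite ^ 'n"
  assumes "open U" and A: "\<And>i j. smooth_on U (\<lambda>x. A x $ i $ j)" and "\<And>x. x \<in> U \<Longrightarrow> det (A x) \<noteq> 0"
  shows "smooth_on U (\<lambda>x. matrix_inv (A x) $ i $ k)"
proof (rule smooth_on_cong)
  let ?N = "\<lambda>x. (\<chi> a b. if b = i then axis k 1 $ a else A x $ a $ b) :: real ^ 'n ^ 'n"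
  have "smooth_on U (\<lambda>x. ?N x $ a $ b)" for a b
    by (cases "b = i") (auto intro: smooth_intros A)
  then show "smooth_on U (\<lambda>x. det (?N x) / det (A x))"
    by (intro smooth_intros assms) auto
  show "open U" by fact
  fix x assume "x \<in> U"
  then have nz: "det (A x) \<noteq> 0" using assms by blast
  then have "A x *v (matrix_inv (A x) *v axis k 1) = axis k 1"
    by (simp add: matrix_vector_mul_assoc matrix_inv_inverse invertible_det_nz)
  then have "matrix_inv (A x) *v axis k 1 = (\<chi> i. det (\<chi> a b. if b = i then axis k 1 $ a else A x $ a $ b) / det (A x))"
    using cramer[OF nz] by blast
  then have "(matrix_inv (A x) *v axis k 1) $ i = det (?N x) / det (A x)" by simp
  then show "det (?N x) / det (A x) = matrix_inv (A x) $ i $ k"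
    by (simp add: matrix_vector_mult_basis column_def)
qed

section \<open>The Laplacian of an immersed chart\<close>

definition pd :: "(real ^ 'n::finite \<Rightarrow> 'b::real_normed_vector) \<Rightarrow> 'n \<Rightarrow> real ^ 'n \<Rightarrow> 'b" where
  "pd f i x = frechet_derivative f (at x) (axis i 1)"

lemma smooth_on_pd [smooth_intros]: "smooth_on U f \<Longrightarrow> smooth_on U (pd f i)"
  unfolding pd_def by (rule smooth_on_frechet)

lemma pd_cong:
  assumes "open U" "x \<in> U" "\<And>z. z \<in> U \<Longrightarrow> f z = g z" "smooth_on U f"
  shows "pd f i x = pd g i x"
  using frechet_derivative_transform_within_open[OF smooth_on_differentiable[OF assms(4,2)] assms(1,2,3)]
  by (simp add: pd_def)

lemma pd_eqI: "(f has_derivative f') (at x) \<Longrightarrow> pd f i x = f' (axis i 1)"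
  unfolding pd_def using frechet_derivative_at by metis

lemma pd_const: "pd (\<lambda>x. c) i x = 0"
  by (rule pd_eqI) (auto intro!: derivative_eq_intros)

lemma pd_inner:
  "smooth_on U f \<Longrightarrow> smooth_on U g \<Longrightarrow> x \<in> U \<Longrightarrow> pd (\<lambda>x. f x \<bullet> g x) i x = f x \<bullet> pd g i x + pd f i x \<bullet> g x"
  by (subst pd_eqI[OF has_derivative_inner[OF smooth_on_has_derivative smooth_on_has_derivative]])
     (auto simp: pd_def)

lemma pd_mult:
  fixes f g :: "_ \<Rightarrow> real"
  shows "smooth_on U f \<Longrightarrow> smooth_on U g \<Longrightarrow> x \<in> U \<Longrightarrow> pd (\<lambda>x. f x * g x) i x = f x * pd g i x + pd f i x * g x"
  by (subst pd_eqI[OF has_derivative_mult[OF smooth_on_has_derivative smooth_on_has_derivative]])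
     (auto simp: pd_def)

lemma pd_sum:
  "(\<And>k. k \<in> K \<Longrightarrow> smooth_on U (f k)) \<Longrightarrow> x \<in> U \<Longrightarrow> pd (\<lambda>x. \<Sum>k\<in>K. f k x) i x = (\<Sum>k\<in>K. pd (f k) i x)"
  by (subst pd_eqI[OF has_derivative_sum[OF smooth_on_has_derivative]]) (auto simp: pd_def)

lemma pd_symmetric:
  fixes f :: "_ \<Rightarrow> 'b::euclidean_space"
  shows "smooth_on U f \<Longrightarrow> open U \<Longrightarrow> x \<in> U \<Longrightarrow> pd (pd f i) j x = pd (pd f j) i x"
  unfolding pd_def by (rule frechet_derivative_symmetric)

lemma frechet_derivative_pd:
  assumes "(f has_derivative frechet_derivative f (at x)) (at x)"
  shows "frechet_derivative f (at x) v = (\<Sum>i\<in>UNIV. v $ i *\<^sub>R pd f i x)"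
proof -
  have "v = (\<Sum>i\<in>UNIV. v $ i *\<^sub>R axis i 1)"
    by (simp add: basis_expansion flip: scalar_mult_eq_scaleR)
  then have "frechet_derivative f (at x) v = frechet_derivative f (at x) (\<Sum>i\<in>UNIV. v $ i *\<^sub>R axis i 1)" by simp
  also have "\<dots> = (\<Sum>i\<in>UNIV. frechet_derivative f (at x) (v $ i *\<^sub>R axis i 1))"
    by (rule linear_sum[OF has_derivative_linear[OF assms]])
  also have "\<dots> = (\<Sum>i\<in>UNIV. v $ i *\<^sub>R pd f i x)"
    unfolding pd_def by (rule sum.cong[OF refl]) (rule linear_cmul[OF has_derivative_linear[OF assms]])
  finally show ?thesis .
qed

text \<open>The index computation behind the coordinate formula for the Laplacian: the contracted
  Christoffel symbols that come from the volume density cancel against one of the two terms of the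
  derivative of the inverse metric.\<close>

lemma christoffel_cancellation:
  fixes g :: "'n::finite \<Rightarrow> 'n \<Rightarrow> real" and G :: "'n \<Rightarrow> 'n \<Rightarrow> 'n \<Rightarrow> real"
  assumes G: "\<And>i j k. G k i j = G k j i" and g: "\<And>i j. g i j = g j i"
  shows "(\<Sum>j\<in>UNIV. (\<Sum>k\<in>UNIV. G k k j) * (\<Sum>i\<in>UNIV. g i j * a i) +
      (\<Sum>i\<in>UNIV. (- (\<Sum>k\<in>UNIV. g j k * G i k j) - (\<Sum>k\<in>UNIV. g i k * G j k j)) * a i + g i j * b i j)) =
    (\<Sum>i\<in>UNIV. \<Sum>j\<in>UNIV. g i j * (b i j - (\<Sum>k\<in>UNIV. G k i j * a k)))"
proof -
  have 1: "(\<Sum>j\<in>UNIV. (\<Sum>k\<in>UNIV. G k k j) * (\<Sum>i\<in>UNIV. g i j * a i)) =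
      (\<Sum>j\<in>UNIV. \<Sum>i\<in>UNIV. (\<Sum>k\<in>UNIV. g i k * G j k j) * a i)"
  proof -
    have "(\<Sum>j\<in>UNIV. (\<Sum>k\<in>UNIV. G k k j) * (\<Sum>i\<in>UNIV. g i j * a i)) =
        (\<Sum>j\<in>UNIV. \<Sum>k\<in>UNIV. \<Sum>i\<in>UNIV. G k k j * (g i j * a i))"
      unfolding sum_distrib_right unfolding sum_distrib_left ..
    also have "\<dots> = (\<Sum>k\<in>UNIV. \<Sum>j\<in>UNIV. \<Sum>i\<in>UNIV. G k k j * (g i j * a i))" by (rule sum.swap)
    also have "\<dots> = (\<Sum>k\<in>UNIV. \<Sum>i\<in>UNIV. \<Sum>j\<in>UNIV. G k k j * (g i j * a i))"
      by (rule sum.cong[OF refl]) (rule sum.swap)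
    also have "\<dots> = (\<Sum>k\<in>UNIV. \<Sum>i\<in>UNIV. (\<Sum>j\<in>UNIV. g i j * G k j k) * a i)"
      by (intro sum.cong refl) (subst sum_distrib_right, intro sum.cong refl, subst G, simp)
    finally show ?thesis .
  qed
  have 2: "(\<Sum>j\<in>UNIV. \<Sum>i\<in>UNIV. (\<Sum>k\<in>UNIV. g j k * G i k j) * a i) =
      (\<Sum>i\<in>UNIV. \<Sum>j\<in>UNIV. g i j * (\<Sum>k\<in>UNIV. G k i j * a k))"
  proof -
    have "(\<Sum>j\<in>UNIV. \<Sum>i\<in>UNIV. (\<Sum>k\<in>UNIV. g j k * G i k j) * a i) =
        (\<Sum>j\<in>UNIV. \<Sum>i\<in>UNIV. \<Sum>k\<in>UNIV. g j k * (G i k j * a i))"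
      by (simp add: sum_distrib_right mult.assoc)
    also have "\<dots> = (\<Sum>j\<in>UNIV. \<Sum>k\<in>UNIV. \<Sum>i\<in>UNIV. g j k * (G i k j * a i))"
      by (rule sum.cong[OF refl]) (rule sum.swap)
    also have "\<dots> = (\<Sum>k\<in>UNIV. \<Sum>j\<in>UNIV. \<Sum>i\<in>UNIV. g j k * (G i k j * a i))" by (rule sum.swap)
    also have "\<dots> = (\<Sum>k\<in>UNIV. \<Sum>j\<in>UNIV. g k j * (\<Sum>i\<in>UNIV. G i k j * a i))"
      by (subst g) (simp add: sum_distrib_left)
    finally show ?thesis .
  qed
  have 3: "(\<Sum>j\<in>UNIV. \<Sum>i\<in>UNIV. g i j * b i j) = (\<Sum>i\<in>UNIV. \<Sum>j\<in>UNIV. g i j * b i j)" by (rule sum.swap)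
  show ?thesis
    using 1 2 3 by (simp add: sum.distrib sum_subtractf algebra_simps)
qed

locale immersed_chart =
  fixes U :: "(real ^ 'n::finite) set" and y :: "real ^ 'n \<Rightarrow> 'v::euclidean_space"
  assumes open_U: "open U" and smooth_y: "smooth_on U y"
    and inj_dy: "\<And>x. x \<in> U \<Longrightarrow> inj (frechet_derivative y (at x))"
begin

abbreviation frame :: "real ^ 'n \<Rightarrow> 'n \<Rightarrow> 'v" where "frame x \<equiv> \<lambda>i. pd y i x"

abbreviation E :: "'n \<Rightarrow> real ^ 'n \<Rightarrow> 'v" where "E i x \<equiv> dual_frame (frame x) i"

definition vol :: "real ^ 'n \<Rightarrow> real" where "vol x = sqrt (det (gram_matrix (frame x)))"

text \<open>The Laplacian in coordinates, \<open>g\<^sup>i\<^sup>j (\<partial>\<^sub>i\<partial>\<^sub>j f - \<Gamma>\<^sup>k\<^sub>i\<^sub>j \<partial>\<^sub>k f)\<close>: the inverse metric \<open>g\<^sup>i\<^sup>j\<close> is the Gram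
  matrix of the dual frame.\<close>

definition lap :: "(real ^ 'n \<Rightarrow> 'w::real_normed_vector) \<Rightarrow> real ^ 'n \<Rightarrow> 'w" where
  "lap f x = (\<Sum>i\<in>UNIV. \<Sum>j\<in>UNIV. (E i x \<bullet> E j x) *\<^sub>R
     (pd (pd f i) j x - (\<Sum>k\<in>UNIV. (E k x \<bullet> pd (pd y i) j x) *\<^sub>R pd f k x)))"

lemma frame_indep:
  assumes "x \<in> U"
  shows "indep_frame (frame x)"
  unfolding indep_frame_def
proof (intro allI impI)
  fix c i assume "(\<Sum>i\<in>UNIV. c i *\<^sub>R pd y i x) = 0"
  then have "frechet_derivative y (at x) (\<chi> i. c i) = 0"
    using frechet_derivative_pd[OF smooth_on_has_derivative[OF smooth_y assms]] by simp
  then have "(\<chi> i. c i) = 0"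
    using inj_dy[OF assms] has_derivative_linear[OF smooth_on_has_derivative[OF smooth_y assms]]
    by (simp add: linear_injective_0)
  then show "c i = 0" by (metis vec_lambda_beta zero_index)
qed

lemma range_dy_eq_span:
  assumes "x \<in> U"
  shows "range (frechet_derivative y (at x)) = span (range (frame x))"
proof
  note D = frechet_derivative_pd[OF smooth_on_has_derivative[OF smooth_y assms]]
  show "range (frechet_derivative y (at x)) \<subseteq> span (range (frame x))"
  proof
    fix w assume "w \<in> range (frechet_derivative y (at x))"
    then obtain v where "w = (\<Sum>i\<in>UNIV. v $ i *\<^sub>R frame x i)" using D by auto
    then show "w \<in> span (range (frame x))"
      by (simp only:) (intro span_sum span_mul span_base rangeI)
  qed
  show "span (range (frame x)) \<subseteq> range (frechet_derivative y (at x))"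
  proof
    fix w assume "w \<in> span (range (frame x))"
    then obtain c where "w = (\<Sum>i\<in>UNIV. c i *\<^sub>R frame x i)" using span_range_frame by blast
    then have "w = frechet_derivative y (at x) (\<chi> i. c i)" by (simp add: D)
    then show "w \<in> range (frechet_derivative y (at x))" by blast
  qed
qed

lemma vol_pos: "x \<in> U \<Longrightarrow> vol x > 0"
  by (simp add: vol_def det_gram_matrix_pos frame_indep)

lemma smooth_gram: "smooth_on U (\<lambda>x. gram_matrix (frame x) $ i $ j)"
  by (simp add: gram_matrix_def) (intro smooth_intros open_U smooth_y)

lemma smooth_vol: "smooth_on U vol"
  unfolding vol_def by (intro smooth_intros open_U smooth_gram det_gram_matrix_pos frame_indep)

lemma smooth_E: "smooth_on U (E i)"
  unfolding dual_frame_def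
proof (intro smooth_intros open_U smooth_y smooth_on_matrix_inv smooth_gram)
  show "det (gram_matrix (frame x)) \<noteq> 0" if "x \<in> U" for x
    using det_gram_matrix_pos[OF frame_indep[OF that]] by simp
qed

lemma E_frame: "x \<in> U \<Longrightarrow> E i x \<bullet> pd y j x = (if i = j then 1 else 0)"
  by (rule dual_frame_inner[OF frame_indep])

text \<open>Obtained by differentiating the duality relation of the two frames. This replaces a formula for the
  derivative of the inverse metric.\<close>

lemma pd_E_frame:
  assumes "x \<in> U"
  shows "pd (E i) l x \<bullet> pd y j x = - (E i x \<bullet> pd (pd y j) l x)"
proof -
  have "pd (\<lambda>x. E i x \<bullet> pd y j x) l x = pd (\<lambda>x. if i = j then 1 else 0) l x"
    by (rule pd_cong[OF open_U assms], erule E_frame) (intro smooth_intros open_U smooth_E smooth_y)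
  moreover have "pd (\<lambda>x. E i x \<bullet> pd y j x) l x = E i x \<bullet> pd (pd y j) l x + pd (E i) l x \<bullet> pd y j x"
    by (rule pd_inner[OF smooth_E _ assms]) (intro smooth_intros smooth_y)
  ultimately show ?thesis by (simp add: pd_const split: if_splits)
qed

lemma E_expansion:
  assumes "x \<in> U"
  shows "E j x = (\<Sum>k\<in>UNIV. (E j x \<bullet> E k x) *\<^sub>R pd y k x)"
  by (rule frame_expansion[OF frame_indep[OF assms] dual_frame_in_span])

lemma pd_E_inner_E:
  assumes "x \<in> U"
  shows "pd (E i) l x \<bullet> E j x = - (\<Sum>k\<in>UNIV. (E j x \<bullet> E k x) * (E i x \<bullet> pd (pd y k) l x))"
  by (subst E_expansion[OF assms]) (simp add: inner_sum_right pd_E_frame[OF assms] sum_negf)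

text \<open>The derivative of the determinant of the Gram matrix is a trace against the inverse matrix,
  which is the contraction with the dual frame.\<close>

lemma pd_vol:
  assumes x: "x \<in> U"
  shows "pd vol l x = vol x * (\<Sum>k\<in>UNIV. E k x \<bullet> pd (pd y k) l x)"
proof -
  let ?A = "\<lambda>x. gram_matrix (frame x)"
  let ?B = "matrix_inv (?A x)"
  have pdA: "pd (\<lambda>x. ?A x $ i $ j) l x = pd y i x \<bullet> pd (pd y j) l x + pd (pd y i) l x \<bullet> pd y j x" for i j
    unfolding gram_matrix_def vec_lambda_beta
    by (rule pd_inner[OF smooth_on_pd[OF smooth_y] smooth_on_pd[OF smooth_y] x])
  have "((\<lambda>x. det (?A x)) has_derivative (\<lambda>v. det (?A x) *
      (\<Sum>i\<in>UNIV. \<Sum>k\<in>UNIV. ?B $ i $ k * frechet_derivative (\<lambda>x. ?A x $ k $ i) (at x) v))) (at x)"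
    by (rule has_derivative_det) (auto intro: smooth_on_has_derivative[OF smooth_gram x]
        gram_matrix_inverse[OF frame_indep[OF x]])
  from pd_eqI[OF this] have "pd (\<lambda>x. det (?A x)) l x = det (?A x) *
      (\<Sum>i\<in>UNIV. \<Sum>k\<in>UNIV. ?B $ i $ k * (pd y k x \<bullet> pd (pd y i) l x + pd (pd y k) l x \<bullet> pd y i x))"
    unfolding pdA[symmetric] by (simp add: pd_def)
  also have "(\<Sum>i\<in>UNIV. \<Sum>k\<in>UNIV. ?B $ i $ k * (pd y k x \<bullet> pd (pd y i) l x + pd (pd y k) l x \<bullet> pd y i x)) =
      (\<Sum>i\<in>UNIV. E i x \<bullet> pd (pd y i) l x) + (\<Sum>i\<in>UNIV. \<Sum>k\<in>UNIV. ?B $ i $ k * (pd (pd y k) l x \<bullet> pd y i x))"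
    by (simp add: sum.distrib distrib_left dual_frame_def inner_sum_left)
  also have "(\<Sum>i\<in>UNIV. \<Sum>k\<in>UNIV. ?B $ i $ k * (pd (pd y k) l x \<bullet> pd y i x)) = (\<Sum>k\<in>UNIV. E k x \<bullet> pd (pd y k) l x)"
  proof -
    have sym: "?B $ i $ k = ?B $ k $ i" for i k
    proof -
      have "?B $ a $ b = E a x \<bullet> E b x" for a b
      proof -
        have "E a x \<bullet> E b x = (\<Sum>j\<in>UNIV. ?B $ a $ j * (pd y j x \<bullet> E b x))"
          by (subst (1) dual_frame_def) (simp add: inner_sum_left)
        then show ?thesis
          using E_frame[OF x] by (simp add: inner_commute[of _ "E b x"] if_distrib[of "\<lambda>c. _ * c"] cong: if_cong)
      qed
      then show ?thesis by (metis inner_commute)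
    qed
    have "(\<Sum>i\<in>UNIV. \<Sum>k\<in>UNIV. ?B $ i $ k * (pd (pd y k) l x \<bullet> pd y i x)) =
        (\<Sum>k\<in>UNIV. \<Sum>i\<in>UNIV. ?B $ i $ k * (pd (pd y k) l x \<bullet> pd y i x))" by (rule sum.swap)
    also have "\<dots> = (\<Sum>k\<in>UNIV. \<Sum>i\<in>UNIV. ?B $ k $ i * (pd y i x \<bullet> pd (pd y k) l x))"
      by (intro sum.cong refl) (metis sym inner_commute)
    also have "\<dots> = (\<Sum>k\<in>UNIV. E k x \<bullet> pd (pd y k) l x)"
      by (simp add: dual_frame_def inner_sum_left)
    finally show ?thesis .
  qed
  finally have d: "pd (\<lambda>x. det (?A x)) l x = 2 * (det (?A x) * (\<Sum>k\<in>UNIV. E k x \<bullet> pd (pd y k) l x))" by simp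
  have sd: "smooth_on U (\<lambda>x. det (?A x))" by (intro smooth_intros open_U smooth_gram)
  have pos: "det (?A x) > 0" by (rule det_gram_matrix_pos[OF frame_indep[OF x]])
  have sq: "(sqrt has_derivative (\<lambda>v. v * (inverse (sqrt (det (?A x))) / 2))) (at (det (?A x)))"
    using pos by (auto intro!: derivative_eq_intros simp: field_simps)
  from pd_eqI[OF has_derivative_compose[OF smooth_on_has_derivative[OF sd x] this]]
  have "pd vol l x = pd (\<lambda>x. det (?A x)) l x * (inverse (vol x) / 2)"
    by (simp add: vol_def[abs_def] pd_def)
  also have "\<dots> = det (?A x) * inverse (vol x) * (\<Sum>k\<in>UNIV. E k x \<bullet> pd (pd y k) l x)"
    unfolding d by simp
  also have "det (?A x) * inverse (vol x) = vol x"
    using pos by (simp add: vol_def field_simps)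
  finally show ?thesis .
qed

text \<open>The integrands on the two sides of Green's identity differ by a divergence.\<close>

lemma divergence_identity:
  fixes f u :: "real ^ 'n \<Rightarrow> 'w::euclidean_space"
  assumes f: "smooth_on U f" and u: "smooth_on U u" and x: "x \<in> U"
  shows "(\<Sum>j\<in>UNIV. pd (\<lambda>x. vol x * (\<Sum>i\<in>UNIV. (E i x \<bullet> E j x) * (pd f i x \<bullet> u x))) j x) =
    vol x * ((\<Sum>i\<in>UNIV. \<Sum>j\<in>UNIV. (E i x \<bullet> E j x) * (pd f i x \<bullet> pd u j x)) + lap f x \<bullet> u x)"
proof -
  let ?g = "\<lambda>i j. E i x \<bullet> E j x" and ?G = "\<lambda>k i j. E k x \<bullet> pd (pd y i) j x"
  let ?a = "\<lambda>i. pd f i x \<bullet> u x"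
  let ?b = "\<lambda>i j. pd f i x \<bullet> pd u j x + pd (pd f i) j x \<bullet> u x"
  have sm: "smooth_on U (\<lambda>x. \<Sum>i\<in>UNIV. (E i x \<bullet> E j x) * (pd f i x \<bullet> u x))"
    "smooth_on U (\<lambda>x. E i x \<bullet> E j x)" "smooth_on U (\<lambda>x. pd f i x \<bullet> u x)" for i j
    by (intro smooth_intros open_U smooth_E f u)+
  have sm': "smooth_on U (\<lambda>x. (E i x \<bullet> E j x) * (pd f i x \<bullet> u x))" for i j
    by (intro smooth_intros open_U smooth_E f u)
  have 1: "pd (\<lambda>x. (E i x \<bullet> E j x) * (pd f i x \<bullet> u x)) j x =
      (- (\<Sum>k\<in>UNIV. ?g j k * ?G i k j) - (\<Sum>k\<in>UNIV. ?g i k * ?G j k j)) * ?a i + ?g i j * ?b i j" for i j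
    unfolding pd_mult[OF sm(2,3) x] pd_inner[OF smooth_E smooth_E x] pd_inner[OF smooth_on_pd[OF f] u x]
      pd_E_inner_E[OF x]
    using pd_E_inner_E[OF x, of j j i]
    by (simp add: inner_commute[of "E i x" "pd (E j) j x"])
  have "(\<Sum>j\<in>UNIV. pd (\<lambda>x. vol x * (\<Sum>i\<in>UNIV. (E i x \<bullet> E j x) * (pd f i x \<bullet> u x))) j x) =
    (\<Sum>j\<in>UNIV. vol x * ((\<Sum>k\<in>UNIV. ?G k k j) * (\<Sum>i\<in>UNIV. ?g i j * ?a i) +
      (\<Sum>i\<in>UNIV. (- (\<Sum>k\<in>UNIV. ?g j k * ?G i k j) - (\<Sum>k\<in>UNIV. ?g i k * ?G j k j)) * ?a i + ?g i j * ?b i j)))"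
    unfolding pd_mult[OF smooth_vol sm(1) x] pd_sum[OF sm' x] pd_vol[OF x] 1
    by (intro sum.cong refl) (simp only: distrib_left mult.assoc add.commute)
  also have "\<dots> = vol x * (\<Sum>i\<in>UNIV. \<Sum>j\<in>UNIV. ?g i j * (?b i j - (\<Sum>k\<in>UNIV. ?G k i j * ?a k)))"
    unfolding sum_distrib_left[symmetric]
    by (subst christoffel_cancellation[of ?G ?g])
       (auto simp: pd_symmetric[OF smooth_y open_U x] inner_commute)
  also have "(\<Sum>i\<in>UNIV. \<Sum>j\<in>UNIV. ?g i j * (?b i j - (\<Sum>k\<in>UNIV. ?G k i j * ?a k))) =
      (\<Sum>i\<in>UNIV. \<Sum>j\<in>UNIV. ?g i j * (pd f i x \<bullet> pd u j x)) + lap f x \<bullet> u x"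
    by (simp add: lap_def inner_sum_left inner_diff_left sum.distrib[symmetric] algebra_simps)
  finally show ?thesis .
qed

lemma lap_linear_combination:
  fixes f h :: "real ^ 'n \<Rightarrow> 'w::real_normed_vector"
  assumes f: "smooth_on U f" and h: "smooth_on U h" and x: "x \<in> U"
  shows "lap (\<lambda>x. a *\<^sub>R f x + b *\<^sub>R h x) x = a *\<^sub>R lap f x + b *\<^sub>R lap h x"
proof -
  have lin: "pd (\<lambda>x. a *\<^sub>R f x + b *\<^sub>R h x) i z = a *\<^sub>R pd f i z + b *\<^sub>R pd h i z"
    if "smooth_on U f" "smooth_on U h" "z \<in> U" for f h i z
    by (subst pd_eqI[OF has_derivative_add[OF
          has_derivative_scaleR_right[OF smooth_on_has_derivative[OF that(1,3)]]
          has_derivative_scaleR_right[OF smooth_on_has_derivative[OF that(2,3)]]]]) (simp add: pd_def)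
  have 2: "pd (pd (\<lambda>x. a *\<^sub>R f x + b *\<^sub>R h x) i) j x = a *\<^sub>R pd (pd f i) j x + b *\<^sub>R pd (pd h i) j x" for i j
  proof -
    have "pd (\<lambda>z. a *\<^sub>R pd f i z + b *\<^sub>R pd h i z) j x = pd (pd (\<lambda>x. a *\<^sub>R f x + b *\<^sub>R h x) i) j x"
      by (rule pd_cong[OF open_U x]) (auto simp: lin f h intro!: smooth_intros open_U f h)
    then show ?thesis using lin[OF smooth_on_pd[OF f] smooth_on_pd[OF h] x] by simp
  qed
  have coeff: "g *\<^sub>R (a *\<^sub>R P + b *\<^sub>R Q - (\<Sum>k\<in>UNIV. c k *\<^sub>R (a *\<^sub>R F k + b *\<^sub>R H k))) =
      a *\<^sub>R (g *\<^sub>R (P - (\<Sum>k\<in>UNIV. c k *\<^sub>R F k))) + b *\<^sub>R (g *\<^sub>R (Q - (\<Sum>k\<in>UNIV. c k *\<^sub>R H k)))"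
    for g :: real and P Q :: 'w and c :: "'n \<Rightarrow> real" and F H :: "'n \<Rightarrow> 'w"
  proof -
    have "(\<Sum>k\<in>UNIV. c k *\<^sub>R (a *\<^sub>R F k + b *\<^sub>R H k)) =
        a *\<^sub>R (\<Sum>k\<in>UNIV. c k *\<^sub>R F k) + b *\<^sub>R (\<Sum>k\<in>UNIV. c k *\<^sub>R H k)"
      by (simp add: scaleR_add_right sum.distrib scaleR_sum_right mult.commute)
    then show ?thesis by (simp only: scaleR_add_right scaleR_diff_right scaleR_scaleR mult.commute) simp
  qed
  show ?thesis
    unfolding lap_def 2 lin[OF f h x] coeff sum.distrib scaleR_sum_right ..
qed

end

section \<open>Hypersurfaces of the sphere in a chart\<close>

locale hypersurface_chart = immersed_chart U y
  for U :: "(real ^ 'n::finite) set" and y :: "real ^ 'n \<Rightarrow> 'v::euclidean_space" +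
  fixes \<nu> :: "real ^ 'n \<Rightarrow> 'v"
  assumes dim: "DIM('v) = CARD('n) + 2"
    and smooth_nu: "smooth_on U \<nu>"
    and y_y: "\<And>x. x \<in> U \<Longrightarrow> y x \<bullet> y x = 1"
    and nu_nu: "\<And>x. x \<in> U \<Longrightarrow> \<nu> x \<bullet> \<nu> x = 1"
    and nu_y: "\<And>x. x \<in> U \<Longrightarrow> \<nu> x \<bullet> y x = 0"
    and nu_frame: "\<And>x i. x \<in> U \<Longrightarrow> \<nu> x \<bullet> pd y i x = 0"
begin

text \<open>Minus the trace of the shape operator, and its squared Hilbert-Schmidt norm.\<close>

definition trA :: "real ^ 'n \<Rightarrow> real" where "trA x = (\<Sum>j\<in>UNIV. E j x \<bullet> pd \<nu> j x)"

definition sqA :: "real ^ 'n \<Rightarrow> real" where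
  "sqA x = (\<Sum>i\<in>UNIV. \<Sum>j\<in>UNIV. (E i x \<bullet> E j x) * (pd \<nu> i x \<bullet> pd \<nu> j x))"

text \<open>The relations between derivatives below all come from differentiating constant inner products of
  \<open>y\<close>, \<open>\<nu>\<close> and their derivatives.\<close>

lemma pd_inner_const:
  assumes "smooth_on U f" "smooth_on U h" "x \<in> U" "\<And>z. z \<in> U \<Longrightarrow> f z \<bullet> h z = c"
  shows "f x \<bullet> pd h i x = - (pd f i x \<bullet> h x)"
proof -
  have "pd (\<lambda>x. f x \<bullet> h x) i x = pd (\<lambda>x. c) i x"
    by (rule pd_cong[OF open_U assms(3,4)]) (auto intro: smooth_intros open_U assms)
  then show ?thesis using pd_inner[OF assms(1-3), of i] by (simp add: pd_const)
qed

lemma first_order_relations: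
  assumes x: "x \<in> U"
  shows "y x \<bullet> pd y i x = 0" "\<nu> x \<bullet> pd \<nu> i x = 0" "y x \<bullet> pd \<nu> i x = 0"
    "pd \<nu> i x \<bullet> pd y j x = - (\<nu> x \<bullet> pd (pd y j) i x)"
    "pd \<nu> i x \<bullet> pd y j x = pd \<nu> j x \<bullet> pd y i x"
proof -
  show "y x \<bullet> pd y i x = 0" "\<nu> x \<bullet> pd \<nu> i x = 0"
    using pd_inner_const[OF smooth_y smooth_y x y_y, of i] pd_inner_const[OF smooth_nu smooth_nu x nu_nu, of i]
    by (simp_all add: inner_commute)
  show "y x \<bullet> pd \<nu> i x = 0"
    using pd_inner_const[OF smooth_nu smooth_y x nu_y, of i] nu_frame[OF x] by (simp add: inner_commute)
  have *: "pd \<nu> i x \<bullet> pd y j x = - (\<nu> x \<bullet> pd (pd y j) i x)" for i j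
    using pd_inner_const[OF smooth_nu smooth_on_pd[OF smooth_y] x nu_frame, of j i] by simp
  show "pd \<nu> i x \<bullet> pd y j x = - (\<nu> x \<bullet> pd (pd y j) i x)" by (rule *)
  show "pd \<nu> i x \<bullet> pd y j x = pd \<nu> j x \<bullet> pd y i x"
    unfolding * by (simp add: pd_symmetric[OF smooth_y open_U x, of i j])
qed

lemma second_order_relations:
  assumes x: "x \<in> U"
  shows "pd (pd y i) j x \<bullet> y x = - (pd y i x \<bullet> pd y j x)"
    and "pd (pd y i) j x \<bullet> \<nu> x = - (pd y i x \<bullet> pd \<nu> j x)"
    and "pd (pd \<nu> i) j x \<bullet> y x = - (pd \<nu> i x \<bullet> pd y j x)"
    and "pd (pd \<nu> i) j x \<bullet> \<nu> x = - (pd \<nu> i x \<bullet> pd \<nu> j x)"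
  using pd_inner_const[OF smooth_y smooth_on_pd[OF smooth_y] x first_order_relations(1), of i j]
    pd_inner_const[OF smooth_nu smooth_on_pd[OF smooth_y] x nu_frame, of i j]
    pd_inner_const[OF smooth_y smooth_on_pd[OF smooth_nu] x first_order_relations(3), of i j]
    pd_inner_const[OF smooth_nu smooth_on_pd[OF smooth_nu] x first_order_relations(2), of i j]
  by (simp_all add: inner_commute)

text \<open>Counting dimensions: the frame together with \<open>\<nu>\<close> and \<open>y\<close> already has as many independent
  vectors as the ambient space.\<close>

lemma orthogonal_to_all_imp_0:
  assumes x: "x \<in> U" and "\<And>i. r \<bullet> pd y i x = 0" "r \<bullet> \<nu> x = 0" "r \<bullet> y x = 0"
  shows "r = 0"
proof (rule ccontr)
  assume r: "r \<noteq> 0"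
  let ?F = "range (frame x)"
  have inj: "inj (frame x)"
  proof (rule injI)
    fix i j assume eq: "frame x i = frame x j"
    then have "E i x \<bullet> frame x i = E i x \<bullet> frame x j" by simp
    then show "i = j" using E_frame[OF x] by (auto split: if_splits)
  qed
  have ind: "independent ?F"
    unfolding independent_explicit_finite_subsets
  proof (intro allI impI ballI)
    fix A u v assume A: "A \<subseteq> ?F" "finite A" "(\<Sum>v\<in>A. u v *\<^sub>R v) = 0" "v \<in> A"
    then obtain k where k: "v = frame x k" by blast
    have "0 = (\<Sum>w\<in>A. u w *\<^sub>R w) \<bullet> E k x" using A by simp
    also have "\<dots> = (\<Sum>w\<in>A. if w = v then u w else 0)"
      unfolding inner_sum_left
    proof (rule sum.cong[OF refl])
      fix w assume "w \<in> A"
      then obtain l where l: "w = frame x l" using A by blast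
      then show "u w *\<^sub>R w \<bullet> E k x = (if w = v then u w else 0)"
        using k inj E_frame[OF x, of k l] by (auto simp: inner_commute dest: injD)
    qed
    finally show "u v = 0" using A by simp
  qed
  have span0: "w \<notin> span S" if "w \<noteq> 0" "\<And>s. s \<in> S \<Longrightarrow> w \<bullet> s = 0" for w :: 'v and S
  proof
    assume "w \<in> span S"
    then have "orthogonal w w" using orthogonal_to_span[of w S w] that by (simp add: orthogonal_def)
    then show False using that by (simp add: orthogonal_self)
  qed
  have ny: "\<nu> x \<noteq> 0" "y x \<noteq> 0" using nu_nu[OF x] y_y[OF x] by auto
  have d0: "dim ?F = CARD('n)" using ind inj by (simp add: dim_eq_card_independent card_image)
  have "\<nu> x \<notin> span ?F" by (rule span0[OF ny(1)]) (use nu_frame[OF x] in auto)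
  then have d1: "dim (insert (\<nu> x) ?F) = CARD('n) + 1" using d0 by (simp add: dim_insert)
  have "y x \<notin> span (insert (\<nu> x) ?F)"
    by (rule span0[OF ny(2)]) (use first_order_relations(1)[OF x] nu_y[OF x] in \<open>auto simp: inner_commute\<close>)
  then have d2: "dim (insert (y x) (insert (\<nu> x) ?F)) = CARD('n) + 2" using d1 by (simp add: dim_insert)
  have "r \<notin> span (insert (y x) (insert (\<nu> x) ?F))"
    by (rule span0[OF r]) (use assms in auto)
  then have "dim (insert r (insert (y x) (insert (\<nu> x) ?F))) = CARD('n) + 3" using d2 by (simp add: dim_insert)
  moreover have "dim (insert r (insert (y x) (insert (\<nu> x) ?F))) \<le> DIM('v)" by (rule dim_subset_UNIV)
  ultimately show False using dim by simp
qed

lemma tangent_if_orthogonal: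
  assumes x: "x \<in> U" and w: "w \<bullet> \<nu> x = 0" "w \<bullet> y x = 0"
  shows "w \<in> span (range (frame x))"
proof -
  let ?r = "w - (\<Sum>k\<in>UNIV. (w \<bullet> pd y k x) *\<^sub>R E k x)"
  have "?r = 0"
  proof (rule orthogonal_to_all_imp_0[OF x])
    have tang: "E k x \<bullet> \<nu> x = 0" "E k x \<bullet> y x = 0" for k
      using nu_frame[OF x] first_order_relations(1)[OF x]
      by (auto simp: dual_frame_def inner_sum_right inner_commute[of _ "\<nu> x"] inner_commute[of _ "y x"])
    show "?r \<bullet> \<nu> x = 0" "?r \<bullet> y x = 0" by (auto simp: inner_diff_left inner_sum_left w tang)
    show "?r \<bullet> pd y i x = 0" for i
      by (simp add: inner_diff_left inner_sum_left E_frame[OF x] if_distrib[of "\<lambda>c. _ * c"] cong: if_cong)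
  qed
  then have "w = (\<Sum>k\<in>UNIV. (w \<bullet> pd y k x) *\<^sub>R E k x)" by simp
  then show ?thesis
    by (metis (no_types, lifting) span_sum span_mul dual_frame_in_span)
qed

lemma pd_nu_tangent: "x \<in> U \<Longrightarrow> pd \<nu> i x \<in> span (range (frame x))"
  using tangent_if_orthogonal first_order_relations(2,3) by (simp add: inner_commute)

lemma lap_inner:
  fixes f :: "real ^ 'n \<Rightarrow> 'w::real_inner"
  shows "lap f x \<bullet> w = (\<Sum>i\<in>UNIV. \<Sum>j\<in>UNIV. (E i x \<bullet> E j x) *
     (pd (pd f i) j x \<bullet> w - (\<Sum>k\<in>UNIV. (E k x \<bullet> pd (pd y i) j x) * (pd f k x \<bullet> w))))"
  by (simp add: lap_def inner_sum_left inner_diff_left)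

lemma contract_E:
  assumes "x \<in> U"
  shows "(\<Sum>i\<in>UNIV. (E i x \<bullet> E j x) * (pd y i x \<bullet> w)) = E j x \<bullet> w"
    and "(\<Sum>i\<in>UNIV. (E j x \<bullet> E i x) * (pd y i x \<bullet> w)) = E j x \<bullet> w"
  by (subst (2) E_expansion[OF assms], simp add: inner_sum_left inner_commute[of "E j x"])
     (subst (2) E_expansion[OF assms], simp add: inner_sum_left)

lemma trA_alt:
  assumes x: "x \<in> U"
  shows "(\<Sum>i\<in>UNIV. \<Sum>j\<in>UNIV. (E i x \<bullet> E j x) * (pd y i x \<bullet> pd \<nu> j x)) = trA x"
proof -
  have "(\<Sum>i\<in>UNIV. \<Sum>j\<in>UNIV. (E i x \<bullet> E j x) * (pd y i x \<bullet> pd \<nu> j x)) =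
      (\<Sum>j\<in>UNIV. \<Sum>i\<in>UNIV. (E i x \<bullet> E j x) * (pd y i x \<bullet> pd \<nu> j x))" by (rule sum.swap)
  then show ?thesis by (simp add: contract_E[OF x] trA_def)
qed

text \<open>The second derivatives of \<open>y\<close> without their tangential parts are normal to the frame, so only the
  components along \<open>\<nu>\<close> and \<open>y\<close> survive: \<open>\<Delta>y = n H \<nu> - n y\<close>, with \<open>trA = - n H\<close>.\<close>

lemma lap_y:
  assumes x: "x \<in> U"
  shows "lap y x \<bullet> pd y l x = 0" "lap y x \<bullet> \<nu> x = - trA x" "lap y x \<bullet> y x = - real CARD('n)"
proof -
  show "lap y x \<bullet> pd y l x = 0"
    unfolding lap_inner
    by (subst dual_frame_inner_expansion(1)[OF frame_indep[OF x]]) (auto intro: span_base)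
  show "lap y x \<bullet> \<nu> x = - trA x"
    unfolding lap_inner second_order_relations[OF x]
    using nu_frame[OF x] by (simp add: inner_commute[of _ "\<nu> x"] sum_negf trA_alt[OF x])
  have "(\<Sum>i\<in>UNIV. \<Sum>j\<in>UNIV. (E i x \<bullet> E j x) * (pd y i x \<bullet> pd y j x)) = real CARD('n)"
    by (subst sum.swap) (simp add: contract_E[OF x] E_frame[OF x])
  then show "lap y x \<bullet> y x = - real CARD('n)"
    unfolding lap_inner second_order_relations[OF x]
    using first_order_relations(1)[OF x] by (simp add: inner_commute[of _ "y x"] sum_negf)
qed

text \<open>The tangential part of \<open>\<Delta>\<nu>\<close> is minus the gradient of the trace of the shape operator: this is
  the contracted Codazzi equation.\<close>

lemma lap_nu:
  assumes x: "x \<in> U"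
  shows "lap \<nu> x \<bullet> pd y l x = pd trA l x" "lap \<nu> x \<bullet> \<nu> x = - sqA x" "lap \<nu> x \<bullet> y x = - trA x"
proof -
  show "lap \<nu> x \<bullet> \<nu> x = - sqA x"
    unfolding lap_inner second_order_relations[OF x]
    using first_order_relations(2)[OF x] by (simp add: inner_commute[of _ "\<nu> x"] sum_negf sqA_def)
  have "(\<Sum>i\<in>UNIV. \<Sum>j\<in>UNIV. (E i x \<bullet> E j x) * (pd \<nu> i x \<bullet> pd y j x)) = trA x"
    unfolding trA_alt[OF x, symmetric]
    by (intro sum.cong refl arg_cong[where f = "\<lambda>c. _ * c"])
       (rule trans[OF first_order_relations(5)[OF x] inner_commute])
  then show "lap \<nu> x \<bullet> y x = - trA x"
    unfolding lap_inner second_order_relations[OF x]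
    using first_order_relations(3)[OF x] by (simp add: inner_commute[of _ "y x"] sum_negf)
  let ?g = "\<lambda>i j. E i x \<bullet> E j x"
  have chr: "(\<Sum>k\<in>UNIV. (E k x \<bullet> pd (pd y i) j x) * (pd \<nu> k x \<bullet> pd y l x)) = pd (pd y i) j x \<bullet> pd \<nu> l x" for i j
    by (subst first_order_relations(5)[OF x])
       (simp add: inner_commute[of "pd \<nu> l x"] dual_frame_inner_expansion(1)[OF frame_indep[OF x] pd_nu_tangent[OF x]])
  have cod: "pd (pd \<nu> i) j x \<bullet> pd y l x - pd (pd y i) j x \<bullet> pd \<nu> l x =
      pd (pd \<nu> l) j x \<bullet> pd y i x - pd \<nu> i x \<bullet> pd (pd y l) j x" for i j
  proof -
    have "pd (\<lambda>x. pd \<nu> i x \<bullet> pd y l x) j x = pd (\<lambda>x. pd \<nu> l x \<bullet> pd y i x) j x"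
      by (rule pd_cong[OF open_U x first_order_relations(5)]) (auto intro!: smooth_intros open_U smooth_nu smooth_y)
    then show ?thesis
      unfolding pd_inner[OF smooth_on_pd[OF smooth_nu] smooth_on_pd[OF smooth_y] x]
      by (simp add: inner_commute[of "pd \<nu> l x"])
  qed
  have L: "lap \<nu> x \<bullet> pd y l x =
      (\<Sum>j\<in>UNIV. E j x \<bullet> pd (pd \<nu> l) j x) - (\<Sum>i\<in>UNIV. \<Sum>j\<in>UNIV. ?g i j * (pd \<nu> i x \<bullet> pd (pd y l) j x))"
  proof -
    have "lap \<nu> x \<bullet> pd y l x = (\<Sum>i\<in>UNIV. \<Sum>j\<in>UNIV. ?g i j * (pd y i x \<bullet> pd (pd \<nu> l) j x))
      - (\<Sum>i\<in>UNIV. \<Sum>j\<in>UNIV. ?g i j * (pd \<nu> i x \<bullet> pd (pd y l) j x))"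
      unfolding lap_inner chr cod by (simp add: right_diff_distrib sum_subtractf inner_commute[of _ "pd y _ x"])
    also have "(\<Sum>i\<in>UNIV. \<Sum>j\<in>UNIV. ?g i j * (pd y i x \<bullet> pd (pd \<nu> l) j x)) =
        (\<Sum>j\<in>UNIV. \<Sum>i\<in>UNIV. ?g i j * (pd y i x \<bullet> pd (pd \<nu> l) j x))" by (rule sum.swap)
    finally show ?thesis by (simp add: contract_E[OF x])
  qed
  have "pd trA l x = (\<Sum>j\<in>UNIV. E j x \<bullet> pd (pd \<nu> j) l x) + (\<Sum>j\<in>UNIV. pd (E j) l x \<bullet> pd \<nu> j x)"
    unfolding trA_def[abs_def]
    by (subst pd_sum[OF _ x]) (auto intro!: smooth_intros open_U smooth_E smooth_nu
        simp: pd_inner[OF smooth_E smooth_on_pd[OF smooth_nu] x] sum.distrib)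
  also have "(\<Sum>j\<in>UNIV. E j x \<bullet> pd (pd \<nu> j) l x) = (\<Sum>j\<in>UNIV. E j x \<bullet> pd (pd \<nu> l) j x)"
    by (simp add: pd_symmetric[OF smooth_nu open_U x, of _ l])
  also have "(\<Sum>j\<in>UNIV. pd (E j) l x \<bullet> pd \<nu> j x) = - (\<Sum>i\<in>UNIV. \<Sum>j\<in>UNIV. ?g i j * (pd \<nu> i x \<bullet> pd (pd y l) j x))"
  proof -
    have "(\<Sum>j\<in>UNIV. pd (E j) l x \<bullet> pd \<nu> j x) =
        (\<Sum>j\<in>UNIV. \<Sum>k\<in>UNIV. (pd \<nu> j x \<bullet> E k x) * - (E j x \<bullet> pd (pd y k) l x))"
      by (subst frame_expansion[OF frame_indep[OF x] pd_nu_tangent[OF x]]) (simp add: inner_sum_right pd_E_frame[OF x])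
    also have "\<dots> = - (\<Sum>j\<in>UNIV. \<Sum>k\<in>UNIV. \<Sum>i\<in>UNIV. ?g k i * (pd \<nu> i x \<bullet> pd y j x) * (E j x \<bullet> pd (pd y k) l x))"
    proof -
      have "pd \<nu> j x \<bullet> E k x = (\<Sum>i\<in>UNIV. ?g k i * (pd \<nu> i x \<bullet> pd y j x))" for j k
        unfolding first_order_relations(5)[OF x, of _ j]
        by (simp add: inner_commute[of "pd \<nu> j x"] contract_E(2)[OF x])
      then show ?thesis by (simp add: sum_negf sum_distrib_right)
    qed
    also have "(\<Sum>j\<in>UNIV. \<Sum>k\<in>UNIV. \<Sum>i\<in>UNIV. ?g k i * (pd \<nu> i x \<bullet> pd y j x) * (E j x \<bullet> pd (pd y k) l x)) =
        (\<Sum>k\<in>UNIV. \<Sum>j\<in>UNIV. \<Sum>i\<in>UNIV. ?g k i * (pd \<nu> i x \<bullet> pd y j x) * (E j x \<bullet> pd (pd y k) l x))"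
      by (rule sum.swap)
    also have "\<dots> = (\<Sum>k\<in>UNIV. \<Sum>i\<in>UNIV. \<Sum>j\<in>UNIV. ?g k i * ((E j x \<bullet> pd (pd y k) l x) * (pd y j x \<bullet> pd \<nu> i x)))"
      by (rule sum.cong[OF refl]) (subst sum.swap, simp add: inner_commute[of "pd \<nu> _ x"] mult_ac)
    also have "\<dots> = (\<Sum>k\<in>UNIV. \<Sum>i\<in>UNIV. ?g k i * (pd (pd y k) l x \<bullet> pd \<nu> i x))"
      unfolding sum_distrib_left[symmetric]
      by (simp add: dual_frame_inner_expansion(1)[OF frame_indep[OF x] pd_nu_tangent[OF x]])
    also have "\<dots> = (\<Sum>i\<in>UNIV. \<Sum>j\<in>UNIV. ?g i j * (pd \<nu> i x \<bullet> pd (pd y l) j x))"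
      by (subst sum.swap) (simp add: inner_commute pd_symmetric[OF smooth_y open_U x, of _ l])
    finally show ?thesis by simp
  qed
  finally show "lap \<nu> x \<bullet> pd y l x = pd trA l x" using L by simp
qed

text \<open>The pointwise Euler-Lagrange equation: \<open>\<Delta>\<eta>\<close> is normal to the sphere, that is, a multiple of
  \<open>\<eta>\<close>. Its part tangent to \<open>M\<close> is a multiple of the gradient of the mean curvature; the remaining
  component is the one along \<open>c \<nu> - s y\<close>, the unit normal orthogonal to \<open>\<eta>\<close>.\<close>

lemma euler_lagrange_iff:
  assumes x: "x \<in> U" and sc: "s\<^sup>2 + c\<^sup>2 = (1 :: real)"
    and eta: "\<eta> = (\<lambda>x. s *\<^sub>R \<nu> x + c *\<^sub>R y x)"
  shows "lap \<eta> x = (lap \<eta> x \<bullet> \<eta> x) *\<^sub>R \<eta> x \<longleftrightarrow>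
    (\<forall>l. s * pd trA l x = 0) \<and> s * c * (real CARD('n) - sqA x) = (c\<^sup>2 - s\<^sup>2) * trA x"
proof -
  have L: "lap \<eta> x = s *\<^sub>R lap \<nu> x + c *\<^sub>R lap y x"
    unfolding eta by (rule lap_linear_combination[OF smooth_nu smooth_y x])
  define \<zeta> where "\<zeta> = c *\<^sub>R \<nu> x - s *\<^sub>R y x"
  have tang: "lap \<eta> x \<bullet> pd y l x = s * pd trA l x" for l
    unfolding L by (simp add: inner_add_left lap_y[OF x] lap_nu[OF x])
  have "lap \<eta> x \<bullet> \<zeta> = c * (s * - sqA x + c * - trA x) - s * (s * - trA x + c * - real CARD('n))"
    unfolding L \<zeta>_def by (simp add: inner_add_left inner_diff_right lap_y[OF x] lap_nu[OF x])
  then have norm': "lap \<eta> x \<bullet> \<zeta> = s * c * (real CARD('n) - sqA x) - (c\<^sup>2 - s\<^sup>2) * trA x"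
    by (simp add: algebra_simps power2_eq_square)
  have eta_orth: "\<eta> x \<bullet> pd y l x = 0" "\<eta> x \<bullet> \<zeta> = 0" "\<eta> x \<bullet> \<eta> x = 1" for l
    using sc nu_frame[OF x] first_order_relations(1)[OF x] nu_nu[OF x] y_y[OF x] nu_y[OF x]
    by (auto simp: eta \<zeta>_def inner_add_left inner_add_right inner_diff_right inner_commute[of "y x" "\<nu> x"]
        power2_eq_square)
  let ?r = "lap \<eta> x - (lap \<eta> x \<bullet> \<eta> x) *\<^sub>R \<eta> x"
  have "?r = 0 \<longleftrightarrow> (\<forall>l. lap \<eta> x \<bullet> pd y l x = 0) \<and> lap \<eta> x \<bullet> \<zeta> = 0"
  proof
    assume "?r = 0"
    then obtain k where "lap \<eta> x = k *\<^sub>R \<eta> x" by (metis right_minus_eq)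
    then show "(\<forall>l. lap \<eta> x \<bullet> pd y l x = 0) \<and> lap \<eta> x \<bullet> \<zeta> = 0" using eta_orth by simp
  next
    assume a: "(\<forall>l. lap \<eta> x \<bullet> pd y l x = 0) \<and> lap \<eta> x \<bullet> \<zeta> = 0"
    have re: "?r \<bullet> \<eta> x = 0" "?r \<bullet> \<zeta> = 0" using a eta_orth by (auto simp: inner_diff_left)
    have "s *\<^sub>R \<eta> x + c *\<^sub>R \<zeta> = (s\<^sup>2 + c\<^sup>2) *\<^sub>R \<nu> x" "c *\<^sub>R \<eta> x - s *\<^sub>R \<zeta> = (s\<^sup>2 + c\<^sup>2) *\<^sub>R y x"
      by (simp_all add: eta \<zeta>_def algebra_simps power2_eq_square)
    then have ny: "\<nu> x = s *\<^sub>R \<eta> x + c *\<^sub>R \<zeta>" "y x = c *\<^sub>R \<eta> x - s *\<^sub>R \<zeta>" using sc by simp_all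
    show "?r = 0"
    proof (rule orthogonal_to_all_imp_0[OF x])
      show "?r \<bullet> pd y i x = 0" for i using a eta_orth by (simp add: inner_diff_left)
      show "?r \<bullet> \<nu> x = 0" "?r \<bullet> y x = 0" unfolding ny using re by (simp_all add: inner_add_right inner_diff_right)
    qed
  qed
  then show ?thesis unfolding tang norm' by auto
qed

end

section \<open>Integration by parts\<close>

lemma smooth_on_extend_by_zero:
  assumes "open U" "smooth_on U f" "closed K" "K \<subseteq> U" "\<And>x. x \<in> U - K \<Longrightarrow> f x = 0"
  shows "smooth_on UNIV (\<lambda>x. if x \<in> U then f x else 0)" (is "smooth_on UNIV ?h")
proof (rule smooth_on_local)
  fix x
  show "\<exists>V. open V \<and> x \<in> V \<and> smooth_on V ?h"
  proof (cases "x \<in> U")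
    case True
    have "smooth_on U ?h" by (rule smooth_on_cong[OF assms(2,1)]) simp
    then show ?thesis using True assms(1) by blast
  next
    case False
    have "smooth_on (- K) ?h"
      by (rule smooth_on_cong[OF smooth_on_const[of _ 0]]) (use assms in auto)
    then show ?thesis using False assms by (intro exI[of _ "- K"]) auto
  qed
qed

lemma continuous_on_compact_support_bounded:
  fixes f :: "'a::t2_space \<Rightarrow> real"
  assumes "continuous_on K f" "compact K" "\<And>x. x \<notin> K \<Longrightarrow> f x = 0"
  obtains B where "B \<ge> 0" "\<And>x. \<bar>f x\<bar> \<le> B"
proof -
  have "bounded (f ` K)" using assms compact_continuous_image compact_imp_bounded by blast
  then obtain B where B: "\<And>x. x \<in> K \<Longrightarrow> \<bar>f x\<bar> \<le> B" by (auto simp: bounded_iff)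
  have "\<bar>f x\<bar> \<le> max B 0" for x using B[of x] assms(3)[of x] by (cases "x \<in> K") auto
  then show ?thesis using that[of "max B 0"] by auto
qed

text \<open>Lebesgue measure is translation invariant, so difference quotients of a compactly supported
  function have integral zero; let the step tend to zero.\<close>

lemma integral_pd_eq_0:
  fixes h :: "real ^ 'n::finite \<Rightarrow> real"
  assumes h: "smooth_on UNIV h" and K: "compact K" "\<And>x. x \<notin> K \<Longrightarrow> h x = 0"
  shows "(LINT x|lborel. pd h i x) = 0"
proof -
  let ?e = "axis i 1 :: real ^ 'n"
  have ch: "continuous_on UNIV h" and cp: "continuous_on UNIV (pd h i)"
    by (auto intro!: smooth_on_imp_continuous_on smooth_intros h)
  have pd0: "pd h i x = 0" if "x \<notin> K" for x
  proof -
    have "pd h i x = pd (\<lambda>x. 0) i x"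
      by (rule pd_cong[of "- K"]) (use that K compact_imp_closed smooth_on_subset[OF h] in auto)
    then show ?thesis by (simp add: pd_const)
  qed
  obtain B where B: "B \<ge> 0" "\<And>x. \<bar>pd h i x\<bar> \<le> B"
    using continuous_on_compact_support_bounded[OF continuous_on_subset[OF cp] K(1) pd0] by auto
  define K' where "K' = (\<lambda>(x, s). x - s *\<^sub>R ?e) ` (K \<times> {0..1})"
  have K': "compact K'"
    unfolding K'_def by (intro compact_continuous_image compact_Times K compact_Icc)
      (auto intro!: continuous_intros simp: case_prod_beta)
  have KK': "K \<subseteq> K'" unfolding K'_def by force
  define s where "s n x = real (Suc n) * (h (x + inverse (real (Suc n)) *\<^sub>R ?e) - h x)" for n x
  have deriv: "((\<lambda>t. h (x + t *\<^sub>R ?e)) has_real_derivative pd h i (x + t *\<^sub>R ?e)) (at t)" for x t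
  proof -
    have "((\<lambda>t. x + t *\<^sub>R ?e) has_derivative (\<lambda>r. r *\<^sub>R ?e)) (at t)"
      by (auto intro!: derivative_eq_intros)
    from has_derivative_compose[OF this smooth_on_has_derivative[OF h UNIV_I]]
    show ?thesis
      using linear_cmul[OF has_derivative_linear[OF smooth_on_has_derivative[OF h UNIV_I]]]
      by (simp add: has_field_derivative_def pd_def mult.commute[of _ "frechet_derivative _ _ _"])
  qed
  have bound: "norm (s n x) \<le> indicator K' x * B" for n x
  proof (cases "x \<in> K'")
    case True
    let ?t = "inverse (real (Suc n))"
    obtain c where "0 < c" "c < ?t" "h (x + ?t *\<^sub>R ?e) - h (x + 0 *\<^sub>R ?e) = (?t - 0) * pd h i (x + c *\<^sub>R ?e)"
      using MVT2[of 0 ?t "\<lambda>t. h (x + t *\<^sub>R ?e)" "\<lambda>t. pd h i (x + t *\<^sub>R ?e)"] deriv by auto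
    then have "s n x = pd h i (x + c *\<^sub>R ?e)" by (simp add: s_def)
    then show ?thesis using B(2) True by simp
  next
    case False
    have "x + inverse (real (Suc n)) *\<^sub>R ?e \<notin> K"
    proof
      assume "x + inverse (real (Suc n)) *\<^sub>R ?e \<in> K"
      moreover have "inverse (real (Suc n)) \<in> {0..1}" by (simp add: inverse_le_1_iff)
      ultimately have "(\<lambda>(x, s). x - s *\<^sub>R ?e) (x + inverse (real (Suc n)) *\<^sub>R ?e, inverse (real (Suc n))) \<in> K'"
        unfolding K'_def by (intro imageI) blast
      then show False using False by simp
    qed
    moreover have "x \<notin> K" using False KK' by blast
    ultimately show ?thesis using False K by (simp add: s_def)
  qed
  have hint: "integrable lborel h"
  proof -
    have "integrable lborel (\<lambda>x. indicator K x *\<^sub>R h x)"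
      by (rule borel_integrable_compact[OF K(1)]) (rule continuous_on_subset[OF ch], simp)
    moreover have "(\<lambda>x. indicator K x *\<^sub>R h x) = h" using K(2) by (intro ext) (metis indicator_simps scaleR_one scaleR_zero_right)
    ultimately show ?thesis by simp
  qed
  have tr: "integrable lborel (\<lambda>x. h (x + a))" "(LINT x|lborel. h (x + a)) = (LINT x|lborel. h x)" for a
  proof -
    have "h \<in> borel_measurable borel" using ch by (rule borel_measurable_continuous_onI)
    then show "(LINT x|lborel. h (x + a)) = (LINT x|lborel. h x)"
      by (subst lborel_distr_plus[of a, symmetric], subst integral_distr) (auto simp: add.commute)
    have "integrable (distr lborel borel ((+) a)) h" using hint by (simp add: lborel_distr_plus)
    then show "integrable lborel (\<lambda>x. h (x + a))"
      by (subst (asm) integrable_distr_eq) (use \<open>h \<in> borel_measurable borel\<close> in \<open>auto simp: add.commute\<close>)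
  qed
  have int0: "(LINT x|lborel. s n x) = 0" for n
    unfolding s_def using tr hint by (simp add: Bochner_Integration.integral_diff)
  have lim: "(\<lambda>n. s n x) \<longlonglongrightarrow> pd h i x" for x
  proof -
    have "((\<lambda>t. (h (x + t *\<^sub>R ?e) - h x) / t) \<longlongrightarrow> pd h i x) (at 0)"
      using deriv[of x 0] by (simp add: has_field_derivative_iff)
    moreover have "filterlim (\<lambda>n. inverse (real (Suc n))) (at 0) sequentially"
      unfolding filterlim_at using LIMSEQ_inverse_real_of_nat by (auto simp del: of_nat_Suc)
    ultimately have "(\<lambda>n. (h (x + inverse (real (Suc n)) *\<^sub>R ?e) - h x) / inverse (real (Suc n))) \<longlonglongrightarrow> pd h i x"
      by (rule filterlim_compose)
    then show ?thesis by (simp add: s_def divide_inverse mult.commute)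
  qed
  have meas: "s n \<in> borel_measurable lborel" for n
  proof -
    have "continuous_on UNIV (s n)"
      unfolding s_def by (intro continuous_intros continuous_on_compose2[OF ch]) auto
    then show ?thesis using borel_measurable_continuous_onI by simp
  qed
  have "integrable lborel (\<lambda>x. indicator K' x * B)"
    using borel_integrable_compact[OF K' continuous_on_const, of B] by (simp add: mult.commute)
  then have "(\<lambda>n. LINT x|lborel. s n x) \<longlonglongrightarrow> (LINT x|lborel. pd h i x)"
    by (intro integral_dominated_convergence[where w = "\<lambda>x. indicator K' x * B"] AE_I2 lim bound meas)
       (auto intro: borel_measurable_continuous_onI[OF cp])
  then show ?thesis by (simp add: int0 LIMSEQ_const_iff)
qed

context immersed_chart
begin

text \<open>The divergence has compact support in \<open>U\<close>, so its integral vanishes.\<close>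

lemma green_identity:
  fixes f u :: "real ^ 'n \<Rightarrow> 'w::euclidean_space"
  assumes f: "smooth_on U f" and u: "smooth_on U u"
    and K: "compact K" "K \<subseteq> U" and u0: "\<And>x. x \<in> U - K \<Longrightarrow> u x = 0"
  shows "(LINT x:K|lborel. vol x * (\<Sum>i\<in>UNIV. \<Sum>j\<in>UNIV. (E i x \<bullet> E j x) * (pd f i x \<bullet> pd u j x))) =
    - (LINT x:K|lborel. vol x * (lap f x \<bullet> u x))"
proof -
  define Z where "Z j x = vol x * (\<Sum>i\<in>UNIV. (E i x \<bullet> E j x) * (pd f i x \<bullet> u x))" for j x
  define Z' where "Z' j x = (if x \<in> U then Z j x else 0)" for j x
  have sZ: "smooth_on U (Z j)" for j
    unfolding Z_def by (intro smooth_intros open_U smooth_vol smooth_E f u)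
  have Z0: "Z j x = 0" if "x \<in> U - K" for x j using u0[OF that] by (simp add: Z_def)
  have sZ': "smooth_on UNIV (Z' j)" for j
    unfolding Z'_def by (rule smooth_on_extend_by_zero[OF open_U sZ _ K(2) Z0]) (use K compact_imp_closed in auto)
  have Z'0: "Z' j x = 0" if "x \<notin> K" for x j using Z0 that by (auto simp: Z'_def)
  have pdZ: "pd (Z' j) j x = indicator K x *\<^sub>R pd (Z j) j x" for j x
  proof (cases "x \<in> K")
    case True
    have "pd (Z j) j x = pd (Z' j) j x"
      by (rule pd_cong[OF open_U _ _ sZ]) (use True K in \<open>auto simp: Z'_def\<close>)
    then show ?thesis using True by simp
  next
    case False
    have "pd (Z' j) j x = pd (\<lambda>x. 0) j x"
      by (rule pd_cong[of "- K"]) (use False K compact_imp_closed smooth_on_subset[OF sZ'] Z'0 in auto)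
    then show ?thesis using False by (simp add: pd_const)
  qed
  have int: "integrable lborel (\<lambda>x. indicator K x *\<^sub>R F x)" if "smooth_on U F" for F :: "real ^ 'n \<Rightarrow> real"
    by (rule borel_integrable_compact[OF K(1)]) (rule continuous_on_subset[OF smooth_on_imp_continuous_on[OF that] K(2)])
  let ?A = "\<lambda>x. vol x * (\<Sum>i\<in>UNIV. \<Sum>j\<in>UNIV. (E i x \<bullet> E j x) * (pd f i x \<bullet> pd u j x))"
  let ?B = "\<lambda>x. vol x * (lap f x \<bullet> u x)"
  have sA: "smooth_on U ?A" by (intro smooth_intros open_U smooth_vol smooth_E f u)
  have sB: "smooth_on U ?B"
    unfolding lap_def by (intro smooth_intros open_U smooth_vol smooth_E smooth_y f u)
  have "0 = (\<Sum>j\<in>UNIV. (LINT x|lborel. pd (Z' j) j x))"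
    by (simp add: integral_pd_eq_0[OF sZ' K(1) Z'0])
  also have "\<dots> = (\<Sum>j\<in>UNIV. (LINT x|lborel. indicator K x *\<^sub>R pd (Z j) j x))"
    by (simp only: pdZ)
  also have "\<dots> = (LINT x|lborel. (\<Sum>j\<in>UNIV. indicator K x *\<^sub>R pd (Z j) j x))"
    by (rule Bochner_Integration.integral_sum[symmetric]) (intro int smooth_intros sZ)
  also have "\<dots> = (LINT x|lborel. indicator K x *\<^sub>R ?A x + indicator K x *\<^sub>R ?B x)"
  proof (rule Bochner_Integration.integral_cong[OF refl])
    fix x
    show "(\<Sum>j\<in>UNIV. indicator K x *\<^sub>R pd (Z j) j x) = indicator K x *\<^sub>R ?A x + indicator K x *\<^sub>R ?B x"
      using divergence_identity[OF f u, of x] K(2)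
      by (cases "x \<in> K") (auto simp: Z_def[abs_def] distrib_left)
  qed
  also have "\<dots> = (LINT x:K|lborel. ?A x) + (LINT x:K|lborel. ?B x)"
    unfolding set_lebesgue_integral_def by (rule Bochner_Integration.integral_add[OF int[OF sA] int[OF sB]])
  finally show ?thesis by simp
qed

end

section \<open>Transition maps between charts\<close>

lemma immersed_chart_local_param:
  "local_param M \<mu> U \<phi> \<Longrightarrow> immersed_chart U (\<mu> \<circ> \<phi>)"
  by (simp add: local_param_def immersed_chart_def)

text \<open>If \<open>Y \<circ> h = X\<close> with \<open>Y\<close> immersive and \<open>h\<close> merely continuous at a point, then \<open>h\<close> is
  differentiable there: a left inverse of the derivative of \<open>Y\<close> reduces this to the case in which
  that derivative is the identity, where the increments of \<open>h\<close> and of \<open>X\<close> differ by a small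
  fraction.\<close>

lemma has_derivative_of_lift:
  fixes X :: "'a::real_normed_vector \<Rightarrow> 'c::euclidean_space" and Y :: "'b::euclidean_space \<Rightarrow> 'c"
  assumes Y: "(Y has_derivative Y') (at (h x))" "inj Y'"
    and X: "(X has_derivative X') (at x)"
    and h: "isCont h x" and eq: "\<forall>\<^sub>F z in nhds x. Y (h z) = X z"
  shows "\<exists>h'. (h has_derivative h') (at x)"
proof -
  obtain L where L: "linear L" "L \<circ> Y' = id"
    using linear_injective_left_inverse[OF has_derivative_linear[OF Y(1)] Y(2)] by blast
  have bL: "bounded_linear L" using L by (simp add: linear_conv_bounded_linear)
  define P where "P z = L (Y z)" for z
  define q where "q z = L (X z)" for z
  have P: "(P has_derivative (\<lambda>v. v)) (at (h x))"
    using bounded_linear.has_derivative[OF bL Y(1)] L(2) by (simp add: P_def[abs_def] fun_eq_iff)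
  define B where "B v = L (X' v)" for v
  have q: "(q has_derivative B) (at x)"
    using bounded_linear.has_derivative[OF bL X] by (simp add: q_def[abs_def] B_def[abs_def])
  have eqPq: "\<forall>\<^sub>F z in nhds x. P (h z) = q z"
    using eq by eventually_elim (simp add: P_def q_def)
  have Px: "P (h x) = q x" using eventually_nhds_x_imp_x[OF eqPq] .
  have bB: "bounded_linear B" using q by (rule has_derivative_bounded_linear)
  obtain \<beta> where \<beta>: "\<beta> > 0" "\<And>v. norm (B v) \<le> norm v * \<beta>"
    using bounded_linear.pos_bounded[OF bB] by blast
  have "(h has_derivative B) (at x)"
    unfolding has_derivative_at_alt
  proof (intro conjI bB allI impI)
    fix e :: real assume e: "e > 0"
    define \<epsilon> where "\<epsilon> = min (1/2) (e / (2 * \<beta> + 3))"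
    have \<epsilon>: "\<epsilon> > 0" "\<epsilon> \<le> 1/2"
      unfolding \<epsilon>_def using e \<beta>(1) by (simp_all only: min_less_iff_conj min.cobounded1) auto
    have "\<epsilon> \<le> e / (2 * \<beta> + 3)" by (simp add: \<epsilon>_def)
    then have \<epsilon>3: "\<epsilon> * (2 * \<beta> + 3) \<le> e" using \<beta>(1) by (simp add: pos_le_divide_eq)
    obtain d1 where d1: "d1 > 0" "\<And>z. norm (z - h x) < d1 \<Longrightarrow> norm (P z - P (h x) - (z - h x)) \<le> \<epsilon> * norm (z - h x)"
      using P \<epsilon>(1) unfolding has_derivative_at_alt by blast
    obtain d2 where d2: "d2 > 0" "\<And>z. norm (z - x) < d2 \<Longrightarrow> norm (q z - q x - B (z - x)) \<le> \<epsilon> * norm (z - x)"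
      using q \<epsilon>(1) unfolding has_derivative_at_alt by blast
    obtain d3 where d3: "d3 > 0" "\<And>z. norm (z - x) < d3 \<Longrightarrow> norm (h z - h x) < d1"
      using h d1(1) unfolding continuous_at_eps_delta dist_norm by blast
    obtain d4 where d4: "d4 > 0" "\<And>z. norm (z - x) < d4 \<Longrightarrow> P (h z) = q z"
      using eqPq unfolding eventually_nhds_metric dist_norm by blast
    show "\<exists>d>0. \<forall>z. norm (z - x) < d \<longrightarrow> norm (h z - h x - B (z - x)) \<le> e * norm (z - x)"
    proof (intro exI conjI allI impI)
      show "min d2 (min d3 d4) > 0" using d2 d3 d4 by simp
      fix z assume z: "norm (z - x) < min d2 (min d3 d4)"
      let ?\<Delta> = "h z - h x" and ?v = "z - x"
      have 1: "norm (q z - q x - ?\<Delta>) \<le> \<epsilon> * norm ?\<Delta>"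
        using d1(2)[OF d3(2)[of z]] d4(2)[of z] z Px by simp
      have 2: "norm (q z - q x - B ?v) \<le> \<epsilon> * norm ?v" using d2(2)[of z] z by simp
      have 3: "norm (?\<Delta> - B ?v) \<le> \<epsilon> * norm ?\<Delta> + \<epsilon> * norm ?v"
        using norm_triangle_ineq4[of "q z - q x - B ?v" "q z - q x - ?\<Delta>"] 1 2 by (simp add: algebra_simps)
      have 4: "norm ?\<Delta> \<le> norm (?\<Delta> - B ?v) + norm (B ?v)" using norm_triangle_ineq[of "?\<Delta> - B ?v" "B ?v"] by simp
      have 5: "\<epsilon> * norm ?\<Delta> \<le> 1/2 * norm ?\<Delta>" by (rule mult_right_mono[OF \<epsilon>(2)]) simp
      have 6: "\<epsilon> * norm ?v \<le> 1/2 * norm ?v" by (rule mult_right_mono[OF \<epsilon>(2)]) simp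
      have "norm ?\<Delta> \<le> 2 * (norm ?v * \<beta>) + norm ?v" using 3 4 5 6 \<beta>(2)[of ?v] by linarith
      then have "\<epsilon> * norm ?\<Delta> \<le> \<epsilon> * (2 * (norm ?v * \<beta>) + norm ?v)" using \<epsilon>(1) by simp
      then have "norm (?\<Delta> - B ?v) \<le> \<epsilon> * (2 * \<beta> + 2) * norm ?v" using 3 by (simp add: algebra_simps)
      also have "\<dots> \<le> \<epsilon> * (2 * \<beta> + 3) * norm ?v" using \<epsilon>(1) by (intro mult_right_mono mult_left_mono) auto
      also have "\<dots> \<le> e * norm ?v" by (rule mult_right_mono[OF \<epsilon>3]) simp
      finally show "norm (?\<Delta> - B ?v) \<le> e * norm ?v" .
    qed
  qed
  then show ?thesis by blast
qed

lemma local_paramD: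
  assumes "local_param M \<mu> U \<phi>"
  shows "open U" "openin (top_of_set M) (\<phi> ` U)" "inj_on \<phi> U" "continuous_on U \<phi>"
    "continuous_on (\<phi> ` U) (inv_into U \<phi>)" "smooth_on U (\<mu> \<circ> \<phi>)" "\<phi> ` U \<subseteq> M"
proof -
  obtain \<psi> where \<psi>: "homeomorphism U (\<phi> ` U) \<phi> \<psi>" using assms by (auto simp: local_param_def)
  show inj: "inj_on \<phi> U" by (rule inj_on_inverseI) (rule homeomorphism_apply1[OF \<psi>])
  show "continuous_on U \<phi>" using \<psi> homeomorphism_cont1 by blast
  have "inv_into U \<phi> p = \<psi> p" if "p \<in> \<phi> ` U" for p
    using that homeomorphism_apply1[OF \<psi>] inv_into_f_f[OF inj] by auto
  then show "continuous_on (\<phi> ` U) (inv_into U \<phi>)"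
    using homeomorphism_cont2[OF \<psi>] by (simp cong: continuous_on_cong)
  show "open U" "openin (top_of_set M) (\<phi> ` U)" "smooth_on U (\<mu> \<circ> \<phi>)"
    using assms by (auto simp: local_param_def)
  then show "\<phi> ` U \<subseteq> M" by (auto dest: openin_imp_subset)
qed

lemma local_param_image_openin:
  assumes "local_param M \<mu> U \<phi>" "open W" "W \<subseteq> U"
  shows "openin (top_of_set M) (\<phi> ` W)"
proof -
  note \<phi> = local_paramD[OF assms(1)]
  have "openin (top_of_set (\<phi> ` U)) (\<phi> ` U \<inter> inv_into U \<phi> -` W)"
    by (rule continuous_openin_preimage_gen[OF \<phi>(5) assms(2)])
  moreover have "\<phi> ` U \<inter> inv_into U \<phi> -` W = \<phi> ` W"
    using assms(3) \<phi>(3) by (auto simp: inv_into_f_f image_iff subset_iff)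
  ultimately show ?thesis using \<phi>(2) openin_trans by metis
qed

definition transition :: "(real ^ 'n::finite) set \<Rightarrow> (real ^ 'n \<Rightarrow> 'm) \<Rightarrow> (real ^ 'n \<Rightarrow> 'm) \<Rightarrow> real ^ 'n \<Rightarrow> real ^ 'n" where
  "transition V \<psi> \<phi> x = inv_into V \<psi> (\<phi> x)"

text \<open>From \<open>\<psi> \<circ> h = \<phi>\<close> follows \<open>(\<mu> \<circ> \<psi>) \<circ> h = \<mu> \<circ> \<phi>\<close>, where \<open>\<mu> \<circ> \<psi>\<close> is an immersion. This
  makes the transition map \<open>h\<close>, a homeomorphism by definition, differentiable.\<close>

lemma transition_properties:
  assumes \<phi>: "local_param M \<mu> U \<phi>" and \<psi>: "local_param M \<mu> V \<psi>"
  defines "W \<equiv> {x \<in> U. \<phi> x \<in> \<psi> ` V}" and "h \<equiv> transition V \<psi> \<phi>"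
  shows "open W" "continuous_on W h" "inj_on h W" "h ` W \<subseteq> V" "\<And>x. x \<in> W \<Longrightarrow> \<psi> (h x) = \<phi> x"
    "\<And>x. x \<in> W \<Longrightarrow> (h has_derivative frechet_derivative h (at x)) (at x)"
proof -
  note p = local_paramD[OF \<phi>] and q = local_paramD[OF \<psi>]
  obtain O' where O': "open O'" "\<psi> ` V = M \<inter> O'" using q(2) by (auto simp: openin_open)
  have W: "W = U \<inter> \<phi> -` O'" using O' p(7) by (auto simp: W_def)
  show oW: "open W" unfolding W by (rule continuous_open_preimage[OF p(4,1) O'(1)])
  show hV: "h ` W \<subseteq> V" by (auto simp: h_def transition_def W_def intro: inv_into_into)
  show eq: "\<psi> (h x) = \<phi> x" if "x \<in> W" for x
    using that by (auto simp: h_def transition_def W_def f_inv_into_f)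
  show "inj_on h W"
  proof (rule inj_onI)
    fix a b assume "a \<in> W" "b \<in> W" "h a = h b"
    then have "\<phi> a = \<phi> b" using eq by metis
    then show "a = b" using p(3) \<open>a \<in> W\<close> \<open>b \<in> W\<close> by (auto simp: W_def inj_on_def)
  qed
  show ch: "continuous_on W h"
    unfolding h_def transition_def
    by (rule continuous_on_compose2[OF q(5) continuous_on_subset[OF p(4)]]) (auto simp: W_def)
  interpret Y: immersed_chart V "\<mu> \<circ> \<psi>" by (rule immersed_chart_local_param[OF \<psi>])
  fix x assume x: "x \<in> W"
  have hx: "h x \<in> V" using hV x by blast
  have "\<exists>h'. (h has_derivative h') (at x)"
  proof (rule has_derivative_of_lift)
    show "((\<mu> \<circ> \<psi>) has_derivative frechet_derivative (\<mu> \<circ> \<psi>) (at (h x))) (at (h x))"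
      by (rule smooth_on_has_derivative[OF q(6) hx])
    show "inj (frechet_derivative (\<mu> \<circ> \<psi>) (at (h x)))" by (rule Y.inj_dy[OF hx])
    show "((\<mu> \<circ> \<phi>) has_derivative frechet_derivative (\<mu> \<circ> \<phi>) (at x)) (at x)"
      by (rule smooth_on_has_derivative[OF p(6)]) (use x in \<open>simp add: W_def\<close>)
    show "isCont h x" using ch oW x by (simp add: continuous_on_eq_continuous_at)
    show "\<forall>\<^sub>F z in nhds x. (\<mu> \<circ> \<psi>) (h z) = (\<mu> \<circ> \<phi>) z"
      using eventually_nhds_in_open[OF oW x] by eventually_elim (simp add: eq)
  qed
  then show "(h has_derivative frechet_derivative h (at x)) (at x)"
    by (metis frechet_derivative_at)
qed

lemma frechet_derivative_transition:
  assumes \<phi>: "local_param M \<mu> U \<phi>" and \<psi>: "local_param M \<mu> V \<psi>"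
    and x: "x \<in> U" "\<phi> x \<in> \<psi> ` V" and f: "smooth_on V (f \<circ> \<psi>)"
  shows "frechet_derivative (f \<circ> \<phi>) (at x) v =
    frechet_derivative (f \<circ> \<psi>) (at (transition V \<psi> \<phi> x)) (frechet_derivative (transition V \<psi> \<phi>) (at x) v)"
proof -
  note t = transition_properties[OF \<phi> \<psi>]
  let ?W = "{x \<in> U. \<phi> x \<in> \<psi> ` V}" and ?h = "transition V \<psi> \<phi>"
  have xW: "x \<in> ?W" using x by simp
  have "((\<lambda>z. (f \<circ> \<psi>) (?h z)) has_derivative
      (\<lambda>v. frechet_derivative (f \<circ> \<psi>) (at (?h x)) (frechet_derivative ?h (at x) v))) (at x)"
    by (rule has_derivative_compose[OF t(6)[OF xW] smooth_on_has_derivative[OF f]]) (use t(4) xW in blast)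
  then have "((f \<circ> \<phi>) has_derivative
      (\<lambda>v. frechet_derivative (f \<circ> \<psi>) (at (?h x)) (frechet_derivative ?h (at x) v))) (at x)"
    by (rule has_derivative_transform_within_open[OF _ t(1) xW]) (simp add: t(5))
  then show ?thesis by (metis frechet_derivative_at)
qed

section \<open>Tangent spaces, differentials and the energy density in a chart\<close>

text \<open>Two charts that represent the same tangent vector are related by the derivative of the transition
  map, and the chain rule shows that they give the same value of \<open>df\<close>.\<close>

lemma dmap_chart:
  assumes \<phi>: "local_param M \<mu> U \<phi>" and x: "x \<in> U" and f: "smooth_map M \<mu> f"
  shows "dmap M \<mu> f (\<phi> x) (frechet_derivative (\<mu> \<circ> \<phi>) (at x) v) = frechet_derivative (f \<circ> \<phi>) (at x) v"
  unfolding dmap_def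
proof (rule the_equality)
  show "\<exists>U' \<phi>' x' v'. local_param M \<mu> U' \<phi>' \<and> x' \<in> U' \<and> \<phi>' x' = \<phi> x \<and>
      frechet_derivative (\<mu> \<circ> \<phi>) (at x) v = frechet_derivative (\<mu> \<circ> \<phi>') (at x') v' \<and>
      frechet_derivative (f \<circ> \<phi>) (at x) v = frechet_derivative (f \<circ> \<phi>') (at x') v'"
    using \<phi> x by blast
next
  fix w
  assume "\<exists>U' \<phi>' x' v'. local_param M \<mu> U' \<phi>' \<and> x' \<in> U' \<and> \<phi>' x' = \<phi> x \<and>
      frechet_derivative (\<mu> \<circ> \<phi>) (at x) v = frechet_derivative (\<mu> \<circ> \<phi>') (at x') v' \<and>
      w = frechet_derivative (f \<circ> \<phi>') (at x') v'"
  then obtain V \<psi> z v' where \<psi>: "local_param M \<mu> V \<psi>" and z: "z \<in> V" "\<psi> z = \<phi> x"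
    and eq: "frechet_derivative (\<mu> \<circ> \<phi>) (at x) v = frechet_derivative (\<mu> \<circ> \<psi>) (at z) v'"
    and w: "w = frechet_derivative (f \<circ> \<psi>) (at z) v'" by blast
  have xV: "\<phi> x \<in> \<psi> ` V" using z by (metis imageI)
  have tz: "transition V \<psi> \<phi> x = z"
    using z local_paramD(3)[OF \<psi>] by (metis inv_into_f_f transition_def)
  interpret Y: immersed_chart V "\<mu> \<circ> \<psi>" by (rule immersed_chart_local_param[OF \<psi>])
  let ?v = "frechet_derivative (transition V \<psi> \<phi>) (at x) v"
  have "frechet_derivative (\<mu> \<circ> \<psi>) (at z) v' = frechet_derivative (\<mu> \<circ> \<psi>) (at z) ?v"
    using frechet_derivative_transition[OF \<phi> \<psi> x xV local_paramD(6)[OF \<psi>], of v] eq tz by simp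
  then have "v' = ?v" using Y.inj_dy[OF z(1)] by (simp add: inj_eq)
  moreover have "smooth_on V (f \<circ> \<psi>)" using f \<psi> by (simp add: smooth_map_def)
  ultimately show "w = frechet_derivative (f \<circ> \<phi>) (at x) v"
    using frechet_derivative_transition[OF \<phi> \<psi> x xV, of f v] tz w by simp
qed

lemma tangent_space_chart:
  assumes \<phi>: "local_param M \<mu> U \<phi>" and x: "x \<in> U"
  shows "tangent_space M \<mu> (\<phi> x) = span (range (\<lambda>i. pd (\<mu> \<circ> \<phi>) i x))"
proof -
  interpret immersed_chart U "\<mu> \<circ> \<phi>" by (rule immersed_chart_local_param[OF \<phi>])
  have "tangent_space M \<mu> (\<phi> x) = range (frechet_derivative (\<mu> \<circ> \<phi>) (at x))"
  proof
    show "range (frechet_derivative (\<mu> \<circ> \<phi>) (at x)) \<subseteq> tangent_space M \<mu> (\<phi> x)"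
      unfolding tangent_space_def using \<phi> x by blast
    show "tangent_space M \<mu> (\<phi> x) \<subseteq> range (frechet_derivative (\<mu> \<circ> \<phi>) (at x))"
    proof
      fix w assume "w \<in> tangent_space M \<mu> (\<phi> x)"
      then obtain V \<psi> z v where \<psi>: "local_param M \<mu> V \<psi>" "z \<in> V" "\<psi> z = \<phi> x"
        and w: "w = frechet_derivative (\<mu> \<circ> \<psi>) (at z) v" unfolding tangent_space_def by blast
      have zU: "\<psi> z \<in> \<phi> ` U" using \<psi>(3) x by simp
      have tz: "transition U \<phi> \<psi> z = x"
        using \<psi> x local_paramD(3)[OF \<phi>] by (simp add: transition_def inv_into_f_f)
      show "w \<in> range (frechet_derivative (\<mu> \<circ> \<phi>) (at x))"
        using frechet_derivative_transition[OF \<psi>(1) \<phi> \<psi>(2) zU local_paramD(6)[OF \<phi>], of v] w tz by auto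
    qed
  qed
  then show ?thesis using range_dy_eq_span[OF x] by simp
qed

lemma subspace_tangent_space: "local_param M \<mu> U \<phi> \<Longrightarrow> x \<in> U \<Longrightarrow> subspace (tangent_space M \<mu> (\<phi> x))"
  by (simp add: tangent_space_chart)

lemma dmap_frame:
  assumes \<phi>: "local_param M \<mu> U \<phi>" and x: "x \<in> U" and f: "smooth_map M \<mu> f"
  shows "dmap M \<mu> f (\<phi> x) (pd (\<mu> \<circ> \<phi>) i x) = pd (f \<circ> \<phi>) i x"
    and "dmap M \<mu> f (\<phi> x) (\<Sum>i\<in>UNIV. c i *\<^sub>R pd (\<mu> \<circ> \<phi>) i x) =
      (\<Sum>i\<in>UNIV. c i *\<^sub>R dmap M \<mu> f (\<phi> x) (pd (\<mu> \<circ> \<phi>) i x))"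
proof -
  have f': "smooth_on U (f \<circ> \<phi>)" using f \<phi> by (simp add: smooth_map_def)
  show *: "dmap M \<mu> f (\<phi> x) (pd (\<mu> \<circ> \<phi>) i x) = pd (f \<circ> \<phi>) i x" for i
    using dmap_chart[OF assms] by (simp add: pd_def)
  show "dmap M \<mu> f (\<phi> x) (\<Sum>i\<in>UNIV. c i *\<^sub>R pd (\<mu> \<circ> \<phi>) i x) =
      (\<Sum>i\<in>UNIV. c i *\<^sub>R dmap M \<mu> f (\<phi> x) (pd (\<mu> \<circ> \<phi>) i x))"
    using dmap_chart[OF assms, of "\<chi> i. c i"]
    by (simp add: * frechet_derivative_pd[OF smooth_on_has_derivative[OF local_paramD(6)[OF \<phi>] x]]
        frechet_derivative_pd[OF smooth_on_has_derivative[OF f' x]])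
qed

text \<open>The bilinear form whose diagonal is the energy density \<open>\<parallel>df\<parallel>\<^sup>2\<close>.\<close>

definition dirichlet_form ::
    "'m::{t2_space,second_countable_topology} set \<Rightarrow> ('m \<Rightarrow> real ^ ('n::finite + 2)) \<Rightarrow>
     ('m \<Rightarrow> 'c::real_inner) \<Rightarrow> ('m \<Rightarrow> 'c) \<Rightarrow> 'm \<Rightarrow> real" where
  "dirichlet_form M \<mu> f g p = (\<Sum>b\<in>onb (tangent_space M \<mu> p). dmap M \<mu> f p b \<bullet> dmap M \<mu> g p b)"

lemma hs_norm_dmap: "(hs_norm (tangent_space M \<mu> p) (dmap M \<mu> f p))\<^sup>2 = dirichlet_form M \<mu> f f p"
  unfolding hs_norm_def dirichlet_form_def
  by (subst real_sqrt_pow2) (auto intro: sum_nonneg simp: power2_norm_eq_inner)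

text \<open>The same form in coordinates, for the metric induced by \<open>y\<close> and partial derivatives \<open>a\<close>, \<open>b\<close>.\<close>

definition chart_form :: "(real ^ 'n::finite \<Rightarrow> 'v::real_inner) \<Rightarrow> ('n \<Rightarrow> 'c::real_inner) \<Rightarrow> ('n \<Rightarrow> 'c) \<Rightarrow> real ^ 'n \<Rightarrow> real"
  where "chart_form y a b x = (\<Sum>i\<in>UNIV. \<Sum>j\<in>UNIV.
    (dual_frame (\<lambda>i. pd y i x) i \<bullet> dual_frame (\<lambda>i. pd y i x) j) * (a i \<bullet> b j))"

lemma dirichlet_form_chart:
  assumes \<phi>: "local_param M \<mu> U \<phi>" and x: "x \<in> U" and f: "smooth_map M \<mu> f" and g: "smooth_map M \<mu> g"
  shows "dirichlet_form M \<mu> f g (\<phi> x) =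
    chart_form (\<mu> \<circ> \<phi>) (\<lambda>i. pd (f \<circ> \<phi>) i x) (\<lambda>i. pd (g \<circ> \<phi>) i x) x"
proof -
  interpret immersed_chart U "\<mu> \<circ> \<phi>" by (rule immersed_chart_local_param[OF \<phi>])
  show ?thesis
    unfolding dirichlet_form_def chart_form_def
    by (subst onb_sum_in_frame[OF frame_indep[OF x] tangent_space_chart[OF \<phi> x] dmap_frame(2)[OF \<phi> x f] dmap_frame(2)[OF \<phi> x g]])
       (simp add: dmap_frame(1)[OF \<phi> x f] dmap_frame(1)[OF \<phi> x g])
qed

lemma (in immersed_chart) smooth_chart_form:
  assumes "open W" "smooth_on W \<pi>" "\<pi> ` W \<subseteq> U"
    "\<And>i. smooth_on W (a i)" "\<And>i. smooth_on W (b i)"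
  shows "smooth_on W (\<lambda>z. chart_form y (\<lambda>i. a i z) (\<lambda>i. b i z) (\<pi> z))"
  unfolding chart_form_def by (intro smooth_intros assms smooth_on_compose[OF assms(1,2) smooth_E])

lemma chart_form_sum_right:
  "chart_form y a (\<lambda>i. \<Sum>k\<in>K. b k i) x = (\<Sum>k\<in>K. chart_form y a (b k) x)"
  unfolding chart_form_def inner_sum_right sum_distrib_left
  by (rule trans[OF sum.cong[OF refl sum.swap] sum.swap])

lemma chart_form_commute: "chart_form y a b x = chart_form y b a x"
  unfolding chart_form_def by (subst sum.swap) (simp add: inner_commute)

lemma continuous_on_if_charts:
  assumes M: "sphere_hypersurface M \<mu>"
    and r: "\<And>U \<phi>. local_param M \<mu> U \<phi> \<Longrightarrow> continuous_on U (\<lambda>x. r (\<phi> x))"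
  shows "continuous_on M r"
proof -
  have "continuous (at p within M) r" if p: "p \<in> M" for p
  proof -
    obtain U \<phi> where \<phi>: "local_param M \<mu> U \<phi>" "p \<in> \<phi> ` U"
      using M p by (auto simp: sphere_hypersurface_def)
    note q = local_paramD[OF \<phi>(1)]
    have "continuous_on (\<phi> ` U) (\<lambda>p. r (\<phi> (inv_into U \<phi> p)))"
      by (rule continuous_on_compose2[OF r[OF \<phi>(1)] q(5)]) (auto intro: inv_into_into)
    then have "continuous_on (\<phi> ` U) r"
      by (rule continuous_on_eq) (simp add: f_inv_into_f)
    then have "continuous (at p within \<phi> ` U) r"
      using \<phi>(2) continuous_on_eq_continuous_within by blast
    moreover obtain T where T: "open T" "\<phi> ` U = M \<inter> T" using q(2) by (auto simp: openin_open)
    moreover have "at p within M = at p within (M \<inter> T)"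
      using T \<phi>(2) by (intro at_within_nhd[of p T]) auto
    ultimately show ?thesis by simp
  qed
  then show ?thesis by (simp add: continuous_on_eq_continuous_within)
qed

lemma continuous_on_dirichlet_form:
  assumes "sphere_hypersurface M \<mu>" "smooth_map M \<mu> f" "smooth_map M \<mu> g"
  shows "continuous_on M (dirichlet_form M \<mu> f g)"
proof (rule continuous_on_if_charts[OF assms(1)])
  fix U \<phi> assume \<phi>: "local_param M \<mu> U \<phi>"
  interpret immersed_chart U "\<mu> \<circ> \<phi>" by (rule immersed_chart_local_param[OF \<phi>])
  have "smooth_on U (\<lambda>z. chart_form (\<mu> \<circ> \<phi>) (\<lambda>i. pd (f \<circ> \<phi>) i z) (\<lambda>i. pd (g \<circ> \<phi>) i z) ((\<lambda>z. z) z))"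
    by (rule smooth_chart_form[OF open_U smooth_on_bounded_linear[OF open_U bounded_linear_ident]])
       (use assms \<phi> in \<open>auto simp: smooth_map_def intro!: smooth_on_pd\<close>)
  then show "continuous_on U (\<lambda>x. dirichlet_form M \<mu> f g (\<phi> x))"
    using smooth_on_imp_continuous_on by (simp add: dirichlet_form_chart[OF \<phi> _ assms(2,3)] cong: continuous_on_cong)
qed

section \<open>Bump functions\<close>

text \<open>A cut-off of the distance of \<open>\<mu>\<close> from a point is smooth in every chart. As \<open>\<mu>\<close> need not be
  injective, it is set to zero away from one small coordinate ball, on whose boundary it vanishes
  already.\<close>

lemma bump_function_exists:
  fixes \<mu> :: "'m::{t2_space,second_countable_topology} \<Rightarrow> real ^ ('n::finite + 2)"
  assumes \<phi>: "local_param M \<mu> U \<phi>" and x0: "x0 \<in> W" and W: "open W" "W \<subseteq> U"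
  obtains \<rho> K where "smooth_map M \<mu> \<rho>" "\<And>p. 0 \<le> \<rho> p" "\<And>p. \<rho> p \<le> (1::real)" "\<rho> (\<phi> x0) > 0"
    "compact K" "K \<subseteq> W" "\<And>p. p \<in> M - \<phi> ` K \<Longrightarrow> \<rho> p = 0"
proof -
  interpret immersed_chart U "\<mu> \<circ> \<phi>" by (rule immersed_chart_local_param[OF \<phi>])
  note q = local_paramD[OF \<phi>]
  let ?y = "\<mu> \<circ> \<phi>" and ?D = "frechet_derivative (\<mu> \<circ> \<phi>) (at x0)"
  have x0U: "x0 \<in> U" using x0 W by blast
  have hd: "(?y has_derivative ?D) (at x0)" by (rule smooth_on_has_derivative[OF smooth_y x0U])
  obtain B where B: "B > 0" "\<And>v. B * norm v \<le> norm (?D v)"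
    using linear_inj_bounded_below_pos[OF has_derivative_linear[OF hd] inj_dy[OF x0U]] by blast
  obtain d where d: "d > 0" "\<And>x. norm (x - x0) < d \<Longrightarrow> norm (?y x - ?y x0 - ?D (x - x0)) \<le> (B/2) * norm (x - x0)"
    using hd B(1) unfolding has_derivative_at_alt by (metis half_gt_zero)
  obtain d' where d': "d' > 0" "ball x0 d' \<subseteq> W" using W x0 open_contains_ball by blast
  define r where "r = min d d' / 2"
  have r: "r > 0" "r < d" "r < d'" using d d' by (auto simp: r_def)
  \<comment> \<open>near \<open>x0\<close> the immersion shrinks distances from \<open>x0\<close> at most by the factor \<open>B/2\<close>\<close>
  have low: "(B/2) * norm (x - x0) \<le> norm (?y x - ?y x0)" if "x \<in> cball x0 r" for x
  proof -
    have "norm (x - x0) < d" using that r by (simp add: dist_norm norm_minus_commute)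
    from d(2)[OF this] have "norm (?D (x - x0)) - norm (?y x - ?y x0) \<le> (B/2) * norm (x - x0)"
      using norm_triangle_ineq2[of "?D (x - x0)" "?y x - ?y x0"] by (simp add: norm_minus_commute)
    then show ?thesis using B(2)[of "x - x0"] by linarith
  qed
  \<comment> \<open>the squared distance of \<open>\<mu>\<close> from its value at \<open>x0\<close> is at least \<open>\<delta>\<close> between the radii \<open>r/2\<close> and \<open>r\<close>\<close>
  define \<delta> where "\<delta> = (B/2 * (r/2))\<^sup>2"
  have \<delta>: "\<delta> > 0" using B r by (simp add: \<delta>_def)
  define s where "s p = exp_cutoff 0 (\<delta> - (\<mu> p - \<mu> (\<phi> x0)) \<bullet> (\<mu> p - \<mu> (\<phi> x0)))" for p
  define \<rho> where "\<rho> p = (if p \<in> \<phi> ` ball x0 r then s p else 0)" for p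
  let ?K = "cball x0 (r/2)"
  have KW: "?K \<subseteq> ball x0 r" "ball x0 r \<subseteq> W" using r d' by auto
  have s0: "s p = 0" if p: "p \<in> \<phi> ` cball x0 r - \<phi> ` ?K" for p
  proof -
    obtain x where x: "x \<in> cball x0 r" "p = \<phi> x" using p by blast
    have x': "x \<notin> ?K" using p x by blast
    have "B/2 * (r/2) \<le> (B/2) * norm (x - x0)"
      using x' B by (intro mult_left_mono) (auto simp: dist_norm norm_minus_commute)
    also have "\<dots> \<le> norm (\<mu> p - \<mu> (\<phi> x0))" using low[OF x(1)] x(2) by simp
    finally have "\<delta> \<le> (norm (\<mu> p - \<mu> (\<phi> x0)))\<^sup>2"
      unfolding \<delta>_def using B r by (intro power_mono) auto
    then show ?thesis by (simp add: s_def exp_cutoff_def power2_norm_eq_inner)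
  qed
  have \<rho>0: "\<rho> p = 0" if "p \<notin> \<phi> ` ?K" for p
    using that s0[of p] ball_subset_cball[of x0 r] by (auto simp: \<rho>_def)
  have sm: "smooth_map M \<mu> s"
    unfolding smooth_map_def
  proof (intro allI impI)
    fix V \<psi> assume \<psi>: "local_param M \<mu> V \<psi>"
    have 1: "smooth_on V (\<mu> \<circ> \<psi>)" "open V" using local_paramD[OF \<psi>] by auto
    then have 2: "smooth_on V (\<lambda>z. \<mu> (\<psi> z))" by (simp add: o_def)
    show "smooth_on V (s \<circ> \<psi>)"
      unfolding s_def o_def
      by (rule smooth_on_compose[OF 1(2) _ smooth_on_exp_cutoff subset_UNIV]) (intro smooth_intros 1 2)
  qed
  have "smooth_map M \<mu> \<rho>"
    unfolding smooth_map_def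
  proof (intro allI impI smooth_on_local)
    fix V \<psi> z assume \<psi>: "local_param M \<mu> V \<psi>" and z: "z \<in> V"
    note q' = local_paramD[OF \<psi>]
    have sV: "smooth_on V (s \<circ> \<psi>)" using sm \<psi> by (simp add: smooth_map_def)
    show "\<exists>O'. open O' \<and> z \<in> O' \<and> smooth_on O' (\<rho> \<circ> \<psi>)"
    proof (cases "\<psi> z \<in> \<phi> ` ball x0 r")
      case True
      obtain T where T: "open T" "\<phi> ` ball x0 r = M \<inter> T"
        using local_param_image_openin[OF \<phi>, of "ball x0 r"] KW W by (auto simp: openin_open)
      have "open (V \<inter> \<psi> -` T)" by (rule continuous_open_preimage[OF q'(4,1) T(1)])
      moreover have "smooth_on (V \<inter> \<psi> -` T) (\<rho> \<circ> \<psi>)"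
        by (rule smooth_on_cong[OF smooth_on_subset[OF sV]])
           (use T q'(7) calculation in \<open>auto simp: \<rho>_def\<close>)
      ultimately show ?thesis using True z T by blast
    next
      case False
      have "compact (\<phi> ` ?K)"
        by (rule compact_continuous_image[OF continuous_on_subset[OF q(4)]]) (use KW W in auto)
      then have "open (V \<inter> \<psi> -` (- \<phi> ` ?K))"
        using compact_imp_closed by (intro continuous_open_preimage[OF q'(4,1)]) auto
      moreover have "smooth_on (V \<inter> \<psi> -` (- \<phi> ` ?K)) (\<rho> \<circ> \<psi>)"
        by (rule smooth_on_cong[OF smooth_on_const[of _ 0]]) (use calculation \<rho>0 in auto)
      moreover have "\<psi> z \<notin> \<phi> ` ?K" using False KW by blast
      ultimately show ?thesis using z by blast
    qed
  qed
  moreover have "\<rho> (\<phi> x0) > 0" using r \<delta> by (auto simp: \<rho>_def s_def exp_cutoff_0_bounds)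
  moreover have "0 \<le> \<rho> p" "\<rho> p \<le> 1" for p by (auto simp: \<rho>_def s_def exp_cutoff_0_bounds)
  moreover have "?K \<subseteq> W" using KW by blast
  ultimately show ?thesis using that[of \<rho> ?K] \<rho>0 by auto
qed

section \<open>Change of variables over an arbitrary finite index type\<close>

text \<open>Determinants and Lebesgue measure depend neither on the names nor on the order of the coordinates.
  Replacing the index type by a copy that is ordered through an enumeration therefore extends the
  change of variables theorem from well-ordered index types to all finite ones.\<close>

typedef 'a ordered_copy = "UNIV :: 'a set" by simp

instance ordered_copy :: (finite) finite
proof
  have "(UNIV :: 'a ordered_copy set) = range Abs_ordered_copy"
    by (metis UNIV_I Abs_ordered_copy_cases surj_def)
  then show "finite (UNIV :: 'a ordered_copy set)" by (metis finite finite_imageI)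
qed

instantiation ordered_copy :: (finite) wellorder
begin

definition less_eq_ordered_copy :: "'a ordered_copy \<Rightarrow> 'a ordered_copy \<Rightarrow> bool" where
  "less_eq_ordered_copy a b \<longleftrightarrow> to_nat (Rep_ordered_copy a) \<le> to_nat (Rep_ordered_copy b)"

definition less_ordered_copy :: "'a ordered_copy \<Rightarrow> 'a ordered_copy \<Rightarrow> bool" where
  "less_ordered_copy a b \<longleftrightarrow> to_nat (Rep_ordered_copy a) < to_nat (Rep_ordered_copy b)"

instance
proof
  fix P :: "'a ordered_copy \<Rightarrow> bool" and a
  assume *: "\<And>x. (\<And>y. y < x \<Longrightarrow> P y) \<Longrightarrow> P x"
  show "P a"
    by (induction a rule: measure_induct_rule[of "\<lambda>a. to_nat (Rep_ordered_copy a)"])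
       (rule *, simp add: less_ordered_copy_def)
qed (auto simp: less_eq_ordered_copy_def less_ordered_copy_def Rep_ordered_copy_inject)

end

definition to_copy :: "real ^ 'n \<Rightarrow> real ^ 'n::finite ordered_copy" where
  "to_copy x = (\<chi> i. x $ Rep_ordered_copy i)"

definition of_copy :: "real ^ 'n::finite ordered_copy \<Rightarrow> real ^ 'n" where
  "of_copy x = (\<chi> i. x $ Abs_ordered_copy i)"

lemma to_of_copy [simp]: "to_copy (of_copy x) = x" "of_copy (to_copy z) = z"
  by (simp_all add: to_copy_def of_copy_def vec_eq_iff Rep_ordered_copy_inverse Abs_ordered_copy_inverse)

lemma bounded_linear_copy: "bounded_linear to_copy" "bounded_linear of_copy"
  unfolding linear_conv_bounded_linear[symmetric]
  by (auto intro!: linearI simp: to_copy_def of_copy_def vec_eq_iff)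

lemma measurable_copy [measurable]: "to_copy \<in> borel_measurable borel" "of_copy \<in> borel_measurable borel"
  by (auto intro!: borel_measurable_continuous_onI linear_continuous_on bounded_linear_copy)

lemma det_reindex:
  fixes A :: "real ^ 'n::finite ^ 'n" and r :: "'b::finite \<Rightarrow> 'n"
  assumes r: "bij r"
  shows "det (\<chi> i j. A $ r i $ r j) = det A"
proof -
  have "det A = (\<Sum>p | p permutes (UNIV :: 'n set). of_int (sign p) * (\<Prod>i\<in>UNIV. A $ i $ p i))"
    by (simp add: det_def)
  also have "\<dots> = (\<Sum>q | q permutes (UNIV :: 'b set). of_int (sign q) * (\<Prod>i\<in>UNIV. A $ r i $ r (q i)))"
  proof (rule sum.reindex_bij_witness[where i = "map_permutation UNIV r" and j = "map_permutation UNIV (inv r)"])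
    have ri: "inj r" "surj r" "inj (inv r)" using r by (auto simp: bij_def bij_imp_bij_inv bij_is_inj surj_imp_inj_inv)
    have m1: "map_permutation UNIV r q = r \<circ> q \<circ> inv r" for q
      using ri by (simp add: map_permutation_def restrict_id_def fun_eq_iff)
    have m2: "map_permutation UNIV (inv r) p = inv r \<circ> p \<circ> r" for p
      using ri r by (simp add: map_permutation_def restrict_id_def fun_eq_iff inv_inv_eq bij_imp_bij_inv bij_is_surj)
    fix p :: "'n \<Rightarrow> 'n" assume "p \<in> {p. p permutes UNIV}"
    then have p: "p permutes UNIV" by simp
    then have bp: "bij p" by (rule permutes_bij)
    show "map_permutation UNIV r (map_permutation UNIV (inv r) p) = p"
      unfolding m1 m2 using ri by (simp add: fun_eq_iff surj_f_inv_f)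
    show "map_permutation UNIV (inv r) p \<in> {q. q permutes UNIV}"
      unfolding m2 using r bp by (auto intro: bij_imp_permutes bij_comp bij_imp_bij_inv)
    have s: "sign (map_permutation UNIV (inv r) p) = sign p"
      using ri p by (intro sign_map_permutation) (auto intro: inj_on_subset)
    have "(\<Prod>i\<in>UNIV. A $ r i $ r (map_permutation UNIV (inv r) p i)) = (\<Prod>i\<in>UNIV. A $ r i $ p (r i))"
      unfolding m2 using ri by (simp add: surj_f_inv_f)
    also have "\<dots> = (\<Prod>i\<in>UNIV. A $ i $ p i)"
      using prod.reindex_bij_betw[OF r, of "\<lambda>i. A $ i $ p i"] by simp
    finally show "of_int (sign (map_permutation UNIV (inv r) p)) *
        (\<Prod>i\<in>UNIV. A $ r i $ r (map_permutation UNIV (inv r) p i)) = of_int (sign p) * (\<Prod>i\<in>UNIV. A $ i $ p i)"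
      by (simp add: s)
  next
    have ri: "inj r" "surj r" using r by (auto simp: bij_def)
    have m1: "map_permutation UNIV r q = r \<circ> q \<circ> inv r" for q
      using ri by (simp add: map_permutation_def restrict_id_def fun_eq_iff)
    have m2: "map_permutation UNIV (inv r) p = inv r \<circ> p \<circ> r" for p
      using ri r by (simp add: map_permutation_def restrict_id_def fun_eq_iff inv_inv_eq bij_imp_bij_inv bij_is_surj)
    fix q :: "'b \<Rightarrow> 'b" assume "q \<in> {q. q permutes UNIV}"
    then have bq: "bij q" by (auto intro: permutes_bij)
    show "map_permutation UNIV (inv r) (map_permutation UNIV r q) = q"
      unfolding m1 m2 using ri by (simp add: fun_eq_iff)
    show "map_permutation UNIV r q \<in> {p. p permutes UNIV}"
      unfolding m1 using r bq by (auto intro: bij_imp_permutes bij_comp bij_imp_bij_inv)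
  qed
  also have "\<dots> = det (\<chi> i j. A $ r i $ r j)" by (simp add: det_def)
  finally show ?thesis ..
qed

lemma bij_Rep_ordered_copy: "bij Rep_ordered_copy"
  by (metis bijI' Rep_ordered_copy_inject Abs_ordered_copy_inverse UNIV_I)

lemma of_copy_axis: "of_copy (axis i 1) = axis (Rep_ordered_copy i) 1"
  by (auto simp: of_copy_def axis_def vec_eq_iff Abs_ordered_copy_inverse Rep_ordered_copy_inverse)

lemma distr_lborel_to_copy: "distr lborel borel (to_copy :: real ^ 'n::finite \<Rightarrow> _) = lborel"
proof (rule lborel_eqI[symmetric])
  fix l u :: "real ^ 'n ordered_copy"
  assume le: "\<And>b. b \<in> Basis \<Longrightarrow> l \<bullet> b \<le> u \<bullet> b"
  have pre: "to_copy -` box l u = box (of_copy l) (of_copy u)"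
    unfolding box_def
    by (auto simp: Basis_vec_def to_copy_def of_copy_def inner_axis)
       (metis Abs_ordered_copy_inverse UNIV_I Rep_ordered_copy_inverse)+
  have le': "of_copy l \<bullet> b \<le> of_copy u \<bullet> b" if "b \<in> Basis" for b
  proof -
    have "l $ i \<le> u $ i" for i using le[of "axis i 1"] by (auto simp: Basis_vec_def inner_axis)
    then show ?thesis using that by (auto simp: Basis_vec_def of_copy_def inner_axis)
  qed
  have prodB: "(\<Prod>b\<in>Basis. w \<bullet> b) = (\<Prod>i\<in>UNIV. w $ i)" for w :: "real ^ 'k::finite"
  proof -
    have B: "(Basis :: (real ^ 'k) set) = range (\<lambda>i. axis i 1)" by (auto simp: Basis_vec_def)
    have "inj (\<lambda>i::'k. axis i (1::real))" by (simp add: inj_on_def axis_eq_axis)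
    then have "(\<Prod>b\<in>range (\<lambda>i::'k. axis i (1::real)). w \<bullet> b) = (\<Prod>i\<in>UNIV. w \<bullet> axis i 1)"
      by (rule prod.reindex_cong) auto
    then show ?thesis unfolding B by (simp add: inner_axis)
  qed
  have "emeasure (distr lborel borel to_copy) (box l u) = emeasure lborel (box (of_copy l) (of_copy u))"
    by (subst emeasure_distr) (simp_all add: pre)
  also have "\<dots> = (\<Prod>b\<in>Basis. (of_copy u - of_copy l) \<bullet> b)"
    using le' by (simp add: emeasure_lborel_box_eq)
  also have "(\<Prod>b\<in>Basis. (of_copy u - of_copy l) \<bullet> b) = (\<Prod>b\<in>Basis. (u - l) \<bullet> b)"
  proof -
    have "bij (Abs_ordered_copy :: 'n \<Rightarrow> _)"
      by (metis bijI' Abs_ordered_copy_inverse UNIV_I Rep_ordered_copy_inverse)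
    from prod.reindex_bij_betw[OF this, of "\<lambda>i. (u - l) $ i"] show ?thesis
      by (simp add: prodB of_copy_def)
  qed
  finally show "emeasure (distr lborel borel to_copy) (box l u) = (\<Prod>b\<in>Basis. (u - l) \<bullet> b)" .
qed simp

text \<open>The theorem on absolutely integrable functions also settles the case of infinite integrals: for
  nonnegative functions, one side is finite iff the other one is.\<close>

lemma nn_integral_change_of_variables_wellorder:
  fixes f :: "real ^ 'm::{finite,wellorder} \<Rightarrow> real"
  assumes A: "A \<in> sets borel"
    and g: "\<And>x. x \<in> A \<Longrightarrow> (g has_derivative g' x) (at x)" "inj_on g A"
    and f: "(\<lambda>y. indicator (g ` A) y * f y) \<in> borel_measurable borel" "\<And>y. y \<in> g ` A \<Longrightarrow> 0 \<le> f y"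
    and m: "(\<lambda>x. indicator A x * (\<bar>det (matrix (g' x))\<bar> * f (g x))) \<in> borel_measurable borel"
  shows "(\<integral>\<^sup>+y. ennreal (indicator (g ` A) y * f y) \<partial>lborel) =
    (\<integral>\<^sup>+x. ennreal (indicator A x * (\<bar>det (matrix (g' x))\<bar> * f (g x))) \<partial>lborel)"
proof -
  let ?F = "\<lambda>y. indicator (g ` A) y * f y"
  let ?G = "\<lambda>x. indicator A x * (\<bar>det (matrix (g' x))\<bar> * f (g x))"
  have cov: "(\<lambda>x. \<bar>det (matrix (g' x))\<bar> *\<^sub>R (vec (f (g x)) :: real ^ 1)) absolutely_integrable_on A \<and>
           integral A (\<lambda>x. \<bar>det (matrix (g' x))\<bar> *\<^sub>R (vec (f (g x)) :: real ^ 1)) = b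
     \<longleftrightarrow> (\<lambda>y. vec (f y) :: real ^ 1) absolutely_integrable_on (g ` A) \<and> integral (g ` A) (\<lambda>y. vec (f y) :: real ^ 1) = b" for b
    by (rule has_absolute_integral_change_of_variables[where f = "\<lambda>y. vec (f y) :: real ^ 1"])
       (use A g(2) in \<open>auto intro: has_derivative_at_withinI[OF g(1)]\<close>)
  have leb: "h absolutely_integrable_on S \<longleftrightarrow> integrable lborel (\<lambda>x. indicator S x * h x)"
    "h absolutely_integrable_on S \<Longrightarrow> integral S h = (LINT x|lborel. indicator S x * h x)"
    if "(\<lambda>x. indicator S x * h x) \<in> borel_measurable borel" for h :: "real ^ 'm::_ \<Rightarrow> real" and S
  proof -
    have m: "(\<lambda>x. indicator S x * h x) \<in> borel_measurable lborel" using that by simp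
    show "h absolutely_integrable_on S \<longleftrightarrow> integrable lborel (\<lambda>x. indicator S x * h x)"
      unfolding set_integrable_def using integrable_completion[OF m] by simp
    show "integral S h = (LINT x|lborel. indicator S x * h x)" if "h absolutely_integrable_on S"
      using set_lebesgue_integral_eq_integral(2)[OF that] integral_completion[OF m]
      by (simp add: set_lebesgue_integral_def)
  qed
  have nonneg: "0 \<le> ?F y" "0 \<le> ?G x" for x y using f(2) by (auto simp: indicator_def)
  have inf: "(\<integral>\<^sup>+x. ennreal (h x) \<partial>lborel) = \<infinity>"
    if "h \<in> borel_measurable borel" "\<And>x. 0 \<le> h x" "\<not> integrable lborel h" for h :: "real ^ 'm::_ \<Rightarrow> real"
  proof (rule ccontr)
    assume "\<not> ?thesis"
    then have "(\<integral>\<^sup>+x. ennreal (h x) \<partial>lborel) < \<infinity>" by (simp add: less_top[symmetric])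
    then have "integrable lborel h" using that(1,2) by (intro integrableI_nonneg) auto
    then show False using that(3) by simp
  qed
  show ?thesis
  proof (cases "integrable lborel ?F")
    case True
    then have "f absolutely_integrable_on (g ` A)" using leb(1)[OF f(1)] by simp
    then have *: "(\<lambda>x. \<bar>det (matrix (g' x))\<bar> * f (g x)) absolutely_integrable_on A"
      "integral A (\<lambda>x. \<bar>det (matrix (g' x))\<bar> * f (g x)) = integral (g ` A) f"
      using cov[of "vec (integral (g ` A) f)"]
      by (auto simp: absolutely_integrable_on_1_iff integral_on_1_eq vec_eq_iff)
    then have iG: "integrable lborel ?G" using leb(1)[OF m] by simp
    have "(LINT y|lborel. ?F y) = (LINT x|lborel. ?G x)"
      using leb(2)[OF f(1)] leb(2)[OF m] * \<open>f absolutely_integrable_on (g ` A)\<close> by simp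
    then show ?thesis
      using nn_integral_eq_integral[OF True] nn_integral_eq_integral[OF iG] nonneg by simp
  next
    case False
    then have nf: "\<not> f absolutely_integrable_on (g ` A)" using leb(1)[OF f(1)] by simp
    have "\<not> integrable lborel ?G"
    proof
      assume "integrable lborel ?G"
      then have "(\<lambda>x. \<bar>det (matrix (g' x))\<bar> * f (g x)) absolutely_integrable_on A" using leb(1)[OF m] by simp
      then show False
        using cov[of "integral A (\<lambda>x. \<bar>det (matrix (g' x))\<bar> *\<^sub>R (vec (f (g x)) :: real ^ 1))"] nf
        by (auto simp: absolutely_integrable_on_1_iff)
    qed
    then have "(\<integral>\<^sup>+x. ennreal (?G x) \<partial>lborel) = \<infinity>" by (rule inf[OF m nonneg(2)])
    moreover have "(\<integral>\<^sup>+x. ennreal (?F x) \<partial>lborel) = \<infinity>" by (rule inf[OF f(1) nonneg(1) False])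
    ultimately show ?thesis by simp
  qed
qed

lemma nn_integral_change_of_variables:
  fixes f :: "real ^ 'n::finite \<Rightarrow> real"
  assumes A: "A \<in> sets borel"
    and g: "\<And>x. x \<in> A \<Longrightarrow> (g has_derivative g' x) (at x)" "inj_on g A"
    and f: "(\<lambda>y. indicator (g ` A) y * f y) \<in> borel_measurable borel" "\<And>y. y \<in> g ` A \<Longrightarrow> 0 \<le> f y"
    and m: "(\<lambda>x. indicator A x * (\<bar>det (matrix (g' x))\<bar> * f (g x))) \<in> borel_measurable borel"
  shows "(\<integral>\<^sup>+y. ennreal (indicator (g ` A) y * f y) \<partial>lborel) =
    (\<integral>\<^sup>+x. ennreal (indicator A x * (\<bar>det (matrix (g' x))\<bar> * f (g x))) \<partial>lborel)"
proof -
  define A2 where "A2 = of_copy -` A"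
  define g2 where "g2 = to_copy \<circ> g \<circ> of_copy"
  define g2' where "g2' x = to_copy \<circ> g' (of_copy x) \<circ> of_copy" for x
  define f2 where "f2 y = f (of_copy y)" for y
  have A2: "A2 = to_copy ` A" by (auto simp: A2_def image_iff) (metis to_of_copy(1))
  have im: "g2 ` A2 = to_copy ` (g ` A)" unfolding A2 by (auto simp: g2_def image_iff)
  have tocopy_in: "to_copy z \<in> to_copy ` S \<longleftrightarrow> z \<in> S" for z :: "real ^ 'n" and S
    by (metis imageE imageI to_of_copy(2))
  have ofcopy_in: "w \<in> to_copy ` S \<longleftrightarrow> of_copy w \<in> S" for w and S :: "(real ^ 'n) set"
    by (metis tocopy_in to_of_copy(1))
  have dt: "det (matrix (g2' x)) = det (matrix (g' (of_copy x)))" for x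
  proof -
    have "matrix (g2' x) = (\<chi> i j. matrix (g' (of_copy x)) $ Rep_ordered_copy i $ Rep_ordered_copy j)"
      by (simp add: matrix_def g2'_def of_copy_axis vec_eq_iff) (simp add: to_copy_def)
    then show ?thesis using det_reindex[OF bij_Rep_ordered_copy, of "matrix (g' (of_copy x))"] by simp
  qed
  have F2: "(\<lambda>y. indicator (g2 ` A2) y * f2 y) = (\<lambda>y. indicator (g ` A) y * f y) \<circ> of_copy"
    by (auto simp: im f2_def fun_eq_iff indicator_def ofcopy_in)
  have G2: "(\<lambda>x. indicator A2 x * (\<bar>det (matrix (g2' x))\<bar> * f2 (g2 x))) =
      (\<lambda>x. indicator A x * (\<bar>det (matrix (g' x))\<bar> * f (g x))) \<circ> of_copy"
    by (auto simp: A2_def f2_def g2_def fun_eq_iff indicator_def dt)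
  have tr: "(\<integral>\<^sup>+x. ennreal ((F \<circ> of_copy) x) \<partial>lborel) = (\<integral>\<^sup>+x. ennreal (F x) \<partial>lborel)"
    if "F \<in> borel_measurable borel" for F :: "real ^ 'n \<Rightarrow> real"
    by (subst distr_lborel_to_copy[symmetric], subst nn_integral_distr)
       (use that in \<open>auto intro!: measurable_compose[OF measurable_copy(2)]\<close>)
  have "(\<integral>\<^sup>+y. ennreal (indicator (g2 ` A2) y * f2 y) \<partial>lborel) =
      (\<integral>\<^sup>+x. ennreal (indicator A2 x * (\<bar>det (matrix (g2' x))\<bar> * f2 (g2 x))) \<partial>lborel)"
  proof (rule nn_integral_change_of_variables_wellorder)
    show "A2 \<in> sets borel" unfolding A2_def using A measurable_copy(2) by (rule measurable_sets_borel[rotated])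
    show "(g2 has_derivative g2' x) (at x)" if "x \<in> A2" for x
    proof -
      have "((\<lambda>x. g (of_copy x)) has_derivative (\<lambda>v. g' (of_copy x) (of_copy v))) (at x)"
        by (rule has_derivative_compose[OF bounded_linear_imp_has_derivative[OF bounded_linear_copy(2)] g(1)])
           (use that in \<open>simp add: A2_def\<close>)
      from bounded_linear.has_derivative[OF bounded_linear_copy(1) this] show ?thesis
        by (simp add: g2_def g2'_def o_def)
    qed
    show "inj_on g2 A2"
      using g(2) unfolding A2_def g2_def by (auto simp: inj_on_def) (metis to_of_copy)
    show "0 \<le> f2 y" if "y \<in> g2 ` A2" for y using that f(2) unfolding im ofcopy_in f2_def by blast
    show "(\<lambda>y. indicator (g2 ` A2) y * f2 y) \<in> borel_measurable borel"
      unfolding F2 by (rule measurable_comp[OF measurable_copy(2) f(1)])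
    show "(\<lambda>x. indicator A2 x * (\<bar>det (matrix (g2' x))\<bar> * f2 (g2 x))) \<in> borel_measurable borel"
      unfolding G2 by (rule measurable_comp[OF measurable_copy(2) m])
  qed
  then show ?thesis
    unfolding fun_cong[OF F2] fun_cong[OF G2] tr[OF f(1)] tr[OF m] .
qed

section \<open>The Riemannian measure\<close>

lemma vol_eq_gram:
  assumes "local_param M \<mu> U \<phi>"
  shows "immersed_chart.vol (\<mu> \<circ> \<phi>) x = sqrt (det (gram \<mu> \<phi> x))"
proof -
  interpret immersed_chart U "\<mu> \<circ> \<phi>" by (rule immersed_chart_local_param[OF assms])
  show ?thesis by (simp add: vol_def gram_matrix_def gram_def pd_def)
qed

text \<open>The Gram matrix changes by a congruence with the Jacobian matrix of the transition map.\<close>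

lemma vol_transition:
  assumes \<phi>: "local_param M \<mu> U \<phi>" and \<psi>: "local_param M \<mu> V \<psi>" and x: "x \<in> U" "\<phi> x \<in> \<psi> ` V"
  shows "sqrt (det (gram \<mu> \<phi> x)) = \<bar>det (matrix (frechet_derivative (transition V \<psi> \<phi>) (at x)))\<bar> *
    sqrt (det (gram \<mu> \<psi> (transition V \<psi> \<phi> x)))"
proof -
  note t = transition_properties[OF \<phi> \<psi>]
  let ?h = "transition V \<psi> \<phi>"
  let ?H = "matrix (frechet_derivative ?h (at x))"
  have xW: "x \<in> {x \<in> U. \<phi> x \<in> \<psi> ` V}" using x by simp
  have hx: "?h x \<in> V" using t(4) xW by blast
  have col: "frechet_derivative (\<mu> \<circ> \<phi>) (at x) (axis i 1) =
      (\<Sum>a\<in>UNIV. ?H $ a $ i *\<^sub>R frechet_derivative (\<mu> \<circ> \<psi>) (at (?h x)) (axis a 1))" for i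
    unfolding frechet_derivative_transition[OF \<phi> \<psi> x local_paramD(6)[OF \<psi>]]
    by (subst frechet_derivative_pd[OF smooth_on_has_derivative[OF local_paramD(6)[OF \<psi>] hx]])
       (simp add: matrix_def pd_def)
  have "gram \<mu> \<phi> x = transpose ?H ** gram \<mu> \<psi> (?h x) ** ?H"
    unfolding vec_eq_iff
  proof (intro allI)
    fix i j
    have "gram \<mu> \<phi> x $ i $ j = (\<Sum>b\<in>UNIV. \<Sum>a\<in>UNIV. ?H $ a $ i * ?H $ b $ j * gram \<mu> \<psi> (?h x) $ a $ b)"
      unfolding gram_def vec_lambda_beta col inner_sum_right unfolding inner_sum_left
      by (simp add: mult_ac)
    also have "\<dots> = (transpose ?H ** gram \<mu> \<psi> (?h x) ** ?H) $ i $ j"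
      by (simp add: matrix_matrix_mult_def transpose_def sum_distrib_left sum_distrib_right mult_ac)
    finally show "gram \<mu> \<phi> x $ i $ j = (transpose ?H ** gram \<mu> \<psi> (?h x) ** ?H) $ i $ j" .
  qed
  then have "det (gram \<mu> \<phi> x) = (det ?H)\<^sup>2 * det (gram \<mu> \<psi> (?h x))"
    by (simp add: det_mul det_transpose power2_eq_square mult_ac)
  then show ?thesis by (simp add: real_sqrt_mult)
qed

lemma local_param_measurable:
  assumes \<phi>: "local_param M \<mu> U \<phi>" and K: "K \<in> sets borel" "K \<subseteq> U"
  shows "\<phi> \<in> measurable (restrict_space lborel K) (restrict_space borel M)"
proof (rule measurable_restrict_space2)
  show "\<phi> \<in> space (restrict_space lborel K) \<rightarrow> M"
    using local_paramD(7)[OF \<phi>] K(2) by (auto simp: space_restrict_space)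
  have "\<phi> \<in> borel_measurable (restrict_space borel K)"
    by (rule borel_measurable_continuous_on_restrict[OF continuous_on_subset[OF local_paramD(4)[OF \<phi>] K(2)]])
  then show "\<phi> \<in> borel_measurable (restrict_space lborel K)"
    by (simp cong: measurable_cong_sets add: sets_restrict_space)
qed

lemma local_param_image_sets:
  assumes \<phi>: "local_param M \<mu> U \<phi>" and A: "A \<in> sets borel" "A \<subseteq> U"
  shows "\<phi> ` A \<in> sets (restrict_space borel M)"
proof -
  note q = local_paramD[OF \<phi>]
  have "inv_into U \<phi> \<in> borel_measurable (restrict_space borel (\<phi> ` U))"
    by (rule borel_measurable_continuous_on_restrict[OF q(5)])
  then have "inv_into U \<phi> -` A \<inter> space (restrict_space borel (\<phi> ` U)) \<in> sets (restrict_space borel (\<phi> ` U))"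
    using A(1) by (rule measurable_sets)
  moreover have "inv_into U \<phi> -` A \<inter> space (restrict_space borel (\<phi> ` U)) = \<phi> ` A"
    using A(2) q(3) by (auto simp: space_restrict_space inv_into_f_f image_iff subset_iff)
  ultimately obtain B where B: "B \<in> sets borel" "\<phi> ` A = \<phi> ` U \<inter> B"
    by (auto simp: sets_restrict_space)
  obtain T where T: "open T" "\<phi> ` U = M \<inter> T" using q(2) by (auto simp: openin_open)
  have "\<phi> ` A = M \<inter> (T \<inter> B)" using B T by auto
  moreover have "T \<inter> B \<in> sets borel" using B T by auto
  ultimately show ?thesis by (auto simp: sets_restrict_space)
qed

lemma continuous_on_vol:
  assumes "local_param M \<mu> U \<phi>"
  shows "continuous_on U (\<lambda>x. sqrt (det (gram \<mu> \<phi> x)))"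
proof -
  interpret immersed_chart U "\<mu> \<circ> \<phi>" by (rule immersed_chart_local_param[OF assms])
  show ?thesis using smooth_on_imp_continuous_on[OF smooth_vol] by (simp add: vol_eq_gram[OF assms])
qed

lemma vol_nonneg: "local_param M \<mu> U \<phi> \<Longrightarrow> x \<in> U \<Longrightarrow> 0 \<le> sqrt (det (gram \<mu> \<phi> x))"
  using immersed_chart.vol_pos[OF immersed_chart_local_param] vol_eq_gram by (metis less_imp_le)

lemma borel_measurable_indicator_continuous:
  fixes f :: "'a::topological_space \<Rightarrow> real"
  assumes "continuous_on U f" "A \<in> sets borel" "A \<subseteq> U"
  shows "(\<lambda>x. indicator A x * f x) \<in> borel_measurable borel"
  using borel_measurable_restrict_space_iff[of A borel f]
    borel_measurable_continuous_on_restrict[OF continuous_on_subset[OF assms(1,3)]] assms(2)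
  by simp

text \<open>The densities of two charts agree on their overlap, by the change of variables formula.\<close>

lemma nn_integral_vol_transition:
  assumes \<phi>: "local_param M \<mu> U \<phi>" and \<psi>: "local_param M \<mu> V \<psi>"
    and A: "A \<in> sets borel" "A \<subseteq> U" "\<phi> ` A \<subseteq> \<psi> ` V" and A': "A' = {z \<in> V. \<psi> z \<in> \<phi> ` A}" "A' \<in> sets borel"
  shows "(\<integral>\<^sup>+z. ennreal (indicator A' z * sqrt (det (gram \<mu> \<psi> z))) \<partial>lborel) =
    (\<integral>\<^sup>+x. ennreal (indicator A x * sqrt (det (gram \<mu> \<phi> x))) \<partial>lborel)"
proof -
  note t = transition_properties[OF \<phi> \<psi>]
  let ?h = "transition V \<psi> \<phi>" and ?W = "{x \<in> U. \<phi> x \<in> \<psi> ` V}"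
  let ?det = "\<lambda>x. \<bar>det (matrix (frechet_derivative ?h (at x)))\<bar>"
  have AW: "A \<subseteq> ?W" using A by blast
  have im: "?h ` A = A'"
  proof
    show "?h ` A \<subseteq> A'" using AW t(4,5) A'(1) by (auto simp: subset_iff image_iff)
    show "A' \<subseteq> ?h ` A"
    proof
      fix z assume "z \<in> A'"
      then obtain x where x: "x \<in> A" "z \<in> V" "\<psi> z = \<phi> x" using A'(1) by auto
      then have "?h x = z" using local_paramD(3)[OF \<psi>] by (metis inv_into_f_f transition_def)
      then show "z \<in> ?h ` A" using x by blast
    qed
  qed
  have tr: "indicator A x * (?det x * sqrt (det (gram \<mu> \<psi> (?h x)))) = indicator A x * sqrt (det (gram \<mu> \<phi> x))" for x
    using vol_transition[OF \<phi> \<psi>, of x] AW by (cases "x \<in> A") auto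
  have "(\<integral>\<^sup>+z. ennreal (indicator (?h ` A) z * sqrt (det (gram \<mu> \<psi> z))) \<partial>lborel) =
    (\<integral>\<^sup>+x. ennreal (indicator A x * (?det x * sqrt (det (gram \<mu> \<psi> (?h x))))) \<partial>lborel)"
  proof (rule nn_integral_change_of_variables[OF A(1)])
    show "(?h has_derivative frechet_derivative ?h (at x)) (at x)" if "x \<in> A" for x using t(6) AW that by blast
    show "inj_on ?h A" using t(3) AW inj_on_subset by blast
    show "(\<lambda>y. indicator (?h ` A) y * sqrt (det (gram \<mu> \<psi> y))) \<in> borel_measurable borel"
      unfolding im by (rule borel_measurable_indicator_continuous[OF continuous_on_vol[OF \<psi>] A'(2)]) (simp add: A')
    show "0 \<le> sqrt (det (gram \<mu> \<psi> y))" if "y \<in> ?h ` A" for y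
      using that vol_nonneg[OF \<psi>] A'(1) unfolding im by blast
    show "(\<lambda>x. indicator A x * (?det x * sqrt (det (gram \<mu> \<psi> (?h x))))) \<in> borel_measurable borel"
      unfolding tr by (rule borel_measurable_indicator_continuous[OF continuous_on_vol[OF \<phi>] A(1,2)])
  qed
  then show ?thesis unfolding im tr .
qed

text \<open>The volume density over a part \<open>K\<close> of the parameter domain, pushed forward to \<open>M\<close>.\<close>

definition chart_measure ::
    "'m::{t2_space,second_countable_topology} set \<Rightarrow> ('m \<Rightarrow> real ^ ('n::finite + 2)) \<Rightarrow>
     (real ^ 'n) set \<Rightarrow> (real ^ 'n \<Rightarrow> 'm) \<Rightarrow> 'm measure" where
  "chart_measure M \<mu> K \<phi> =
     distr (density (restrict_space lborel K) (\<lambda>x. ennreal (sqrt (det (gram \<mu> \<phi> x))))) (restrict_space borel M) \<phi>"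

lemma vol_measurable_restrict:
  assumes \<phi>: "local_param M \<mu> U \<phi>" and K: "K \<in> sets borel" "K \<subseteq> U"
  shows "(\<lambda>x. sqrt (det (gram \<mu> \<phi> x))) \<in> borel_measurable (restrict_space lborel K)"
proof -
  have "(\<lambda>x. sqrt (det (gram \<mu> \<phi> x))) \<in> borel_measurable (restrict_space borel K)"
    by (rule borel_measurable_continuous_on_restrict[OF continuous_on_subset[OF continuous_on_vol[OF \<phi>] K(2)]])
  then show ?thesis by (simp cong: measurable_cong_sets add: sets_restrict_space)
qed

lemma emeasure_chart_measure:
  assumes \<phi>: "local_param M \<mu> U \<phi>" and K: "K \<in> sets borel" "K \<subseteq> U" and B: "B \<in> sets (restrict_space borel M)"
  shows "{x \<in> K. \<phi> x \<in> B} \<in> sets borel"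
    and "emeasure (chart_measure M \<mu> K \<phi>) B =
      (\<integral>\<^sup>+x. ennreal (indicator {x \<in> K. \<phi> x \<in> B} x * sqrt (det (gram \<mu> \<phi> x))) \<partial>lborel)"
proof -
  have sp: "space (restrict_space lborel K) = K" by (simp add: space_restrict_space)
  have set: "\<phi> -` B \<inter> K \<in> sets (restrict_space lborel K)"
    using measurable_sets[OF local_param_measurable[OF \<phi> K] B] sp by simp
  have eqs: "\<phi> -` B \<inter> K = {x \<in> K. \<phi> x \<in> B}" by auto
  show "{x \<in> K. \<phi> x \<in> B} \<in> sets borel"
    using set K(1) unfolding eqs by (auto simp: sets_restrict_space)
  have "emeasure (chart_measure M \<mu> K \<phi>) B =
      emeasure (density (restrict_space lborel K) (\<lambda>x. ennreal (sqrt (det (gram \<mu> \<phi> x))))) {x \<in> K. \<phi> x \<in> B}"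
    unfolding chart_measure_def
    by (subst emeasure_distr[OF _ B]) (auto simp: local_param_measurable[OF \<phi> K] sp eqs)
  also have "\<dots> = (\<integral>\<^sup>+x. ennreal (sqrt (det (gram \<mu> \<phi> x))) * indicator {x \<in> K. \<phi> x \<in> B} x \<partial>restrict_space lborel K)"
    using vol_measurable_restrict[OF \<phi> K] set unfolding eqs by (intro emeasure_density) auto
  also have "\<dots> = (\<integral>\<^sup>+x. ennreal (sqrt (det (gram \<mu> \<phi> x))) * indicator {x \<in> K. \<phi> x \<in> B} x * indicator K x \<partial>lborel)"
    using K(1) by (intro nn_integral_restrict_space) simp
  also have "\<dots> = (\<integral>\<^sup>+x. ennreal (indicator {x \<in> K. \<phi> x \<in> B} x * sqrt (det (gram \<mu> \<phi> x))) \<partial>lborel)"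
    by (intro nn_integral_cong) (auto simp: indicator_def)
  finally show "emeasure (chart_measure M \<mu> K \<phi>) B =
      (\<integral>\<^sup>+x. ennreal (indicator {x \<in> K. \<phi> x \<in> B} x * sqrt (det (gram \<mu> \<phi> x))) \<partial>lborel)" .
qed

lemma countable_charts:
  assumes "sphere_hypersurface M \<mu>"
  obtains U :: "nat \<Rightarrow> (real ^ 'n::finite) set" and \<phi> :: "nat \<Rightarrow> real ^ 'n \<Rightarrow> 'm::{t2_space,second_countable_topology}"
  where "\<And>k. local_param M (\<mu> :: 'm \<Rightarrow> real ^ ('n + 2)) (U k) (\<phi> k)" "(\<Union>k. \<phi> k ` U k) = M"
proof -
  let ?C = "{(U, \<phi>). local_param M \<mu> U \<phi>}"
  let ?im = "\<lambda>c :: (real ^ 'n) set \<times> (real ^ 'n \<Rightarrow> 'm). snd c ` fst c"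
  have op: "\<And>S. S \<in> ?im ` ?C \<Longrightarrow> openin (top_of_set M) S"
    by (auto dest: local_paramD(2))
  obtain F where F: "F \<subseteq> ?im ` ?C" "countable F" "\<Union>F = \<Union>(?im ` ?C)"
    using Lindelof_openin[OF op] by blast
  have cov: "\<Union>(?im ` ?C) = M"
  proof
    show "\<Union>(?im ` ?C) \<subseteq> M" using local_paramD(7)[of M \<mu>] by fastforce
    show "M \<subseteq> \<Union>(?im ` ?C)"
    proof
      fix p assume "p \<in> M"
      then obtain U \<phi> where "local_param M \<mu> U \<phi>" "p \<in> \<phi> ` U" using assms by (auto simp: sphere_hypersurface_def)
      then show "p \<in> \<Union>(?im ` ?C)" by (intro UnionI[of "\<phi> ` U"] image_eqI[of _ _ "(U, \<phi>)"]) auto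
    qed
  qed
  \<comment> \<open>the empty chart makes the family nonempty also when \<open>M\<close> is empty\<close>
  have "local_param M \<mu> {} \<phi>0" for \<phi>0
    by (simp add: local_param_def smooth_on_def homeomorphism_def) (metis Ck_on_cong Ck_on_const empty_iff open_empty)
  then have ne: "?C \<noteq> {}" by blast
  then obtain c0 where c0: "c0 \<in> ?C" by blast
  have "\<exists>c. c \<in> ?C \<and> ?im c = S" if "S \<in> F" for S using that F(1) by blast
  then obtain g where some: "\<And>S. S \<in> F \<Longrightarrow> g S \<in> ?C \<and> ?im (g S) = S" by metis
  define G where "G = insert c0 (g ` F)"
  have "G \<subseteq> ?C" unfolding G_def by (intro insert_subsetI image_subsetI c0 some[THEN conjunct1])
  moreover have "countable G" "G \<noteq> {}" using F(2) by (simp_all add: G_def)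
  ultimately have G: "G \<subseteq> ?C" "countable G" "G \<noteq> {}" by blast+
  have GM: "(\<Union>c\<in>G. ?im c) = M"
  proof
    show "(\<Union>c\<in>G. ?im c) \<subseteq> M" using G(1) cov by blast
    show "M \<subseteq> (\<Union>c\<in>G. ?im c)"
    proof
      fix p assume "p \<in> M"
      then have "p \<in> \<Union>F" using F(3) cov by simp
      then obtain S where S: "S \<in> F" "p \<in> S" by (rule UnionE)
      have "p \<in> ?im (g S)" using conjunct2[OF some[OF S(1)]] S(2) by simp
      moreover have "g S \<in> G" using S(1) by (simp add: G_def)
      ultimately show "p \<in> (\<Union>c\<in>G. ?im c)" by (rule UN_I[rotated])
    qed
  qed
  define c where "c = from_nat_into G"
  have cG: "range c = G" unfolding c_def using G(2,3) by (rule range_from_nat_into[rotated])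
  show ?thesis
  proof (rule that[of "\<lambda>k. fst (c k)" "\<lambda>k. snd (c k)"])
    show "local_param M \<mu> (fst (c k)) (snd (c k))" for k
      using G(1) cG by (auto simp: subset_iff)
    show "(\<Union>k. snd (c k) ` fst (c k)) = M" using GM cG by blast
  qed
qed

text \<open>The measure is assembled from the densities of countably many charts, each restricted to the
  part of \<open>M\<close> that the earlier ones leave uncovered.\<close>

lemma riemannian_measure_exists:
  fixes M :: "'m::{t2_space,second_countable_topology} set" and \<mu> :: "'m \<Rightarrow> real ^ ('n::finite + 2)"
  assumes M: "sphere_hypersurface M \<mu>"
  shows "\<exists>V. space V = M \<and> sets V = sets (restrict_space borel M) \<and>
        (\<forall>U \<phi> A. local_param M \<mu> U \<phi> \<and> A \<in> sets borel \<and> A \<subseteq> U \<longrightarrow>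
           emeasure V (\<phi> ` A) = (\<integral>\<^sup>+x\<in>A. ennreal (sqrt (det (gram \<mu> \<phi> x))) \<partial>lborel))"
proof -
  obtain U :: "nat \<Rightarrow> (real ^ 'n) set" and \<phi> where
    \<phi>: "\<And>k. local_param M \<mu> (U k) (\<phi> k)" and cov: "(\<Union>k. \<phi> k ` U k) = M"
    using countable_charts[OF M] by metis
  let ?B = "restrict_space borel M"
  have spB: "space ?B = M" by (simp add: space_restrict_space)
  have Uk: "U k \<in> sets borel" for k using local_paramD(1)[OF \<phi>[of k]] by simp
  define P where "P = disjointed (\<lambda>k. \<phi> k ` U k)"
  have Pset: "P k \<in> sets ?B" for k
  proof -
    have "range P \<subseteq> sets ?B"
      unfolding P_def by (rule sets.range_disjointed_sets) (auto intro: local_param_image_sets[OF \<phi> Uk])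
    then show ?thesis by blast
  qed
  have Psub: "P k \<subseteq> \<phi> k ` U k" for k unfolding P_def by (rule disjointed_subset)
  have Pdisj: "disjoint_family P" unfolding P_def by (rule disjoint_family_disjointed)
  have Pun: "(\<Union>k. P k) = M" unfolding P_def UN_disjointed_eq cov ..
  let ?N = "\<lambda>k. chart_measure M \<mu> (U k) (\<phi> k)"
  define W where "W E = (\<Sum>k. emeasure (?N k) (E \<inter> P k))" for E
  have W': "W E = (\<integral>\<^sup>+k. emeasure (?N k) (E \<inter> P k) \<partial>count_space UNIV)" for E
    unfolding W_def by (simp add: nn_integral_count_space_nat)
  define V where "V = measure_of M (sets ?B) W"
  have sig: "sigma_algebra M (sets ?B)" using sets.sigma_algebra_axioms[of ?B] unfolding spB .
  have setsN: "sets (?N k) = sets ?B" for k by (simp add: chart_measure_def)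
  have V: "space V = M" "sets V = sets ?B"
    unfolding V_def using sigma_algebra.space_measure_of_eq[OF sig] sigma_algebra.sets_measure_of_eq[OF sig] by auto
  have emV: "emeasure V E = W E" if "E \<in> sets ?B" for E
    unfolding V_def
  proof (rule emeasure_measure_of_sigma[OF sig _ _ that])
    show "positive (sets ?B) W" by (simp add: positive_def W_def)
    show "countably_additive (sets ?B) W"
      unfolding countably_additive_def
    proof (intro allI impI)
      fix F :: "nat \<Rightarrow> 'm set" assume F: "range F \<subseteq> sets ?B" "disjoint_family F" "\<Union>(range F) \<in> sets ?B"
      have "(\<Sum>i. W (F i)) = (\<integral>\<^sup>+k. (\<Sum>i. emeasure (?N k) (F i \<inter> P k)) \<partial>count_space UNIV)"
        unfolding W' by (rule nn_integral_suminf[symmetric]) simp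
      also have "\<dots> = W (\<Union>(range F))"
        unfolding W'
      proof (rule nn_integral_cong)
        fix k
        have "(\<Sum>i. emeasure (?N k) (F i \<inter> P k)) = emeasure (?N k) (\<Union>i. F i \<inter> P k)"
          by (rule suminf_emeasure) (use F(1,2) Pset in \<open>auto simp: setsN disjoint_family_on_def\<close>)
        moreover have "(\<Union>i. F i \<inter> P k) = \<Union>(range F) \<inter> P k" by blast
        ultimately show "(\<Sum>i. emeasure (?N k) (F i \<inter> P k)) = emeasure (?N k) (\<Union>(range F) \<inter> P k)"
          by (simp only:)
      qed
      finally show "(\<Sum>i. W (F i)) = W (\<Union>(range F))" .
    qed
  qed
  show ?thesis
  proof (intro exI[of _ V] conjI allI impI V)
    fix U' \<phi>' A assume a: "local_param M \<mu> U' \<phi>' \<and> A \<in> sets borel \<and> A \<subseteq> U'"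
    then have \<phi>': "local_param M \<mu> U' \<phi>'" and A: "A \<in> sets borel" "A \<subseteq> U'" by auto
    have imA: "\<phi>' ` A \<in> sets ?B" by (rule local_param_image_sets[OF \<phi>' A])
    let ?A = "\<lambda>k. {x \<in> A. \<phi>' x \<in> P k}"
    let ?d = "\<lambda>x. ennreal (sqrt (det (gram \<mu> \<phi>' x)))"
    have piece: "emeasure (?N k) (\<phi>' ` A \<inter> P k) = (\<integral>\<^sup>+x. ?d x * indicator (?A k) x \<partial>lborel)" for k
    proof -
      have IB: "\<phi>' ` A \<inter> P k \<in> sets ?B" using imA Pset by auto
      note e = emeasure_chart_measure[OF \<phi> Uk subset_refl IB]
      have Ak: "?A k \<in> sets borel" by (rule emeasure_chart_measure(1)[OF \<phi>' A Pset])
      have "emeasure (?N k) (\<phi>' ` A \<inter> P k) =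
          (\<integral>\<^sup>+x. ennreal (indicator (?A k) x * sqrt (det (gram \<mu> \<phi>' x))) \<partial>lborel)"
        unfolding e(2)
        by (rule nn_integral_vol_transition[OF \<phi>' \<phi> Ak _ _ _ e(1)]) (use A Psub in auto)
      also have "\<dots> = (\<integral>\<^sup>+x. ?d x * indicator (?A k) x \<partial>lborel)"
        by (intro nn_integral_cong) (auto simp: indicator_def)
      finally show ?thesis .
    qed
    have Ak: "?A k \<in> sets borel" for k by (rule emeasure_chart_measure(1)[OF \<phi>' A Pset])
    have dm: "(\<lambda>x. ?d x * indicator (?A k) x) \<in> borel_measurable lborel" for k
    proof -
      have "(\<lambda>x. indicator (?A k) x * sqrt (det (gram \<mu> \<phi>' x))) \<in> borel_measurable borel"
        by (rule borel_measurable_indicator_continuous[OF continuous_on_vol[OF \<phi>'] Ak]) (use A in auto)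
      then have "(\<lambda>x. ennreal (indicator (?A k) x * sqrt (det (gram \<mu> \<phi>' x)))) \<in> borel_measurable lborel" by simp
      moreover have "(\<lambda>x. ennreal (indicator (?A k) x * sqrt (det (gram \<mu> \<phi>' x)))) = (\<lambda>x. ?d x * indicator (?A k) x)"
        by (auto simp: indicator_def fun_eq_iff)
      ultimately show ?thesis by simp
    qed
    have "emeasure V (\<phi>' ` A) = (\<Sum>k. \<integral>\<^sup>+x. ?d x * indicator (?A k) x \<partial>lborel)"
      unfolding emV[OF imA] W_def piece ..
    also have "\<dots> = (\<integral>\<^sup>+x. (\<Sum>k. ?d x * indicator (?A k) x) \<partial>lborel)"
      by (rule nn_integral_suminf[symmetric]) (rule dm)
    also have "\<dots> = (\<integral>\<^sup>+x\<in>A. ?d x \<partial>lborel)"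
    proof (rule nn_integral_cong)
      fix x
      have "(\<Sum>k. indicator (?A k) x :: ennreal) = indicator (\<Union>k. ?A k) x"
        by (rule suminf_indicator) (use Pdisj in \<open>auto simp: disjoint_family_on_def\<close>)
      moreover have "(\<Union>k. ?A k) = A"
        using Pun local_paramD(7)[OF \<phi>'] A by auto
      ultimately show "(\<Sum>k. ?d x * indicator (?A k) x) = ?d x * indicator A x"
        by (simp add: ennreal_suminf_cmult)
    qed
    finally show "emeasure V (\<phi>' ` A) = (\<integral>\<^sup>+x\<in>A. ennreal (sqrt (det (gram \<mu> \<phi>' x))) \<partial>lborel)" .
  qed
qed

lemma riemannian_measure_properties:
  assumes "sphere_hypersurface M \<mu>"
  shows "space (riemannian_measure M \<mu>) = M"
    and "sets (riemannian_measure M \<mu>) = sets (restrict_space borel M)"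
    and "local_param M \<mu> U \<phi> \<Longrightarrow> A \<in> sets borel \<Longrightarrow> A \<subseteq> U \<Longrightarrow>
      emeasure (riemannian_measure M \<mu>) (\<phi> ` A) = (\<integral>\<^sup>+x\<in>A. ennreal (sqrt (det (gram \<mu> \<phi> x))) \<partial>lborel)"
  using someI_ex[OF riemannian_measure_exists[OF assms], folded riemannian_measure_def] by blast+

text \<open>The Riemannian measure and the volume density of the chart assign the same measure to every Borel
  subset of the image of \<open>K\<close>.\<close>

lemma chart_integral:
  fixes r :: "'m::{t2_space,second_countable_topology} \<Rightarrow> real" and \<mu> :: "'m \<Rightarrow> real ^ ('n::finite + 2)"
  assumes M: "sphere_hypersurface M \<mu>" and \<phi>: "local_param M \<mu> U \<phi>"
    and K: "K \<in> sets borel" "K \<subseteq> U" and r: "continuous_on M r"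
  shows "(LINT p:\<phi> ` K|riemannian_measure M \<mu>. r p) = (LINT x:K|lborel. sqrt (det (gram \<mu> \<phi> x)) * r (\<phi> x))"
proof -
  note R = riemannian_measure_properties[OF M]
  let ?V = "riemannian_measure M \<mu>" and ?B = "restrict_space borel M"
  have imK: "\<phi> ` K \<in> sets ?V" unfolding R(2) by (rule local_param_image_sets[OF \<phi> K])
  have rm: "r \<in> borel_measurable ?B" by (rule borel_measurable_continuous_on_restrict[OF r])
  have rV: "r \<in> borel_measurable ?V" using rm by (simp cong: measurable_cong_sets add: R(2))
  have eq: "density ?V (indicator (\<phi> ` K)) = chart_measure M \<mu> K \<phi>"
  proof (rule measure_eqI)
    show "sets (density ?V (indicator (\<phi> ` K))) = sets (chart_measure M \<mu> K \<phi>)"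
      by (simp add: chart_measure_def R(2))
    fix B assume "B \<in> sets (density ?V (indicator (\<phi> ` K)))"
    then have B: "B \<in> sets ?B" by (simp add: R(2))
    note e = emeasure_chart_measure[OF \<phi> K B]
    have "emeasure (density ?V (indicator (\<phi> ` K))) B = emeasure ?V (\<phi> ` K \<inter> B)"
    proof -
      have BV: "B \<in> sets ?V" using B R(2) by simp
      show ?thesis
        unfolding emeasure_density[OF borel_measurable_indicator[OF imK] BV] indicator_inter_arith[symmetric]
        using imK BV by (intro nn_integral_indicator) auto
    qed
    also have "\<phi> ` K \<inter> B = \<phi> ` {x \<in> K. \<phi> x \<in> B}" by auto
    also have "emeasure ?V (\<phi> ` {x \<in> K. \<phi> x \<in> B}) =
        (\<integral>\<^sup>+x\<in>{x \<in> K. \<phi> x \<in> B}. ennreal (sqrt (det (gram \<mu> \<phi> x))) \<partial>lborel)"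
      by (rule R(3)[OF \<phi> e(1)]) (use K in auto)
    also have "\<dots> = emeasure (chart_measure M \<mu> K \<phi>) B"
      unfolding e(2) by (intro nn_integral_cong) (auto simp: indicator_def)
    finally show "emeasure (density ?V (indicator (\<phi> ` K))) B = emeasure (chart_measure M \<mu> K \<phi>) B" .
  qed
  have "(LINT p:\<phi> ` K|?V. r p) = integral\<^sup>L (density ?V (\<lambda>p. ennreal (indicator (\<phi> ` K) p))) r"
    unfolding set_lebesgue_integral_def by (rule integral_density[symmetric]) (use imK rV in auto)
  also have "(\<lambda>p. ennreal (indicator (\<phi> ` K) p)) = indicator (\<phi> ` K)"
    by (auto simp: indicator_def)
  also have "integral\<^sup>L (density ?V (indicator (\<phi> ` K))) r =
      integral\<^sup>L (density (restrict_space lborel K) (\<lambda>x. ennreal (sqrt (det (gram \<mu> \<phi> x))))) (\<lambda>x. r (\<phi> x))"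
    unfolding eq chart_measure_def
    by (rule integral_distr) (use local_param_measurable[OF \<phi> K] rm in auto)
  also have "\<dots> = integral\<^sup>L (restrict_space lborel K) (\<lambda>x. sqrt (det (gram \<mu> \<phi> x)) *\<^sub>R r (\<phi> x))"
  proof (rule integral_density)
    show "(\<lambda>x. r (\<phi> x)) \<in> borel_measurable (restrict_space lborel K)"
      by (rule measurable_compose[OF local_param_measurable[OF \<phi> K] rm])
    show "AE x in restrict_space lborel K. 0 \<le> sqrt (det (gram \<mu> \<phi> x))"
      using vol_nonneg[OF \<phi>] K(2) by (intro AE_I2) (auto simp: space_restrict_space)
  qed (rule vol_measurable_restrict[OF \<phi> K])
  also have "\<dots> = (LINT x:K|lborel. sqrt (det (gram \<mu> \<phi> x)) * r (\<phi> x))"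
    unfolding set_lebesgue_integral_def using K(1) by (subst integral_restrict_space) auto
  finally show ?thesis .
qed

text \<open>Compact sets have finite volume, which makes the energy of a smooth map over them finite.\<close>

lemma emeasure_riemannian_compact:
  fixes M :: "'m::{t2_space,second_countable_topology} set" and \<mu> :: "'m \<Rightarrow> real ^ ('n::finite + 2)"
  assumes M: "sphere_hypersurface M \<mu>" and D: "compact D" "D \<subseteq> M"
  shows "D \<in> sets (riemannian_measure M \<mu>)" "emeasure (riemannian_measure M \<mu>) D < \<infinity>"
proof -
  note R = riemannian_measure_properties[OF M]
  let ?V = "riemannian_measure M \<mu>"
  have "D \<in> sets borel" using D(1) by (simp add: compact_imp_closed)
  then show DV: "D \<in> sets ?V" unfolding R(2) using D(2) by (auto simp: sets_restrict_space image_iff intro!: bexI[of _ D])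
  have "\<exists>T. open T \<and> p \<in> T \<and> (\<exists>K. K \<in> sets ?V \<and> M \<inter> T \<subseteq> K \<and> emeasure ?V K < \<infinity>)" if p: "p \<in> D" for p
  proof -
    obtain U \<phi> x where \<phi>: "local_param M \<mu> U \<phi>" "x \<in> U" "p = \<phi> x"
      using M D(2) p by (force simp: sphere_hypersurface_def)
    note q = local_paramD[OF \<phi>(1)]
    obtain d where d: "d > 0" "cball x d \<subseteq> U" using q(1) \<phi>(2) open_contains_cball by blast
    have "openin (top_of_set M) (\<phi> ` ball x d)"
      by (rule local_param_image_openin[OF \<phi>(1)]) (use d in auto)
    then obtain T where T: "open T" "\<phi> ` ball x d = M \<inter> T" by (auto simp: openin_open)
    let ?v = "\<lambda>x. sqrt (det (gram \<mu> \<phi> x))"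
    have K: "cball x d \<in> sets borel" by simp
    obtain C where C: "\<And>z. z \<in> cball x d \<Longrightarrow> ?v z \<le> C"
    proof -
      have "bounded (?v ` cball x d)"
        by (intro compact_imp_bounded compact_continuous_image compact_cball continuous_on_subset[OF continuous_on_vol[OF \<phi>(1)] d(2)])
      then obtain a where "\<forall>w\<in>?v ` cball x d. norm w \<le> a" unfolding bounded_iff by blast
      then have "?v z \<le> a" if "z \<in> cball x d" for z using that abs_le_D1 by fastforce
      then show ?thesis by (rule that)
    qed
    have "emeasure ?V (\<phi> ` cball x d) = (\<integral>\<^sup>+z\<in>cball x d. ennreal (?v z) \<partial>lborel)"
      by (rule R(3)[OF \<phi>(1) K d(2)])
    also have "\<dots> \<le> (\<integral>\<^sup>+z. ennreal C * indicator (cball x d) z \<partial>lborel)"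
      by (intro nn_integral_mono) (auto simp: indicator_def intro!: ennreal_leI C)
    also have "\<dots> = ennreal C * emeasure lborel (cball x d)"
      by (simp add: nn_integral_cmult_indicator)
    also have "\<dots> < \<infinity>"
      using emeasure_bounded_finite[OF bounded_cball, of x d] by (simp add: ennreal_mult_less_top)
    finally have "emeasure ?V (\<phi> ` cball x d) < \<infinity>" .
    moreover have "\<phi> ` cball x d \<in> sets ?V" unfolding R(2) by (rule local_param_image_sets[OF \<phi>(1) K d(2)])
    moreover have "M \<inter> T \<subseteq> \<phi> ` cball x d" using T(2) ball_subset_cball[of x d] by blast
    moreover have "p \<in> T" using T(2) \<phi>(3) d(1) by (metis IntD2 centre_in_ball imageI)
    ultimately show ?thesis using T(1) by blast
  qed
  then obtain T K where T: "\<And>p. p \<in> D \<Longrightarrow> open (T p) \<and> p \<in> T p \<and> K p \<in> sets ?V \<and> M \<inter> T p \<subseteq> K p \<and> emeasure ?V (K p) < \<infinity>"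
    by metis
  obtain F where F: "F \<subseteq> D" "finite F" "D \<subseteq> (\<Union>p\<in>F. T p)"
    using compactE_image[OF D(1), of D T] T by blast
  have "emeasure ?V D \<le> emeasure ?V (\<Union>p\<in>F. K p)"
    using F T D(2) by (intro emeasure_mono sets.finite_UN) (auto, blast)
  also have "\<dots> \<le> (\<Sum>p\<in>F. emeasure ?V (K p))"
    using F T by (intro emeasure_subadditive_finite) auto
  also have "\<dots> < \<infinity>"
  proof -
    have "emeasure ?V (K p) < \<infinity>" if "p \<in> F" for p using F(1) T that by blast
    with \<open>finite F\<close> show ?thesis by (induction F rule: finite_induct) (auto simp: ennreal_add_less_top)
  qed
  finally show "emeasure ?V D < \<infinity>" .
qed

section \<open>The first variation of the energy\<close>

lemma smooth_map_compose: "smooth_map M \<mu> f \<Longrightarrow> local_param M \<mu> U \<phi> \<Longrightarrow> smooth_on U (f \<circ> \<phi>)"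
  by (simp add: smooth_map_def)

lemma continuous_on_smooth_map:
  assumes "sphere_hypersurface M \<mu>" "smooth_map M \<mu> f"
  shows "continuous_on M f"
  by (rule continuous_on_if_charts[OF assms(1)])
     (use smooth_on_imp_continuous_on[OF smooth_map_compose[OF assms(2)]] in \<open>simp add: o_def\<close>)

lemma set_integrable_continuous_on:
  fixes r :: "'m::{t2_space,second_countable_topology} \<Rightarrow> real" and \<mu> :: "'m \<Rightarrow> real ^ ('n::finite + 2)"
  assumes M: "sphere_hypersurface M \<mu>" and D: "compact D" "D \<subseteq> M" and r: "continuous_on M r"
  shows "set_integrable (riemannian_measure M \<mu>) D r"
proof -
  note R = riemannian_measure_properties[OF M] and E = emeasure_riemannian_compact[OF M D]
  let ?V = "riemannian_measure M \<mu>"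
  have "r \<in> borel_measurable (restrict_space borel M)" by (rule borel_measurable_continuous_on_restrict[OF r])
  then have rV: "r \<in> borel_measurable ?V" by (simp cong: measurable_cong_sets add: R(2))
  have "bounded (r ` D)"
    by (intro compact_imp_bounded compact_continuous_image D continuous_on_subset[OF r])
  then obtain B where B: "\<forall>w\<in>r ` D. norm w \<le> B" unfolding bounded_iff by blast
  show ?thesis
    unfolding set_integrable_def
    by (rule integrableI_bounded_set_indicator[OF E(1) rV E(2), of B]) (use B in auto)
qed

lemma taylor_remainder_bound:
  fixes f :: "real \<Rightarrow> real"
  assumes t: "\<bar>t\<bar> \<le> d"
    and f: "\<And>s. \<bar>s\<bar> \<le> d \<Longrightarrow> (f has_real_derivative f' s) (at s)"
    and f': "\<And>s. \<bar>s\<bar> \<le> d \<Longrightarrow> (f' has_real_derivative f'' s) (at s)"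
    and C: "\<And>s. \<bar>s\<bar> \<le> d \<Longrightarrow> \<bar>f'' s\<bar> \<le> C"
  shows "\<bar>f t - f 0 - t * f' 0\<bar> \<le> C * t\<^sup>2"
proof (cases "t = 0")
  case False
  let ?diff = "\<lambda>m::nat. if m = 0 then f else if m = 1 then f' else f''"
  have "\<exists>s. (if t < 0 then t < s \<and> s < 0 else 0 < s \<and> s < t) \<and>
      f t = (\<Sum>m<2. ?diff m 0 / fact m * (t - 0) ^ m) + ?diff 2 s / fact 2 * (t - 0) ^ 2"
    by (rule Taylor[of 2 ?diff f "- d" d 0 t])
       (use t False in \<open>auto simp: less_2_cases_iff abs_le_iff intro!: f f'\<close>)
  then obtain s where s: "if t < 0 then t < s \<and> s < 0 else 0 < s \<and> s < t"
    and eq: "f t = f 0 + t * f' 0 + f'' s / 2 * t\<^sup>2"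
    by (auto simp: numeral_2_eq_2 lessThan_Suc)
  have "\<bar>s\<bar> \<le> d" using s t by (auto split: if_splits)
  then have "\<bar>f'' s\<bar> \<le> C" by (rule C)
  then have "\<bar>f'' s / 2\<bar> * t\<^sup>2 \<le> C * t\<^sup>2" by (intro mult_right_mono) auto
  moreover have "\<bar>f t - f 0 - t * f' 0\<bar> = \<bar>f'' s / 2\<bar> * t\<^sup>2" unfolding eq by (simp add: abs_mult)
  ultimately show ?thesis by simp
qed simp

lemma chart_form_has_derivative:
  assumes A: "\<And>i. (A i has_vector_derivative A' i) (at t)"
  shows "((\<lambda>t. chart_form y (\<lambda>i. A i t) (\<lambda>i. A i t) x) has_real_derivative
    2 * chart_form y (\<lambda>i. A i t) A' x) (at t)"
proof -
  have inner: "((\<lambda>t. A i t \<bullet> A j t) has_real_derivative A i t \<bullet> A' j + A' i \<bullet> A j t) (at t)" for i j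
    using has_derivative_inner[OF A[of i, unfolded has_vector_derivative_def] A[of j, unfolded has_vector_derivative_def]]
    unfolding has_field_derivative_def
    by (rule has_derivative_eq_rhs) (simp add: fun_eq_iff algebra_simps)
  have "((\<lambda>t. chart_form y (\<lambda>i. A i t) (\<lambda>i. A i t) x) has_real_derivative
     (\<Sum>i\<in>UNIV. \<Sum>j\<in>UNIV. (dual_frame (\<lambda>i. pd y i x) i \<bullet> dual_frame (\<lambda>i. pd y i x) j) *
        (A i t \<bullet> A' j + A' i \<bullet> A j t))) (at t)"
    unfolding chart_form_def by (intro DERIV_sum DERIV_cmult inner)
  also have "(\<Sum>i\<in>UNIV. \<Sum>j\<in>UNIV. (dual_frame (\<lambda>i. pd y i x) i \<bullet> dual_frame (\<lambda>i. pd y i x) j) *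
        (A i t \<bullet> A' j + A' i \<bullet> A j t)) = chart_form y (\<lambda>i. A i t) A' x + chart_form y A' (\<lambda>i. A i t) x"
    by (simp add: chart_form_def distrib_left sum.distrib)
  also have "\<dots> = 2 * chart_form y (\<lambda>i. A i t) A' x"
    by (simp add: chart_form_commute[of y A'])
  finally show ?thesis .
qed

definition variation_field :: "(real \<Rightarrow> 'm \<Rightarrow> 'c::real_normed_vector) \<Rightarrow> 'm \<Rightarrow> 'c" where
  "variation_field F p = vector_derivative (\<lambda>t. F t p) (at 0)"

locale variation =
  fixes M :: "'m::{t2_space,second_countable_topology} set" and \<mu> :: "'m \<Rightarrow> real ^ ('n::finite + 2)"
    and D :: "'m set" and f :: "'m \<Rightarrow> 'c::euclidean_space" and \<epsilon> :: real and F :: "real \<Rightarrow> 'm \<Rightarrow> 'c"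
  assumes M: "sphere_hypersurface M \<mu>" and D: "compact D" "D \<subseteq> M"
    and var: "sphere_variation M \<mu> D f \<epsilon> F"
begin

abbreviation I :: "real set" where "I \<equiv> {-\<epsilon><..<\<epsilon>}"

lemma eps: "\<epsilon> > 0" and F0: "p \<in> M \<Longrightarrow> F 0 p = f p"
  and F_outside: "t \<in> I \<Longrightarrow> p \<in> M - D \<Longrightarrow> F t p = f p"
  and F_sphere: "t \<in> I \<Longrightarrow> p \<in> M \<Longrightarrow> norm (F t p) = 1"
proof -
  show "\<epsilon> > 0" using var by (simp add: sphere_variation_def)
  show "p \<in> M \<Longrightarrow> F 0 p = f p" using var by (simp add: sphere_variation_def)
  show "t \<in> I \<Longrightarrow> p \<in> M - D \<Longrightarrow> F t p = f p" using var unfolding sphere_variation_def by blast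
  show "t \<in> I \<Longrightarrow> p \<in> M \<Longrightarrow> norm (F t p) = 1"
    using var unfolding sphere_variation_def image_subset_iff mem_sphere_0 by blast
qed

lemma smooth_F: "local_param M \<mu> U \<phi> \<Longrightarrow> smooth_on (I \<times> U) (\<lambda>z. F (fst z) (\<phi> (snd z)))"
  using var by (simp add: sphere_variation_def case_prod_beta')

lemma open_IU: "open U \<Longrightarrow> open (I \<times> U)" by (intro open_Times) auto

lemma line_derivative:
  fixes g :: "real \<times> (real ^ 'n) \<Rightarrow> 'd::real_normed_vector"
  assumes "smooth_on (I \<times> U) g" "t \<in> I" "x \<in> U"
  shows "((\<lambda>t. g (t, x)) has_vector_derivative frechet_derivative g (at (t, x)) (1, 0)) (at t)"
proof -
  have g: "(g has_derivative frechet_derivative g (at (t, x))) (at (t, x))"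
    by (rule smooth_on_has_derivative[OF assms(1)]) (use assms in auto)
  have "((\<lambda>t. (t, x)) has_derivative (\<lambda>h. (h, 0))) (at t)" by (auto intro!: derivative_eq_intros)
  note comp = has_derivative_compose[OF this g]
  have "frechet_derivative g (at (t, x)) (h, 0) = h *\<^sub>R frechet_derivative g (at (t, x)) (1, 0)" for h
    using linear_cmul[OF has_derivative_linear[OF g], of h "(1, 0)"] by simp
  then show ?thesis unfolding has_vector_derivative_def by (intro has_derivative_eq_rhs[OF comp] ext)
qed

lemma slice_derivative:
  fixes g :: "real \<times> (real ^ 'n) \<Rightarrow> 'd::real_normed_vector"
  assumes "smooth_on (I \<times> U) g" "t \<in> I" "x \<in> U"
  shows "pd (\<lambda>x. g (t, x)) i x = frechet_derivative g (at (t, x)) (0, axis i 1)"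
proof -
  have g: "(g has_derivative frechet_derivative g (at (t, x))) (at (t, x))"
    by (rule smooth_on_has_derivative[OF assms(1)]) (use assms in auto)
  have "((\<lambda>x. (t, x)) has_derivative (\<lambda>h. (0, h))) (at x)" by (auto intro!: derivative_eq_intros)
  from pd_eqI[OF has_derivative_compose[OF this g]] show ?thesis .
qed

lemma smooth_slice:
  fixes g :: "real \<times> (real ^ 'n) \<Rightarrow> 'd::real_normed_vector"
  assumes "smooth_on (I \<times> U) g" "t \<in> I" "open U"
  shows "smooth_on U (\<lambda>x. g (t, x))"
proof (rule smooth_on_compose[OF assms(3) _ assms(1)])
  have "smooth_on U (\<lambda>x. (t, 0) + (0, x))"
    by (intro smooth_on_add assms smooth_on_const smooth_on_bounded_linear bounded_linear_Pair bounded_linear_zero bounded_linear_ident)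
  then show "smooth_on U (\<lambda>x. (t, x))" by simp
  show "(\<lambda>x. (t, x)) ` U \<subseteq> I \<times> U" using assms(2) by auto
qed

lemma smooth_map_F:
  assumes "t \<in> I"
  shows "smooth_map M \<mu> (F t)"
  unfolding smooth_map_def
proof (intro allI impI)
  fix U \<phi> assume \<phi>: "local_param M \<mu> U \<phi>"
  show "smooth_on U (F t \<circ> \<phi>)"
    using smooth_slice[OF smooth_F[OF \<phi>] assms local_paramD(1)[OF \<phi>]] by (simp add: o_def)
qed

lemma variation_field_chart:
  assumes \<phi>: "local_param M \<mu> U \<phi>" and x: "x \<in> U"
  shows "variation_field F (\<phi> x) = frechet_derivative (\<lambda>z. F (fst z) (\<phi> (snd z))) (at (0, x)) (1, 0)"
    and "((\<lambda>t. F t (\<phi> x)) has_vector_derivative variation_field F (\<phi> x)) (at 0)"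
proof -
  have 0: "0 \<in> I" using eps by simp
  show "variation_field F (\<phi> x) = frechet_derivative (\<lambda>z. F (fst z) (\<phi> (snd z))) (at (0, x)) (1, 0)"
    unfolding variation_field_def using line_derivative[OF smooth_F[OF \<phi>] 0 x] by (simp add: vector_derivative_at)
  then show "((\<lambda>t. F t (\<phi> x)) has_vector_derivative variation_field F (\<phi> x)) (at 0)"
    using line_derivative[OF smooth_F[OF \<phi>] 0 x] by simp
qed

lemma smooth_map_variation_field: "smooth_map M \<mu> (variation_field F)"
  unfolding smooth_map_def
proof (intro allI impI)
  fix U \<phi> assume \<phi>: "local_param M \<mu> U \<phi>"
  note U = local_paramD(1)[OF \<phi>]
  have "smooth_on U (\<lambda>x. frechet_derivative (\<lambda>z. F (fst z) (\<phi> (snd z))) (at (0, x)) (1, 0))"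
    by (rule smooth_slice[OF smooth_on_frechet[OF smooth_F[OF \<phi>]] _ U]) (use eps in auto)
  then show "smooth_on U (variation_field F \<circ> \<phi>)"
    by (rule smooth_on_cong[OF _ U]) (simp add: variation_field_chart(1)[OF \<phi>])
qed

lemma ex_chart:
  assumes "p \<in> M"
  obtains U \<phi> x where "local_param M \<mu> U \<phi>" "x \<in> U" "\<phi> x = p"
  using M assms by (force simp: sphere_hypersurface_def)

lemma variation_field_outside:
  assumes p: "p \<in> M - D"
  shows "variation_field F p = 0"
proof -
  obtain U \<phi> x where \<phi>: "local_param M \<mu> U \<phi>" "x \<in> U" "\<phi> x = p" using ex_chart p by blast
  have "((\<lambda>t. f p) has_vector_derivative variation_field F p) (at 0)"
    by (rule has_vector_derivative_transform_within_open[OF variation_field_chart(2)[OF \<phi>(1,2), unfolded \<phi>(3)], of I])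
       (use eps F_outside p in auto)
  then show ?thesis using vector_derivative_at has_vector_derivative_const by (metis vector_derivative_const_at)
qed

lemma variation_field_orthogonal:
  assumes p: "p \<in> M"
  shows "variation_field F p \<bullet> f p = 0"
proof -
  obtain U \<phi> x where \<phi>: "local_param M \<mu> U \<phi>" "x \<in> U" "\<phi> x = p" using ex_chart p by blast
  let ?V = "variation_field F p"
  have d: "((\<lambda>t. F t p) has_derivative (\<lambda>h. h *\<^sub>R ?V)) (at 0)"
    using variation_field_chart(2)[OF \<phi>(1,2)] \<phi>(3) by (simp add: has_vector_derivative_def)
  have "((\<lambda>t. F t p \<bullet> F t p) has_derivative (\<lambda>h. F 0 p \<bullet> (h *\<^sub>R ?V) + (h *\<^sub>R ?V) \<bullet> F 0 p)) (at 0)"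
    by (rule has_derivative_inner[OF d d])
  then have "((\<lambda>t. 1) has_derivative (\<lambda>h. F 0 p \<bullet> (h *\<^sub>R ?V) + (h *\<^sub>R ?V) \<bullet> F 0 p)) (at 0)"
    by (rule has_derivative_transform_within_open[of _ _ _ _ I]) (use eps F_sphere[OF _ p] in \<open>auto simp: norm_eq_1\<close>)
  then have "(\<lambda>h. F 0 p \<bullet> (h *\<^sub>R ?V) + (h *\<^sub>R ?V) \<bullet> F 0 p) = (\<lambda>h. 0 :: real)"
    by (rule has_derivative_unique) simp
  from fun_cong[OF this, of 1] show ?thesis by (simp add: F0[OF p] inner_commute)
qed

text \<open>In a chart the energy density is a smooth function of the parameter and the coordinates. Its second
  derivative in the parameter is bounded near a point, so Taylor's formula holds there uniformly.\<close>

lemma energy_density_expansion: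
  assumes p: "p \<in> M"
  shows "\<exists>T C. open T \<and> p \<in> T \<and> C \<ge> 0 \<and> (\<forall>t p'. \<bar>t\<bar> \<le> \<epsilon> / 2 \<longrightarrow> p' \<in> M \<inter> T \<longrightarrow>
    \<bar>dirichlet_form M \<mu> (F t) (F t) p' - dirichlet_form M \<mu> (F 0) (F 0) p'
      - t * (2 * dirichlet_form M \<mu> (F 0) (variation_field F) p')\<bar> \<le> C * t\<^sup>2)"
proof -
  obtain U \<phi> x0 where \<phi>: "local_param M \<mu> U \<phi>" and x0: "x0 \<in> U" "\<phi> x0 = p" using ex_chart p by blast
  interpret immersed_chart U "\<mu> \<circ> \<phi>" by (rule immersed_chart_local_param[OF \<phi>])
  let ?P = "\<lambda>z. F (fst z) (\<phi> (snd z))"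
  let ?a = "\<lambda>i z. frechet_derivative ?P (at z) (0, axis i 1)"
  define Q where "Q z = chart_form (\<mu> \<circ> \<phi>) (\<lambda>i. ?a i z) (\<lambda>i. ?a i z) (snd z)" for z
  let ?Q1 = "\<lambda>z. frechet_derivative Q (at z) (1, 0)"
  let ?Q2 = "\<lambda>z. frechet_derivative ?Q1 (at z) (1, 0)"
  note sP = smooth_F[OF \<phi>] and oIU = open_IU[OF open_U]
  have sQ: "smooth_on (I \<times> U) Q"
    unfolding Q_def
    by (rule smooth_chart_form[OF oIU smooth_on_bounded_linear[OF oIU bounded_linear_snd]])
       (auto intro!: smooth_on_frechet sP)
  have sQ1: "smooth_on (I \<times> U) ?Q1" and sQ2: "smooth_on (I \<times> U) ?Q2" by (intro smooth_on_frechet sQ)+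
  have Qt: "dirichlet_form M \<mu> (F t) (F t) (\<phi> x) = Q (t, x)" if "t \<in> I" "x \<in> U" for t x
    unfolding dirichlet_form_chart[OF \<phi> that(2) smooth_map_F[OF that(1)] smooth_map_F[OF that(1)]] Q_def
    using slice_derivative[OF sP that] by (simp add: o_def)
  have d1: "((\<lambda>t. Q (t, x)) has_real_derivative ?Q1 (t, x)) (at t)" if "t \<in> I" "x \<in> U" for t x
    using line_derivative[OF sQ that] by (simp add: has_real_derivative_iff_has_vector_derivative)
  have d2: "((\<lambda>t. ?Q1 (t, x)) has_real_derivative ?Q2 (t, x)) (at t)" if "t \<in> I" "x \<in> U" for t x
    using line_derivative[OF sQ1 that] by (simp add: has_real_derivative_iff_has_vector_derivative)
  have 0: "0 \<in> I" using eps by simp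
  \<comment> \<open>the derivatives in \<open>t\<close> and in the coordinates are exchanged here\<close>
  have first: "?Q1 (0, x) = 2 * dirichlet_form M \<mu> (F 0) (variation_field F) (\<phi> x)" if x: "x \<in> U" for x
  proof -
    let ?b = "\<lambda>i. frechet_derivative (?a i) (at (0, x)) (1, 0)"
    have "((\<lambda>t. chart_form (\<mu> \<circ> \<phi>) (\<lambda>i. ?a i (t, x)) (\<lambda>i. ?a i (t, x)) x) has_real_derivative
        2 * chart_form (\<mu> \<circ> \<phi>) (\<lambda>i. ?a i (0, x)) ?b x) (at 0)"
      by (rule chart_form_has_derivative[where A = "\<lambda>i t. ?a i (t, x)"])
         (rule line_derivative[OF smooth_on_frechet[OF sP] 0 x])
    then have "((\<lambda>t. Q (t, x)) has_real_derivative 2 * chart_form (\<mu> \<circ> \<phi>) (\<lambda>i. ?a i (0, x)) ?b x) (at 0)"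
      by (simp add: Q_def)
    then have "?Q1 (0, x) = 2 * chart_form (\<mu> \<circ> \<phi>) (\<lambda>i. ?a i (0, x)) ?b x"
      using d1[OF 0 x] DERIV_unique by blast
    moreover have "?b i = pd (variation_field F \<circ> \<phi>) i x" for i
    proof -
      have "?b i = frechet_derivative (\<lambda>z. frechet_derivative ?P (at z) (1, 0)) (at (0, x)) (0, axis i 1)"
        by (rule frechet_derivative_symmetric[OF sP oIU]) (use 0 x in auto)
      also have "\<dots> = pd (\<lambda>x. frechet_derivative ?P (at (0, x)) (1, 0)) i x"
        by (rule slice_derivative[OF smooth_on_frechet[OF sP] 0 x, symmetric])
      also have "\<dots> = pd (variation_field F \<circ> \<phi>) i x"
        by (rule pd_cong[OF open_U x _ smooth_slice[OF smooth_on_frechet[OF sP] 0 open_U]])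
           (simp add: variation_field_chart(1)[OF \<phi>])
      finally show ?thesis .
    qed
    moreover have "?a i (0, x) = pd (F 0 \<circ> \<phi>) i x" for i
      using slice_derivative[OF sP 0 x] by (simp add: o_def)
    ultimately show ?thesis
      by (simp add: dirichlet_form_chart[OF \<phi> x smooth_map_F[OF 0] smooth_map_variation_field])
  qed
  obtain d where d: "d > 0" "cball x0 d \<subseteq> U" using open_U x0 open_contains_cball by blast
  have sub: "{-\<epsilon>/2..\<epsilon>/2} \<times> cball x0 d \<subseteq> I \<times> U" using d eps by auto
  have "bounded (?Q2 ` ({-\<epsilon>/2..\<epsilon>/2} \<times> cball x0 d))"
    by (intro compact_imp_bounded compact_continuous_image compact_Times compact_Icc compact_cball
        continuous_on_subset[OF smooth_on_imp_continuous_on[OF sQ2] sub])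
  then obtain C where C: "\<forall>w\<in>?Q2 ` ({-\<epsilon>/2..\<epsilon>/2} \<times> cball x0 d). norm w \<le> C" unfolding bounded_iff by blast
  have "openin (top_of_set M) (\<phi> ` ball x0 d)"
    by (rule local_param_image_openin[OF \<phi>]) (use d in auto)
  then obtain T where T: "open T" "\<phi> ` ball x0 d = M \<inter> T" by (auto simp: openin_open)
  have "\<bar>dirichlet_form M \<mu> (F t) (F t) p' - dirichlet_form M \<mu> (F 0) (F 0) p'
      - t * (2 * dirichlet_form M \<mu> (F 0) (variation_field F) p')\<bar> \<le> max C 0 * t\<^sup>2"
    if t: "\<bar>t\<bar> \<le> \<epsilon> / 2" and p': "p' \<in> M \<inter> T" for t p'
  proof -
    obtain x where x: "x \<in> ball x0 d" "p' = \<phi> x" using p' T by blast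
    have xU: "x \<in> U" "x \<in> cball x0 d" using x d by (auto simp: subset_iff)
    have sI: "s \<in> I" if "\<bar>s\<bar> \<le> \<epsilon>/2" for s using that eps by auto
    have "\<bar>Q (t, x) - Q (0, x) - t * ?Q1 (0, x)\<bar> \<le> max C 0 * t\<^sup>2"
    proof (rule taylor_remainder_bound[OF t, where f'' = "\<lambda>s. ?Q2 (s, x)"])
      fix s :: real assume s: "\<bar>s\<bar> \<le> \<epsilon> / 2"
      show "((\<lambda>t. Q (t, x)) has_real_derivative ?Q1 (s, x)) (at s)" by (rule d1[OF sI[OF s] xU(1)])
      show "((\<lambda>t. ?Q1 (t, x)) has_real_derivative ?Q2 (s, x)) (at s)" by (rule d2[OF sI[OF s] xU(1)])
      have "(s, x) \<in> {-\<epsilon>/2..\<epsilon>/2} \<times> cball x0 d" using s xU by auto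
      then have "norm (?Q2 (s, x)) \<le> C" using C by blast
      then show "\<bar>?Q2 (s, x)\<bar> \<le> max C 0" by simp
    qed
    then show ?thesis
      unfolding x(2) Qt[OF sI[OF t] xU(1)] Qt[OF 0 xU(1)] first[OF xU(1), symmetric] .
  qed
  moreover have "p \<in> T" using T(2) x0 d by (metis IntD2 centre_in_ball imageI)
  ultimately show ?thesis using T(1) by (intro exI[of _ T] exI[of _ "max C 0"]) auto
qed

lemma energy_density_expansion_uniform:
  obtains C where "\<And>t p. \<bar>t\<bar> \<le> \<epsilon> / 2 \<Longrightarrow> p \<in> D \<Longrightarrow>
    \<bar>dirichlet_form M \<mu> (F t) (F t) p - dirichlet_form M \<mu> (F 0) (F 0) p
      - t * (2 * dirichlet_form M \<mu> (F 0) (variation_field F) p)\<bar> \<le> C * t\<^sup>2"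
proof -
  let ?R = "\<lambda>t p. \<bar>dirichlet_form M \<mu> (F t) (F t) p - dirichlet_form M \<mu> (F 0) (F 0) p
      - t * (2 * dirichlet_form M \<mu> (F 0) (variation_field F) p)\<bar>"
  obtain T C where TC: "\<And>p. p \<in> M \<Longrightarrow> open (T p) \<and> p \<in> T p \<and> C p \<ge> 0 \<and>
      (\<forall>t p'. \<bar>t\<bar> \<le> \<epsilon> / 2 \<longrightarrow> p' \<in> M \<inter> T p \<longrightarrow> ?R t p' \<le> C p * t\<^sup>2)"
    using energy_density_expansion by metis
  obtain S where S: "S \<subseteq> D" "finite S" "D \<subseteq> (\<Union>p\<in>S. T p)"
    using compactE_image[OF D(1), of D T] TC D(2) by blast
  show ?thesis
  proof (rule that[of "\<Sum>p\<in>S. C p"])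
    fix t p assume t: "\<bar>t\<bar> \<le> \<epsilon> / 2" and p: "p \<in> D"
    obtain p0 where p0: "p0 \<in> S" "p \<in> T p0" using S p by blast
    have Cnn: "0 \<le> C q" if "q \<in> S" for q using TC S(1) D(2) that by blast
    have "?R t p \<le> C p0 * t\<^sup>2" using TC[of p0] p0 S(1) D(2) p t by blast
    also have "\<dots> \<le> (\<Sum>p\<in>S. C p) * t\<^sup>2"
    proof (intro mult_right_mono)
      show "C p0 \<le> (\<Sum>p\<in>S. C p)" by (rule member_le_sum[OF p0(1) _ S(2)]) (use Cnn in auto)
    qed auto
    finally show "?R t p \<le> (\<Sum>p\<in>S. C p) * t\<^sup>2" .
  qed
qed

text \<open>The error of the uniform expansion is at most \<open>C t\<^sup>2\<close> times the volume of \<open>D\<close>.\<close>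

theorem first_variation:
  "((\<lambda>t. energy M \<mu> D (F t)) has_real_derivative
    2 * (LINT p:D|riemannian_measure M \<mu>. dirichlet_form M \<mu> (F 0) (variation_field F) p)) (at 0)"
proof -
  let ?V = "riemannian_measure M \<mu>"
  let ?q = "\<lambda>t. dirichlet_form M \<mu> (F t) (F t)" and ?r = "dirichlet_form M \<mu> (F 0) (variation_field F)"
  have 0: "0 \<in> I" using eps by simp
  obtain C where C: "\<And>t p. \<bar>t\<bar> \<le> \<epsilon> / 2 \<Longrightarrow> p \<in> D \<Longrightarrow> \<bar>?q t p - ?q 0 p - t * (2 * ?r p)\<bar> \<le> C * t\<^sup>2"
    using energy_density_expansion_uniform by blast
  note fin = emeasure_riemannian_compact[OF M D]
  let ?m = "measure ?V D"
  have E: "energy M \<mu> D (F t) = (LINT p:D|?V. ?q t p)" for t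
    unfolding energy_def hs_norm_dmap ..
  have iq: "set_integrable ?V D (?q t)" if "t \<in> I" for t
    by (rule set_integrable_continuous_on[OF M D continuous_on_dirichlet_form[OF M smooth_map_F smooth_map_F]]) (rule that)+
  have ir: "set_integrable ?V D ?r"
    by (rule set_integrable_continuous_on[OF M D continuous_on_dirichlet_form[OF M smooth_map_F[OF 0] smooth_map_variation_field]])
  let ?B = "2 * (LINT p:D|?V. ?r p)"
  have est: "\<bar>energy M \<mu> D (F t) - energy M \<mu> D (F 0) - t * ?B\<bar> \<le> C * t\<^sup>2 * ?m" if t: "\<bar>t\<bar> \<le> \<epsilon> / 2" for t
  proof -
    have tI: "t \<in> I" using t eps by auto
    let ?g = "\<lambda>p. ?q t p - ?q 0 p - t * (2 * ?r p)"
    have ig: "set_integrable ?V D ?g"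
      by (intro set_integral_diff iq tI 0) (intro set_integrable_mult_right ir)
    have "(LINT p:D|?V. ?g p) = energy M \<mu> D (F t) - energy M \<mu> D (F 0) - t * ?B"
      using iq[OF tI] iq[OF 0] ir by (simp add: E set_integral_diff)
    moreover have "\<bar>LINT p:D|?V. ?g p\<bar> \<le> C * t\<^sup>2 * ?m"
    proof -
      have ig': "integrable ?V (\<lambda>p. indicator D p * ?g p)" using ig by (simp add: set_integrable_def)
      have "\<bar>LINT p:D|?V. ?g p\<bar> \<le> (LINT p|?V. \<bar>indicator D p * ?g p\<bar>)"
        unfolding set_lebesgue_integral_def real_scaleR_def by (rule integral_abs_bound)
      also have "\<dots> \<le> (LINT p|?V. indicator D p * (C * t\<^sup>2))"
      proof (rule integral_mono)
        show "integrable ?V (\<lambda>p. \<bar>indicator D p * ?g p\<bar>)" using ig' by (rule integrable_abs)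
        show "integrable ?V (\<lambda>p. indicator D p * (C * t\<^sup>2))"
          using fin by (intro integrable_mult_left integrable_real_indicator) auto
        show "\<bar>indicator D p * ?g p\<bar> \<le> indicator D p * (C * t\<^sup>2)" for p
          using C[OF t] by (cases "p \<in> D") auto
      qed
      also have "\<dots> = C * t\<^sup>2 * ?m" using fin by simp
      finally show ?thesis .
    qed
    ultimately show ?thesis by simp
  qed
  have "((\<lambda>h. (energy M \<mu> D (F h) - energy M \<mu> D (F 0)) / h - ?B) \<longlongrightarrow> 0) (at 0)"
  proof (rule Lim_null_comparison)
    show "((\<lambda>h. C * ?m * \<bar>h\<bar>) \<longlongrightarrow> 0) (at 0)" by (auto intro!: tendsto_eq_intros)
    show "\<forall>\<^sub>F h in at 0. norm ((energy M \<mu> D (F h) - energy M \<mu> D (F 0)) / h - ?B) \<le> C * ?m * \<bar>h\<bar>"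
      unfolding eventually_at
    proof (intro exI[of _ "\<epsilon> / 2"] conjI ballI impI)
      fix h :: real assume h: "h \<noteq> 0 \<and> dist h 0 < \<epsilon> / 2"
      have "norm ((energy M \<mu> D (F h) - energy M \<mu> D (F 0)) / h - ?B) =
          \<bar>energy M \<mu> D (F h) - energy M \<mu> D (F 0) - h * ?B\<bar> / \<bar>h\<bar>"
        using h by (simp add: field_simps flip: abs_divide)
      also have "\<dots> \<le> C * h\<^sup>2 * ?m / \<bar>h\<bar>"
        using est[of h] h by (intro divide_right_mono) auto
      also have "\<dots> = C * ?m * \<bar>h\<bar>" using h by (simp add: power2_eq_square abs_if field_simps)
      finally show "norm ((energy M \<mu> D (F h) - energy M \<mu> D (F 0)) / h - ?B) \<le> C * ?m * \<bar>h\<bar>" .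
    qed (use eps in auto)
  qed
  then have "((\<lambda>h. (energy M \<mu> D (F h) - energy M \<mu> D (F 0)) / h) \<longlongrightarrow> ?B) (at 0)"
    by (simp add: LIM_zero_iff)
  then show ?thesis by (simp add: has_field_derivative_iff)
qed

end

section \<open>The Euler-Lagrange equation of harmonic maps into spheres\<close>

lemma dmap_eq_0_if_locally_0:
  fixes f :: "'m::{t2_space,second_countable_topology} \<Rightarrow> 'c::real_normed_vector" and \<mu> :: "'m \<Rightarrow> real ^ ('n::finite + 2)"
  assumes M: "sphere_hypersurface M \<mu>" and f: "smooth_map M \<mu> f"
    and S: "closed S" "\<And>p. p \<in> M - S \<Longrightarrow> f p = 0" and p: "p \<in> M - S"
    and X: "X \<in> tangent_space M \<mu> p"
  shows "dmap M \<mu> f p X = 0"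
proof -
  obtain U \<phi> x where \<phi>: "local_param M \<mu> U \<phi>" and x: "x \<in> U" "\<phi> x = p"
    using M p by (force simp: sphere_hypersurface_def)
  note q = local_paramD[OF \<phi>]
  have oW: "open (U \<inter> \<phi> -` (- S))" using S(1) by (intro continuous_open_preimage[OF q(4,1)]) auto
  have "((\<lambda>x. 0) has_derivative (\<lambda>h. 0)) (at x)" by simp
  then have "((f \<circ> \<phi>) has_derivative (\<lambda>h. 0)) (at x)"
    by (rule has_derivative_transform_within_open[OF _ oW]) (use x p S(2) q(7) in auto)
  then have 0: "frechet_derivative (f \<circ> \<phi>) (at x) v = 0" for v
    using frechet_derivative_at by metis
  have "X \<in> span (range (\<lambda>i. pd (\<mu> \<circ> \<phi>) i x))" using X tangent_space_chart[OF \<phi> x(1)] x(2) by simp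
  then obtain c where "X = (\<Sum>i\<in>UNIV. c i *\<^sub>R pd (\<mu> \<circ> \<phi>) i x)" by (rule span_range_frame)
  then show ?thesis
    using dmap_frame[OF \<phi> x(1) f] x(2) 0 by (simp add: pd_def)
qed

lemma dirichlet_form_eq_0_if_locally_0:
  fixes f g :: "'m::{t2_space,second_countable_topology} \<Rightarrow> 'c::euclidean_space" and \<mu> :: "'m \<Rightarrow> real ^ ('n::finite + 2)"
  assumes M: "sphere_hypersurface M \<mu>" and g: "smooth_map M \<mu> g"
    and S: "closed S" "\<And>p. p \<in> M - S \<Longrightarrow> g p = 0" and p: "p \<in> M - S"
  shows "dirichlet_form M \<mu> f g p = 0"
proof -
  have "subspace (tangent_space M \<mu> p)"
    using M p subspace_tangent_space by (force simp: sphere_hypersurface_def)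
  then have "onb (tangent_space M \<mu> p) \<subseteq> tangent_space M \<mu> p" by (rule onb_properties(1))
  then show ?thesis
    unfolding dirichlet_form_def using dmap_eq_0_if_locally_0[OF M g S p] by (intro sum.neutral) auto
qed

text \<open>The differential of the test map vanishes off its support, which reduces the integral over \<open>D\<close> to
  Green's identity in the chart.\<close>

lemma weak_laplacian:
  fixes f g :: "'m::{t2_space,second_countable_topology} \<Rightarrow> 'c::euclidean_space" and \<mu> :: "'m \<Rightarrow> real ^ ('n::finite + 2)"
  assumes M: "sphere_hypersurface M \<mu>" and f: "smooth_map M \<mu> f" and g: "smooth_map M \<mu> g"
    and \<phi>: "local_param M \<mu> U \<phi>" and K: "compact K" "K \<subseteq> U" and KD: "\<phi> ` K \<subseteq> D"
    and g0: "\<And>p. p \<in> M - \<phi> ` K \<Longrightarrow> g p = 0"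
  shows "(LINT p:D|riemannian_measure M \<mu>. dirichlet_form M \<mu> f g p) =
    - (LINT x:K|lborel. immersed_chart.vol (\<mu> \<circ> \<phi>) x * (immersed_chart.lap (\<mu> \<circ> \<phi>) (f \<circ> \<phi>) x \<bullet> g (\<phi> x)))"
proof -
  interpret immersed_chart U "\<mu> \<circ> \<phi>" by (rule immersed_chart_local_param[OF \<phi>])
  note q = local_paramD[OF \<phi>]
  let ?V = "riemannian_measure M \<mu>"
  have "compact (\<phi> ` K)" by (rule compact_continuous_image[OF continuous_on_subset[OF q(4) K(2)] K(1)])
  then have cl: "closed (\<phi> ` K)" by (rule compact_imp_closed)
  have sf: "smooth_on U (f \<circ> \<phi>)" and sg: "smooth_on U (g \<circ> \<phi>)"
    by (rule smooth_map_compose[OF f \<phi>], rule smooth_map_compose[OF g \<phi>])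
  have "(LINT p:D|?V. dirichlet_form M \<mu> f g p) = (LINT p:\<phi> ` K|?V. dirichlet_form M \<mu> f g p)"
    unfolding set_lebesgue_integral_def
  proof (rule Bochner_Integration.integral_cong[OF refl])
    fix p assume "p \<in> space ?V"
    then have "p \<in> M" by (simp add: riemannian_measure_properties(1)[OF M])
    then show "indicator D p *\<^sub>R dirichlet_form M \<mu> f g p = indicator (\<phi> ` K) p *\<^sub>R dirichlet_form M \<mu> f g p"
      using dirichlet_form_eq_0_if_locally_0[OF M g cl g0, of p f] KD
      by (cases "p \<in> \<phi> ` K") (auto simp: indicator_def)
  qed
  also have "\<dots> = (LINT x:K|lborel. sqrt (det (gram \<mu> \<phi> x)) * dirichlet_form M \<mu> f g (\<phi> x))"
    by (rule chart_integral[OF M \<phi> borel_closed[OF compact_imp_closed[OF K(1)]] K(2)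
          continuous_on_dirichlet_form[OF M f g]])
  also have "\<dots> = (LINT x:K|lborel. vol x * (\<Sum>i\<in>UNIV. \<Sum>j\<in>UNIV. (E i x \<bullet> E j x) * (pd (f \<circ> \<phi>) i x \<bullet> pd (g \<circ> \<phi>) j x)))"
    unfolding set_lebesgue_integral_def
  proof (rule Bochner_Integration.integral_cong[OF refl])
    fix x
    show "indicator K x *\<^sub>R (sqrt (det (gram \<mu> \<phi> x)) * dirichlet_form M \<mu> f g (\<phi> x)) =
        indicator K x *\<^sub>R (vol x * (\<Sum>i\<in>UNIV. \<Sum>j\<in>UNIV. (E i x \<bullet> E j x) * (pd (f \<circ> \<phi>) i x \<bullet> pd (g \<circ> \<phi>) j x)))"
      using dirichlet_form_chart[OF \<phi> _ f g, of x] K(2)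
      by (cases "x \<in> K") (auto simp: vol_eq_gram[OF \<phi>] chart_form_def)
  qed
  also have "\<dots> = - (LINT x:K|lborel. vol x * (lap (f \<circ> \<phi>) x \<bullet> (g \<circ> \<phi>) x))"
  proof (rule green_identity[OF sf sg K])
    fix x assume x: "x \<in> U - K"
    then have "\<phi> x \<notin> \<phi> ` K" using q(3) K(2) by (simp add: inj_on_image_mem_iff)
    then show "(g \<circ> \<phi>) x = 0" using g0[of "\<phi> x"] q(7) x by auto
  qed
  finally show ?thesis by simp
qed

lemma dirichlet_form_cong_left:
  assumes M: "sphere_hypersurface M \<mu>" and f: "smooth_map M \<mu> f" "smooth_map M \<mu> f'" and g: "smooth_map M \<mu> g"
    and eq: "\<And>p. p \<in> M \<Longrightarrow> f p = f' p" and p: "p \<in> M"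
  shows "dirichlet_form M \<mu> f g p = dirichlet_form M \<mu> f' g p"
proof -
  obtain U \<phi> x where \<phi>: "local_param M \<mu> U \<phi>" and x: "x \<in> U" "\<phi> x = p"
    using M p by (force simp: sphere_hypersurface_def)
  note q = local_paramD[OF \<phi>]
  have "pd (f \<circ> \<phi>) i x = pd (f' \<circ> \<phi>) i x" for i
    by (rule pd_cong[OF q(1) x(1) _ smooth_map_compose[OF f(1) \<phi>]]) (use q(7) eq in auto)
  then show ?thesis
    using dirichlet_form_chart[OF \<phi> x(1) _ g] f x(2) by simp
qed

lemma dirichlet_form_sum_right:
  fixes f :: "'m::{t2_space,second_countable_topology} \<Rightarrow> 'c::euclidean_space" and \<mu> :: "'m \<Rightarrow> real ^ ('n::finite + 2)"
  assumes M: "sphere_hypersurface M \<mu>" and f: "smooth_map M \<mu> f" and g: "smooth_map M \<mu> g"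
    and w: "\<And>k. k \<in> S \<Longrightarrow> smooth_map M \<mu> (w k)" and eq: "\<And>p. p \<in> M \<Longrightarrow> g p = (\<Sum>k\<in>S. w k p)" and p: "p \<in> M"
  shows "dirichlet_form M \<mu> f g p = (\<Sum>k\<in>S. dirichlet_form M \<mu> f (w k) p)"
proof -
  obtain U \<phi> x where \<phi>: "local_param M \<mu> U \<phi>" and x: "x \<in> U" "\<phi> x = p"
    using M p by (force simp: sphere_hypersurface_def)
  note q = local_paramD[OF \<phi>]
  have "pd (g \<circ> \<phi>) i x = (\<Sum>k\<in>S. pd (w k \<circ> \<phi>) i x)" for i
  proof -
    have "pd (g \<circ> \<phi>) i x = pd (\<lambda>z. \<Sum>k\<in>S. (w k \<circ> \<phi>) z) i x"
      by (rule pd_cong[OF q(1) x(1) _ smooth_map_compose[OF g \<phi>]]) (use q(7) eq in auto)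
    also have "\<dots> = (\<Sum>k\<in>S. pd (w k \<circ> \<phi>) i x)"
      by (rule pd_sum[OF smooth_map_compose[OF w \<phi>] x(1)])
    finally show ?thesis .
  qed
  then have "dirichlet_form M \<mu> f g (\<phi> x) =
      chart_form (\<mu> \<circ> \<phi>) (\<lambda>i. pd (f \<circ> \<phi>) i x) (\<lambda>i. \<Sum>k\<in>S. pd (w k \<circ> \<phi>) i x) x"
    by (simp add: dirichlet_form_chart[OF \<phi> x(1) f g])
  also have "\<dots> = (\<Sum>k\<in>S. dirichlet_form M \<mu> f (w k) (\<phi> x))"
    unfolding chart_form_sum_right by (intro sum.cong refl) (simp add: dirichlet_form_chart[OF \<phi> x(1) f w])
  finally show ?thesis by (simp add: x(2))
qed

text \<open>A solution of the Euler-Lagrange equation is critical: a partition of unity splits the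
  variation field into fields supported in charts, and each of them is orthogonal to \<open>f\<close>.\<close>

lemma (in variation) euler_lagrange_imp_critical:
  assumes f: "smooth_map M \<mu> f"
    and EL: "\<And>U \<phi> x. local_param M \<mu> U \<phi> \<Longrightarrow> x \<in> U \<Longrightarrow>
      \<exists>k. immersed_chart.lap (\<mu> \<circ> \<phi>) (f \<circ> \<phi>) x = k *\<^sub>R f (\<phi> x)"
  shows "((\<lambda>t. energy M \<mu> D (F t)) has_real_derivative 0) (at 0)"
proof -
  let ?V = "riemannian_measure M \<mu>" and ?v = "variation_field F"
  have 0: "0 \<in> I" using eps by simp
  define Q where "Q p U \<phi> \<rho> K T \<longleftrightarrow> local_param M \<mu> U \<phi> \<and> smooth_map M \<mu> \<rho> \<and> (\<forall>q. 0 \<le> \<rho> q) \<and> compact K \<and> K \<subseteq> U \<and>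
      (\<forall>q\<in>M - \<phi> ` K. \<rho> q = (0::real)) \<and> open T \<and> p \<in> T \<and> (\<forall>q\<in>M \<inter> T. 0 < \<rho> q)" for p U \<phi> \<rho> K T
  have "\<exists>U \<phi> \<rho> K T. Q p U \<phi> \<rho> K T" if p: "p \<in> M" for p
  proof -
    obtain U \<phi> x where \<phi>: "local_param M \<mu> U \<phi>" and x: "x \<in> U" "\<phi> x = p" using ex_chart p by blast
    obtain \<rho> :: "'m \<Rightarrow> real" and K where \<rho>: "smooth_map M \<mu> \<rho>" "\<And>q. 0 \<le> \<rho> q" "\<And>q. \<rho> q \<le> 1" "\<rho> (\<phi> x) > 0"
      "compact K" "K \<subseteq> U" "\<And>q. q \<in> M - \<phi> ` K \<Longrightarrow> \<rho> q = 0"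
      using bump_function_exists[OF \<phi> x(1) local_paramD(1)[OF \<phi>] subset_refl] by blast
    have "openin (top_of_set M) (M \<inter> \<rho> -` {0<..})"
      by (rule continuous_openin_preimage_gen[OF continuous_on_smooth_map[OF M \<rho>(1)]]) simp
    then obtain T where T: "open T" "M \<inter> \<rho> -` {0<..} = M \<inter> T" by (auto simp: openin_open)
    have "p \<in> M \<inter> \<rho> -` {0<..}" using p \<rho>(4) x(2) by simp
    then have pT: "p \<in> T" unfolding T(2) by blast
    have pos: "0 < \<rho> q" if "q \<in> M \<inter> T" for q using that unfolding T(2)[symmetric] by simp
    show ?thesis
      unfolding Q_def
      by (intro exI[of _ U] exI[of _ \<phi>] exI[of _ \<rho>] exI[of _ K] exI[of _ T] conjI allI ballI
          \<phi> \<rho>(1,2,5,6,7) T(1) pT pos)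
  qed
  then obtain U \<phi> \<rho> K T where Q: "\<And>p. p \<in> M \<Longrightarrow> Q p (U p) (\<phi> p) (\<rho> p) (K p) (T p)" by metis
  have c1: "local_param M \<mu> (U p) (\<phi> p)" and c2: "smooth_map M \<mu> (\<rho> p)" and c3: "\<forall>q. 0 \<le> \<rho> p q"
    and c4: "compact (K p)" and c5: "K p \<subseteq> U p" and c6: "\<forall>q\<in>M - \<phi> p ` K p. \<rho> p q = 0"
    and c7: "open (T p)" and c8: "p \<in> T p" and c9: "\<forall>q\<in>M \<inter> T p. 0 < \<rho> p q" if "p \<in> M" for p
    using Q[OF that] unfolding Q_def by - (elim conjE, assumption)+
  note c = c1 c2 c3[THEN spec] c4 c5 c6[THEN bspec] c7 c8 c9[THEN bspec]
  obtain S where S: "S \<subseteq> D" "finite S" "D \<subseteq> (\<Union>p\<in>S. T p)"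
  proof (rule compactE_image[OF D(1), of D T])
    show "open (T p)" if "p \<in> D" for p using c7[of p] D(2) that by (simp add: subset_iff)
    show "D \<subseteq> (\<Union>p\<in>D. T p)" using c8 D(2) by blast
  qed
  have SM: "p \<in> M" if "p \<in> S" for p using that S(1) D(2) by blast
  define \<sigma> where "\<sigma> q = (\<Sum>p\<in>S. \<rho> p q)" for q
  have \<sigma>pos: "\<sigma> q > 0" if q: "q \<in> D" for q
  proof -
    obtain p where p: "p \<in> S" "q \<in> T p" using S(3) q by blast
    then have "0 < \<rho> p q" using c(9)[OF SM[OF p(1)]] q D(2) by blast
    also have "\<rho> p q \<le> \<sigma> q" unfolding \<sigma>_def by (rule member_le_sum[OF p(1) _ S(2)]) (use c(3) SM in auto)
    finally show ?thesis .
  qed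
  \<comment> \<open>outside \<open>D\<close>, where \<open>\<sigma>\<close> may vanish, the variation field is zero\<close>
  define w where "w p q = (\<rho> p q / \<sigma> q) *\<^sub>R ?v q" for p q
  have w_smooth: "smooth_map M \<mu> (w p)" if p: "p \<in> S" for p
    unfolding smooth_map_def
  proof (intro allI impI smooth_on_local)
    fix V \<psi> z assume \<psi>: "local_param M \<mu> V \<psi>" and z: "z \<in> V"
    note q = local_paramD[OF \<psi>]
    have s\<rho>: "smooth_on V (\<lambda>z. \<rho> p (\<psi> z))" if "p \<in> S" for p
      using smooth_map_compose[OF c(2)[OF SM[OF that]] \<psi>] by (simp add: o_def)
    have s\<sigma>: "smooth_on V (\<lambda>z. \<sigma> (\<psi> z))" unfolding \<sigma>_def by (intro smooth_on_sum q(1) s\<rho>)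
    have sv: "smooth_on V (\<lambda>z. ?v (\<psi> z))"
      using smooth_map_compose[OF smooth_map_variation_field \<psi>] by (simp add: o_def)
    show "\<exists>O'. open O' \<and> z \<in> O' \<and> smooth_on O' (w p \<circ> \<psi>)"
    proof (cases "\<psi> z \<in> D")
      case True
      let ?O = "V \<inter> (\<lambda>z. \<sigma> (\<psi> z)) -` {0<..}"
      have oO: "open ?O"
        by (rule continuous_open_preimage[OF smooth_on_imp_continuous_on[OF s\<sigma>] q(1)]) simp
      have "smooth_on ?O (\<lambda>z. (\<rho> p (\<psi> z) / \<sigma> (\<psi> z)) *\<^sub>R ?v (\<psi> z))"
        by (intro smooth_on_scaleR smooth_on_divide oO smooth_on_subset[OF s\<rho>[OF p]] smooth_on_subset[OF s\<sigma>]
            smooth_on_subset[OF sv]) auto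
      then show ?thesis using oO z \<sigma>pos[OF True] by (intro exI[of _ ?O]) (auto simp: w_def[abs_def] o_def)
    next
      case False
      let ?O = "V \<inter> \<psi> -` (- D)"
      have oO: "open ?O"
        using compact_imp_closed[OF D(1)] by (intro continuous_open_preimage[OF q(4,1)]) auto
      have "smooth_on ?O (w p \<circ> \<psi>)"
        by (rule smooth_on_cong[OF smooth_on_const[of _ 0] oO])
           (use variation_field_outside q(7) in \<open>auto simp: w_def\<close>)
      then show ?thesis using oO z False by blast
    qed
  qed
  have sum_w: "?v q = (\<Sum>p\<in>S. w p q)" if "q \<in> M" for q
  proof (cases "q \<in> D")
    case True
    have "(\<Sum>p\<in>S. w p q) = ((\<Sum>p\<in>S. \<rho> p q) / \<sigma> q) *\<^sub>R ?v q"
      by (simp add: w_def scaleR_sum_left sum_divide_distrib)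
    then show ?thesis using \<sigma>pos[OF True] by (simp add: \<sigma>_def)
  next
    case False
    then show ?thesis using variation_field_outside that by (simp add: w_def)
  qed
  have zero: "(LINT q:D|?V. dirichlet_form M \<mu> f (w p) q) = 0" if p: "p \<in> S" for p
  proof -
    note q = local_paramD[OF c(1)[OF SM[OF p]]]
    define K' where "K' = K p \<inter> \<phi> p -` D"
    have "closedin (top_of_set (K p)) (K p \<inter> \<phi> p -` D)"
      by (rule continuous_closedin_preimage[OF continuous_on_subset[OF q(4) c(5)[OF SM[OF p]]] compact_imp_closed[OF D(1)]])
    then have K': "compact K'" using closedin_compact[OF c(4)[OF SM[OF p]]] by (simp add: K'_def)
    have K'U: "K' \<subseteq> U p" using c(5)[OF SM[OF p]] by (auto simp: K'_def)
    have w0: "w p q = 0" if "q \<in> M - \<phi> p ` K'" for q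
      using that c(6)[OF SM[OF p], of q] variation_field_outside[of q] by (cases "q \<in> D") (auto simp: w_def K'_def)
    have "(LINT q:D|?V. dirichlet_form M \<mu> f (w p) q) =
      - (LINT x:K'|lborel. immersed_chart.vol (\<mu> \<circ> \<phi> p) x * (immersed_chart.lap (\<mu> \<circ> \<phi> p) (f \<circ> \<phi> p) x \<bullet> w p (\<phi> p x)))"
      by (rule weak_laplacian[OF M f w_smooth[OF p] c(1)[OF SM[OF p]] K' K'U _ w0]) (auto simp: K'_def)
    also have "(LINT x:K'|lborel. immersed_chart.vol (\<mu> \<circ> \<phi> p) x * (immersed_chart.lap (\<mu> \<circ> \<phi> p) (f \<circ> \<phi> p) x \<bullet> w p (\<phi> p x))) =
        (LINT x:K'|lborel. 0)"
      unfolding set_lebesgue_integral_def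
    proof (rule Bochner_Integration.integral_cong[OF refl])
      fix x
      have "immersed_chart.lap (\<mu> \<circ> \<phi> p) (f \<circ> \<phi> p) x \<bullet> w p (\<phi> p x) = 0" if "x \<in> K'"
      proof -
        have xU: "x \<in> U p" "\<phi> p x \<in> M" using that K'U q(7) by auto
        obtain k where "immersed_chart.lap (\<mu> \<circ> \<phi> p) (f \<circ> \<phi> p) x = k *\<^sub>R f (\<phi> p x)"
          using EL[OF c(1)[OF SM[OF p]] xU(1)] by blast
        then show ?thesis using variation_field_orthogonal[OF xU(2)] by (simp add: w_def inner_commute)
      qed
      then show "indicator K' x *\<^sub>R (immersed_chart.vol (\<mu> \<circ> \<phi> p) x *
          (immersed_chart.lap (\<mu> \<circ> \<phi> p) (f \<circ> \<phi> p) x \<bullet> w p (\<phi> p x))) = indicator K' x *\<^sub>R 0"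
        by (cases "x \<in> K'") auto
    qed
    finally show ?thesis by (simp add: set_lebesgue_integral_def)
  qed
  have "(LINT q:D|?V. dirichlet_form M \<mu> (F 0) ?v q) = (LINT q:D|?V. (\<Sum>p\<in>S. dirichlet_form M \<mu> f (w p) q))"
    unfolding set_lebesgue_integral_def
  proof (rule Bochner_Integration.integral_cong[OF refl])
    fix q assume "q \<in> space ?V"
    then have q: "q \<in> M" by (simp add: riemannian_measure_properties(1)[OF M])
    have "dirichlet_form M \<mu> (F 0) ?v q = dirichlet_form M \<mu> f ?v q"
      by (rule dirichlet_form_cong_left[OF M smooth_map_F[OF 0] f smooth_map_variation_field F0 q])
    also have "\<dots> = (\<Sum>p\<in>S. dirichlet_form M \<mu> f (w p) q)"
      by (rule dirichlet_form_sum_right[OF M f smooth_map_variation_field w_smooth sum_w q])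
    finally show "indicator D q *\<^sub>R dirichlet_form M \<mu> (F 0) ?v q =
        indicator D q *\<^sub>R (\<Sum>p\<in>S. dirichlet_form M \<mu> f (w p) q)" by simp
  qed
  also have "\<dots> = (\<Sum>p\<in>S. (LINT q:D|?V. dirichlet_form M \<mu> f (w p) q))"
    unfolding set_lebesgue_integral_def scaleR_sum_right
    by (rule Bochner_Integration.integral_sum)
       (use set_integrable_continuous_on[OF M D continuous_on_dirichlet_form[OF M f w_smooth]] in \<open>simp add: set_integrable_def\<close>)
  also have "\<dots> = 0" using zero by simp
  finally show ?thesis using first_variation by simp
qed

text \<open>The converse direction perturbs \<open>f\<close> by a bump function times a constant vector \<open>w\<close> and
  projects back to the sphere; the variation field is the part of \<open>\<rho> w\<close> orthogonal to \<open>f\<close>.\<close>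

lemma projected_variation:
  fixes f :: "'m::{t2_space,second_countable_topology} \<Rightarrow> 'c::euclidean_space" and \<mu> :: "'m \<Rightarrow> real ^ ('n::finite + 2)"
    and w :: 'c
  assumes f: "smooth_map M \<mu> f" "f ` M \<subseteq> sphere 0 1" and \<rho>: "smooth_map M \<mu> \<rho>" "\<And>p. \<bar>\<rho> p\<bar> \<le> 1" "\<And>p. p \<in> M - D \<Longrightarrow> \<rho> p = 0"
  defines "F \<equiv> \<lambda>t p. inverse (sqrt ((f p + (t * \<rho> p) *\<^sub>R w) \<bullet> (f p + (t * \<rho> p) *\<^sub>R w))) *\<^sub>R (f p + (t * \<rho> p) *\<^sub>R w)"
  shows "sphere_variation M \<mu> D f (1 / (norm w + 1)) F"
    and "p \<in> M \<Longrightarrow> variation_field F p = \<rho> p *\<^sub>R (w - (w \<bullet> f p) *\<^sub>R f p)"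
proof -
  let ?\<epsilon> = "1 / (norm w + 1)"
  have nw: "norm w + 1 > 0" by (smt (verit) norm_ge_zero)
  then have eps: "?\<epsilon> > 0" by simp
  have f1: "norm (f p) = 1" if "p \<in> M" for p using f(2) that by auto
  \<comment> \<open>for these \<open>t\<close> the perturbation of the unit vector \<open>f p\<close> has norm less than one\<close>
  have pos: "(f p + (t * \<rho> p) *\<^sub>R w) \<bullet> (f p + (t * \<rho> p) *\<^sub>R w) > 0" if t: "t \<in> {-?\<epsilon><..<?\<epsilon>}" and p: "p \<in> M" for t p
  proof -
    have "\<bar>t * \<rho> p\<bar> \<le> \<bar>t\<bar>" using \<rho>(2)[of p] by (simp add: abs_mult mult_left_le)
    then have "norm ((t * \<rho> p) *\<^sub>R w) \<le> \<bar>t\<bar> * norm w" by (simp add: mult_right_mono)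
    also have "\<dots> \<le> \<bar>t\<bar> * (norm w + 1)" by (intro mult_left_mono) auto
    also have "\<dots> < ?\<epsilon> * (norm w + 1)" using t nw by (intro mult_strict_right_mono) (auto simp: abs_less_iff)
    also have "\<dots> = 1" using nw by simp
    finally have "f p + (t * \<rho> p) *\<^sub>R w \<noteq> 0" using f1[OF p] by (metis add_eq_0_iff norm_minus_cancel less_irrefl)
    then show ?thesis by simp
  qed
  show "sphere_variation M \<mu> D f ?\<epsilon> F"
    unfolding sphere_variation_def
  proof (intro conjI allI impI ballI eps)
    fix U \<phi> assume \<phi>: "local_param M \<mu> U \<phi>"
    note q = local_paramD[OF \<phi>]
    let ?J = "{-?\<epsilon><..<?\<epsilon>} \<times> U"
    have oJ: "open ?J" using q(1) by (intro open_Times) auto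
    have snd: "smooth_on ?J snd" "snd ` ?J \<subseteq> U"
      by (auto intro: smooth_on_bounded_linear[OF oJ bounded_linear_snd])
    have sf: "smooth_on ?J (\<lambda>z. f (\<phi> (snd z)))"
      using smooth_on_compose[OF oJ snd(1) smooth_map_compose[OF f(1) \<phi>] snd(2)] by simp
    have s\<rho>: "smooth_on ?J (\<lambda>z. \<rho> (\<phi> (snd z)))"
      using smooth_on_compose[OF oJ snd(1) smooth_map_compose[OF \<rho>(1) \<phi>] snd(2)] by simp
    have st: "smooth_on ?J (fst :: real \<times> (real ^ 'n) \<Rightarrow> real)" by (rule smooth_on_bounded_linear[OF oJ bounded_linear_fst])
    have "smooth_on ?J (\<lambda>z. F (fst z) (\<phi> (snd z)))"
      unfolding F_def
    proof (intro smooth_on_scaleR smooth_on_inverse smooth_on_sqrt smooth_on_inner smooth_on_add smooth_on_mult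
        oJ sf s\<rho> st smooth_on_const)
      fix z assume z: "z \<in> ?J"
      then have z': "fst z \<in> {-?\<epsilon><..<?\<epsilon>}" "\<phi> (snd z) \<in> M" using q(7) by auto
      show "0 < (f (\<phi> (snd z)) + (fst z * \<rho> (\<phi> (snd z))) *\<^sub>R w) \<bullet> (f (\<phi> (snd z)) + (fst z * \<rho> (\<phi> (snd z))) *\<^sub>R w)"
        by (rule pos[OF z'])
      then show "sqrt ((f (\<phi> (snd z)) + (fst z * \<rho> (\<phi> (snd z))) *\<^sub>R w) \<bullet> (f (\<phi> (snd z)) + (fst z * \<rho> (\<phi> (snd z))) *\<^sub>R w)) \<noteq> 0"
        by simp
    qed
    then show "smooth_on ?J (\<lambda>(t, x). F t (\<phi> x))" by (simp add: case_prod_beta')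
  next
    fix t assume t: "t \<in> {-?\<epsilon><..<?\<epsilon>}"
    have "norm (F t p) = 1" if "p \<in> M" for p
      using pos[OF t that] by (simp add: F_def norm_eq_sqrt_inner[symmetric])
    then show "F t ` M \<subseteq> sphere 0 1" by auto
    show "F t p = f p" if "p \<in> M - D" for p
      using \<rho>(3)[OF that] f1[of p] that by (simp add: F_def norm_eq_sqrt_inner[symmetric])
  next
    show "F 0 p = f p" if "p \<in> M" for p using f1[OF that] by (simp add: F_def norm_eq_sqrt_inner[symmetric])
  qed
  assume p: "p \<in> M"
  have ff: "f p \<bullet> f p = 1" using f1[OF p] by (simp add: norm_eq_1)
  let ?u = "\<lambda>t. f p + (t * \<rho> p) *\<^sub>R w"
  have u: "(?u has_vector_derivative \<rho> p *\<^sub>R w) (at 0)"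
    unfolding has_vector_derivative_def by (auto intro!: derivative_eq_intros)
  have N: "((\<lambda>t. ?u t \<bullet> ?u t) has_real_derivative 2 * \<rho> p * (w \<bullet> f p)) (at 0)"
    unfolding has_field_derivative_def
    by (rule has_derivative_eq_rhs[OF has_derivative_inner[OF u[unfolded has_vector_derivative_def] u[unfolded has_vector_derivative_def]]])
       (simp add: fun_eq_iff inner_commute algebra_simps)
  have g: "((\<lambda>s. inverse (sqrt s)) has_real_derivative - (1/2)) (at (?u 0 \<bullet> ?u 0))"
    using ff by (auto intro!: derivative_eq_intros)
  have "((\<lambda>t. inverse (sqrt (?u t \<bullet> ?u t))) has_real_derivative - (1/2) * (2 * \<rho> p * (w \<bullet> f p))) (at 0)"
    by (rule DERIV_chain2[OF g N])
  then have "((\<lambda>t. F t p) has_vector_derivative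
      inverse (sqrt (?u 0 \<bullet> ?u 0)) *\<^sub>R (\<rho> p *\<^sub>R w) + (- (1/2) * (2 * \<rho> p * (w \<bullet> f p))) *\<^sub>R ?u 0) (at 0)"
    unfolding F_def by (rule has_vector_derivative_scaleR[OF _ u])
  then have "variation_field F p = inverse (sqrt (?u 0 \<bullet> ?u 0)) *\<^sub>R (\<rho> p *\<^sub>R w) + (- (1/2) * (2 * \<rho> p * (w \<bullet> f p))) *\<^sub>R ?u 0"
    unfolding variation_field_def by (rule vector_derivative_at)
  then show "variation_field F p = \<rho> p *\<^sub>R (w - (w \<bullet> f p) *\<^sub>R f p)"
    using ff by (simp add: algebra_simps)
qed

lemma set_integral_pos:
  fixes h :: "real ^ 'n::finite \<Rightarrow> real"
  assumes K: "compact K" "continuous_on K h" "\<And>x. x \<in> K \<Longrightarrow> 0 \<le> h x"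
    and S: "open S" "S \<subseteq> K" "S \<noteq> {}" "\<And>x. x \<in> S \<Longrightarrow> 0 < h x"
  shows "(LINT x:K|lborel. h x) \<noteq> 0"
proof
  assume 0: "(LINT x:K|lborel. h x) = 0"
  have int: "integrable lborel (\<lambda>x. indicator K x *\<^sub>R h x)"
    by (rule borel_integrable_compact[OF K(1,2)])
  have "AE x in lborel. indicator K x *\<^sub>R h x = 0"
    using integral_nonneg_eq_0_iff_AE[OF int] 0 K(3) by (auto simp: set_lebesgue_integral_def indicator_def)
  moreover have "indicator K x *\<^sub>R h x \<noteq> 0" if "x \<in> S" for x using S(2) S(4)[OF that] that by auto
  ultimately have "AE x in lborel. x \<notin> S" by (auto elim: eventually_mono)
  then have "S \<in> null_sets lborel" using S(1) by (simp add: AE_iff_null_sets)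
  then have "negligible S" by (simp add: negligible_iff_null_sets null_sets_completionI)
  then show False using open_not_negligible S(1,3) by blast
qed

text \<open>If \<open>\<Delta>f\<close> had a component \<open>w\<close> orthogonal to \<open>f\<close> at some point, then the variation in the direction
  of \<open>w\<close>, supported where \<open>\<Delta>f\<close> and the part of \<open>w\<close> orthogonal to \<open>f\<close> have positive inner product,
  would change the energy to first order.\<close>

theorem harmonic_map_iff_euler_lagrange:
  fixes f :: "'m::{t2_space,second_countable_topology} \<Rightarrow> 'c::euclidean_space" and \<mu> :: "'m \<Rightarrow> real ^ ('n::finite + 2)"
  assumes M: "sphere_hypersurface M \<mu>" and f: "smooth_map M \<mu> f" "f ` M \<subseteq> sphere 0 1"
  shows "harmonic_map M \<mu> f \<longleftrightarrow> (\<forall>U \<phi>. local_param M \<mu> U \<phi> \<longrightarrow> (\<forall>x\<in>U.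
    immersed_chart.lap (\<mu> \<circ> \<phi>) (f \<circ> \<phi>) x = (immersed_chart.lap (\<mu> \<circ> \<phi>) (f \<circ> \<phi>) x \<bullet> f (\<phi> x)) *\<^sub>R f (\<phi> x)))"
proof
  assume EL: "\<forall>U \<phi>. local_param M \<mu> U \<phi> \<longrightarrow> (\<forall>x\<in>U.
    immersed_chart.lap (\<mu> \<circ> \<phi>) (f \<circ> \<phi>) x = (immersed_chart.lap (\<mu> \<circ> \<phi>) (f \<circ> \<phi>) x \<bullet> f (\<phi> x)) *\<^sub>R f (\<phi> x))"
  show "harmonic_map M \<mu> f"
    unfolding harmonic_map_def
  proof (intro conjI f allI impI)
    fix D \<epsilon> F assume a: "compact D \<and> D \<subseteq> M \<and> sphere_variation M \<mu> D f \<epsilon> F"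
    interpret variation M \<mu> D f \<epsilon> F by unfold_locales (use M a in auto)
    show "((\<lambda>t. energy M \<mu> D (F t)) has_real_derivative 0) (at 0)"
      by (rule euler_lagrange_imp_critical[OF f(1)]) (use EL in blast)
  qed
next
  assume harm: "harmonic_map M \<mu> f"
  show "\<forall>U \<phi>. local_param M \<mu> U \<phi> \<longrightarrow> (\<forall>x\<in>U.
    immersed_chart.lap (\<mu> \<circ> \<phi>) (f \<circ> \<phi>) x = (immersed_chart.lap (\<mu> \<circ> \<phi>) (f \<circ> \<phi>) x \<bullet> f (\<phi> x)) *\<^sub>R f (\<phi> x))"
  proof (intro allI impI ballI)
    fix U \<phi> x0 assume \<phi>: "local_param M \<mu> U \<phi>" and x0: "x0 \<in> U"
    interpret immersed_chart U "\<mu> \<circ> \<phi>" by (rule immersed_chart_local_param[OF \<phi>])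
    note q = local_paramD[OF \<phi>]
    have sf: "smooth_on U (\<lambda>x. f (\<phi> x))" using smooth_map_compose[OF f(1) \<phi>] by (simp add: o_def)
    let ?L = "lap (f \<circ> \<phi>)"
    have sL: "smooth_on U ?L"
      unfolding lap_def by (intro smooth_intros open_U smooth_E smooth_y smooth_map_compose[OF f(1) \<phi>])
    define w where "w = ?L x0 - (?L x0 \<bullet> f (\<phi> x0)) *\<^sub>R f (\<phi> x0)"
    show "?L x0 = (?L x0 \<bullet> f (\<phi> x0)) *\<^sub>R f (\<phi> x0)"
    proof (rule ccontr)
      assume "\<not> ?thesis"
      then have w: "w \<noteq> 0" by (simp add: w_def)
      define \<psi> where "\<psi> x = ?L x \<bullet> (w - (w \<bullet> f (\<phi> x)) *\<^sub>R f (\<phi> x))" for x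
      have s\<psi>: "smooth_on U \<psi>" unfolding \<psi>_def by (intro smooth_intros open_U sL sf)
      have ff: "f (\<phi> x0) \<bullet> f (\<phi> x0) = 1" 
      proof -
        have "\<phi> x0 \<in> M" using q(7) x0 by blast
        then have "norm (f (\<phi> x0)) = 1" using f(2) by auto
        then show ?thesis by (simp add: norm_eq_1)
      qed
      have "\<psi> x0 = w \<bullet> w"
        by (simp add: \<psi>_def w_def inner_diff_left inner_diff_right inner_commute ff)
      then have \<psi>0: "\<psi> x0 > 0" using w by simp
      let ?W = "U \<inter> \<psi> -` {0<..}"
      have W: "open ?W" by (rule continuous_open_preimage[OF smooth_on_imp_continuous_on[OF s\<psi>] open_U]) simp
      have x0W: "x0 \<in> ?W" using x0 \<psi>0 by simp
      obtain \<rho> :: "'m \<Rightarrow> real" and K where \<rho>: "smooth_map M \<mu> \<rho>" "\<And>q. 0 \<le> \<rho> q" "\<And>q. \<rho> q \<le> 1" "\<rho> (\<phi> x0) > 0"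
        "compact K" "K \<subseteq> ?W" "\<And>q. q \<in> M - \<phi> ` K \<Longrightarrow> \<rho> q = 0"
        using bump_function_exists[OF \<phi> x0W W Int_lower1] by blast
      have KU: "K \<subseteq> U" using \<rho>(6) by blast
      have s\<rho>: "smooth_on U (\<lambda>x. \<rho> (\<phi> x))" using smooth_map_compose[OF \<rho>(1) \<phi>] by (simp add: o_def)
      let ?D = "\<phi> ` K"
      have D: "compact ?D" "?D \<subseteq> M"
        using compact_continuous_image[OF continuous_on_subset[OF q(4) KU] \<rho>(5)] q(7) KU by auto
      have \<rho>1: "\<bar>\<rho> p\<bar> \<le> 1" for p using \<rho>(2,3)[of p] by simp
      define F where "F = (\<lambda>t p. inverse (sqrt ((f p + (t * \<rho> p) *\<^sub>R w) \<bullet> (f p + (t * \<rho> p) *\<^sub>R w))) *\<^sub>R (f p + (t * \<rho> p) *\<^sub>R w))"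
      note pv = projected_variation[where D = ?D and w = w, OF f \<rho>(1) \<rho>1 \<rho>(7), folded F_def]
      interpret v: variation M \<mu> ?D f "1 / (norm w + 1)" F
        by unfold_locales (use M D pv(1) in auto)
      have "((\<lambda>t. energy M \<mu> ?D (F t)) has_real_derivative 0) (at 0)"
        using harm D pv(1) unfolding harmonic_map_def by blast
      then have "(LINT p:?D|riemannian_measure M \<mu>. dirichlet_form M \<mu> (F 0) (variation_field F) p) = 0"
        by (auto dest: DERIV_unique[OF v.first_variation])
      moreover have "(LINT p:?D|riemannian_measure M \<mu>. dirichlet_form M \<mu> (F 0) (variation_field F) p) =
          (LINT p:?D|riemannian_measure M \<mu>. dirichlet_form M \<mu> f (variation_field F) p)"
        unfolding set_lebesgue_integral_def
      proof (rule Bochner_Integration.integral_cong[OF refl])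
        fix p assume "p \<in> space (riemannian_measure M \<mu>)"
        then have p: "p \<in> M" by (simp add: riemannian_measure_properties(1)[OF M])
        have "0 \<in> v.I" using v.eps by simp
        then show "indicator ?D p *\<^sub>R dirichlet_form M \<mu> (F 0) (variation_field F) p =
            indicator ?D p *\<^sub>R dirichlet_form M \<mu> f (variation_field F) p"
          using dirichlet_form_cong_left[OF M v.smooth_map_F f(1) v.smooth_map_variation_field v.F0 p] by simp
      qed
      moreover have "(LINT p:?D|riemannian_measure M \<mu>. dirichlet_form M \<mu> f (variation_field F) p) =
          - (LINT x:K|lborel. vol x * (?L x \<bullet> variation_field F (\<phi> x)))"
        by (rule weak_laplacian[OF M f(1) v.smooth_map_variation_field \<phi> \<rho>(5) KU subset_refl v.variation_field_outside])
      moreover have "(LINT x:K|lborel. vol x * (?L x \<bullet> variation_field F (\<phi> x))) = (LINT x:K|lborel. vol x * (\<rho> (\<phi> x) * \<psi> x))"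
        unfolding set_lebesgue_integral_def
      proof (rule Bochner_Integration.integral_cong[OF refl])
        fix x
        show "indicator K x *\<^sub>R (vol x * (?L x \<bullet> variation_field F (\<phi> x))) = indicator K x *\<^sub>R (vol x * (\<rho> (\<phi> x) * \<psi> x))"
          using pv(2)[of "\<phi> x"] D(2) by (cases "x \<in> K") (auto simp: \<psi>_def)
      qed
      moreover have "(LINT x:K|lborel. vol x * (\<rho> (\<phi> x) * \<psi> x)) \<noteq> 0"
      proof (rule set_integral_pos[OF \<rho>(5)])
        have "smooth_on U (\<lambda>x. vol x * (\<rho> (\<phi> x) * \<psi> x))" by (intro smooth_intros open_U smooth_vol s\<rho> s\<psi>)
        then show "continuous_on K (\<lambda>x. vol x * (\<rho> (\<phi> x) * \<psi> x))"
          using smooth_on_imp_continuous_on continuous_on_subset KU by blast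
        show "0 \<le> vol x * (\<rho> (\<phi> x) * \<psi> x)" if "x \<in> K" for x
          using that \<rho>(2,6) KU vol_pos[of x] by (intro mult_nonneg_nonneg) (auto simp: subset_iff less_imp_le)
        let ?S = "U \<inter> (\<lambda>x. \<rho> (\<phi> x)) -` {0<..}"
        show "open ?S" by (rule continuous_open_preimage[OF smooth_on_imp_continuous_on[OF s\<rho>] open_U]) simp
        show SK: "?S \<subseteq> K"
        proof
          fix x assume x: "x \<in> ?S"
          then have "\<phi> x \<in> \<phi> ` K" using \<rho>(7)[of "\<phi> x"] q(7) by auto
          then show "x \<in> K" using q(3) x KU by (auto simp: inj_on_def subset_iff)
        qed
        show "?S \<noteq> {}" using x0 \<rho>(4) by auto
        show "0 < vol x * (\<rho> (\<phi> x) * \<psi> x)" if "x \<in> ?S" for x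
          using that SK \<rho>(6) vol_pos[of x] by (intro mult_pos_pos) auto
      qed
      ultimately show False by simp
    qed
  qed
qed

section \<open>Gauss maps of hypersurfaces of the sphere\<close>

lemma hypersurface_chart_local_param:
  fixes \<mu> :: "'m::{t2_space,second_countable_topology} \<Rightarrow> real ^ ('n::finite + 2)"
  assumes M: "sphere_hypersurface M \<mu>" and \<nu>: "unit_normal_section_in_sphere M \<mu> \<nu>" and \<phi>: "local_param M \<mu> U \<phi>"
  shows "hypersurface_chart U (\<mu> \<circ> \<phi>) (\<nu> \<circ> \<phi>)"
proof (intro hypersurface_chart.intro immersed_chart_local_param[OF \<phi>] hypersurface_chart_axioms.intro)
  note q = local_paramD[OF \<phi>]
  show "DIM(real ^ ('n + 2)) = CARD('n) + 2" by simp
  have sm: "smooth_map M \<mu> \<nu>" and n1: "\<And>p. p \<in> M \<Longrightarrow> norm (\<nu> p) = 1"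
    and nT: "\<And>p X. p \<in> M \<Longrightarrow> X \<in> tangent_space M \<mu> p \<Longrightarrow> orthogonal (\<nu> p) X"
    and n\<mu>: "\<And>p. p \<in> M \<Longrightarrow> orthogonal (\<nu> p) (\<mu> p)"
    using \<nu> by (auto simp: unit_normal_section_in_sphere_def unit_normal_section_def)
  show "smooth_on U (\<nu> \<circ> \<phi>)" by (rule smooth_map_compose[OF sm \<phi>])
  fix x assume x: "x \<in> U"
  then have p: "\<phi> x \<in> M" using q(7) by blast
  have "norm (\<mu> (\<phi> x)) = 1" using M p by (auto simp: sphere_hypersurface_def)
  then show "(\<mu> \<circ> \<phi>) x \<bullet> (\<mu> \<circ> \<phi>) x = 1" by (simp add: norm_eq_1)
  show "(\<nu> \<circ> \<phi>) x \<bullet> (\<nu> \<circ> \<phi>) x = 1" using n1[OF p] by (simp add: norm_eq_1)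
  show "(\<nu> \<circ> \<phi>) x \<bullet> (\<mu> \<circ> \<phi>) x = 0" using n\<mu>[OF p] by (simp add: orthogonal_def)
  fix i
  have "pd (\<mu> \<circ> \<phi>) i x \<in> tangent_space M \<mu> (\<phi> x)"
    unfolding tangent_space_chart[OF \<phi> x] by (intro span_base) blast
  then show "(\<nu> \<circ> \<phi>) x \<bullet> pd (\<mu> \<circ> \<phi>) i x = 0" using nT[OF p] by (simp add: orthogonal_def)
qed

lemma shape_operator_chart:
  fixes \<mu> :: "'m::{t2_space,second_countable_topology} \<Rightarrow> real ^ ('n::finite + 2)"
  assumes M: "sphere_hypersurface M \<mu>" and \<nu>: "unit_normal_section_in_sphere M \<mu> \<nu>" and \<phi>: "local_param M \<mu> U \<phi>"
    and x: "x \<in> U"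
  shows "X \<in> tangent_space M \<mu> (\<phi> x) \<Longrightarrow> shape_operator M \<mu> \<nu> (\<phi> x) X = - dmap M \<mu> \<nu> (\<phi> x) X"
    and "real CARD('n) * mean_curvature M \<mu> \<nu> (\<phi> x) = - hypersurface_chart.trA (\<mu> \<circ> \<phi>) (\<nu> \<circ> \<phi>) x"
    and "(shape_norm M \<mu> \<nu> (\<phi> x))\<^sup>2 = hypersurface_chart.sqA (\<mu> \<circ> \<phi>) (\<nu> \<circ> \<phi>) x"
proof -
  interpret hypersurface_chart U "\<mu> \<circ> \<phi>" "\<nu> \<circ> \<phi>" by (rule hypersurface_chart_local_param[OF M \<nu> \<phi>])
  have sm: "smooth_map M \<mu> \<nu>" using \<nu> by (simp add: unit_normal_section_in_sphere_def unit_normal_section_def)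
  let ?T = "tangent_space M \<mu> (\<phi> x)"
  note T = tangent_space_chart[OF \<phi> x]
  have onbT: "onb ?T \<subseteq> ?T" by (rule onb_properties(1)[OF subspace_tangent_space[OF \<phi> x]])
  show shape: "shape_operator M \<mu> \<nu> (\<phi> x) X = - dmap M \<mu> \<nu> (\<phi> x) X" if "X \<in> ?T" for X
  proof -
    obtain c where c: "X = (\<Sum>i\<in>UNIV. c i *\<^sub>R pd (\<mu> \<circ> \<phi>) i x)"
      using \<open>X \<in> ?T\<close> unfolding T by (rule span_range_frame)
    have "dmap M \<mu> \<nu> (\<phi> x) X = (\<Sum>i\<in>UNIV. c i *\<^sub>R pd (\<nu> \<circ> \<phi>) i x)"
      unfolding c dmap_frame(2)[OF \<phi> x sm] by (simp add: dmap_frame(1)[OF \<phi> x sm])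
    then have "\<mu> (\<phi> x) \<bullet> dmap M \<mu> \<nu> (\<phi> x) X = 0"
      using first_order_relations(3)[OF x] by (simp add: inner_sum_right)
    then have "dmap M \<mu> \<nu> (\<phi> x) X \<in> orthogonal_comp {\<mu> (\<phi> x)}"
      by (simp add: orthogonal_comp_def orthogonal_def inner_commute)
    then show ?thesis
      unfolding shape_operator_def sphere_connection_def
      by (subst orth_proj_ident[OF subspace_orthogonal_comp]) auto
  qed
  have "trace_on ?T (shape_operator M \<mu> \<nu> (\<phi> x)) = - (\<Sum>b\<in>onb ?T. dmap M \<mu> \<nu> (\<phi> x) b \<bullet> b)"
    unfolding trace_on_def sum_negf[symmetric] using onbT by (intro sum.cong refl) (auto simp: shape)
  also have "(\<Sum>b\<in>onb ?T. dmap M \<mu> \<nu> (\<phi> x) b \<bullet> b) = trA x"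
    by (subst onb_trace_in_frame[OF frame_indep[OF x] T dmap_frame(2)[OF \<phi> x sm]])
       (simp add: trA_def dmap_frame(1)[OF \<phi> x sm] inner_commute)
  finally show "real CARD('n) * mean_curvature M \<mu> \<nu> (\<phi> x) = - trA x"
    by (simp add: mean_curvature_def)
  have "(shape_norm M \<mu> \<nu> (\<phi> x))\<^sup>2 = (\<Sum>b\<in>onb ?T. (norm (shape_operator M \<mu> \<nu> (\<phi> x) b))\<^sup>2)"
    unfolding shape_norm_def hs_norm_def by (rule real_sqrt_pow2) (simp add: sum_nonneg)
  also have "\<dots> = dirichlet_form M \<mu> \<nu> \<nu> (\<phi> x)"
    unfolding dirichlet_form_def using onbT by (intro sum.cong refl) (auto simp: shape power2_norm_eq_inner)
  also have "\<dots> = sqA x"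
    by (simp add: dirichlet_form_chart[OF \<phi> x sm sm] chart_form_def sqA_def)
  finally show "(shape_norm M \<mu> \<nu> (\<phi> x))\<^sup>2 = sqA x" .
qed

lemma (in immersed_chart) lap_cong:
  assumes f: "smooth_on U f" and eq: "\<And>z. z \<in> U \<Longrightarrow> f z = g z" and x: "x \<in> U"
  shows "lap f x = lap g x"
proof -
  have 1: "pd f i z = pd g i z" if "z \<in> U" for i z by (rule pd_cong[OF open_U that eq f])
  have "pd (pd f i) j x = pd (pd g i) j x" for i j by (rule pd_cong[OF open_U x 1 smooth_on_pd[OF f]])
  then show ?thesis unfolding lap_def using 1[OF x] by simp
qed

text \<open>The pointwise Euler-Lagrange equations of all charts, put together and rewritten in terms of the
  mean curvature and the second fundamental form; \<open>s\<close> and \<open>c\<close> are the sine and the cosine of the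
  angle.\<close>

lemma harmonic_gauss_map_iff:
  fixes \<mu> :: "'m::{t2_space,second_countable_topology} \<Rightarrow> real ^ ('n::finite + 2)"
  assumes M: "sphere_hypersurface M \<mu>" and \<nu>: "unit_normal_section_in_sphere M \<mu> \<nu>"
    and \<eta>: "smooth_map M \<mu> \<eta>" "\<And>p. p \<in> M \<Longrightarrow> \<eta> p = s *\<^sub>R \<nu> p + c *\<^sub>R \<mu> p" and sc: "s\<^sup>2 + c\<^sup>2 = 1"
  shows "harmonic_map M \<mu> \<eta> \<longleftrightarrow>
    (\<forall>U \<phi>. local_param M \<mu> U \<phi> \<longrightarrow> (\<forall>x\<in>U. \<forall>l. s * pd (\<lambda>x. mean_curvature M \<mu> \<nu> (\<phi> x)) l x = 0)) \<and>
    (\<forall>p\<in>M. s * c * ((shape_norm M \<mu> \<nu> p)\<^sup>2 - real CARD('n)) = (c\<^sup>2 - s\<^sup>2) * (real CARD('n) * mean_curvature M \<mu> \<nu> p))"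
proof -
  let ?H = "mean_curvature M \<mu> \<nu>" and ?n = "real CARD('n)"
  let ?E1 = "\<lambda>\<phi> x. \<forall>l. s * pd (\<lambda>x. ?H (\<phi> x)) l x = 0"
  let ?E2 = "\<lambda>p. s * c * ((shape_norm M \<mu> \<nu> p)\<^sup>2 - ?n) = (c\<^sup>2 - s\<^sup>2) * (?n * ?H p)"
  have \<eta>1: "\<eta> ` M \<subseteq> sphere 0 1"
  proof -
    have "norm (\<eta> p) = 1" if p: "p \<in> M" for p
    proof -
      obtain U \<phi> x where \<phi>: "local_param M \<mu> U \<phi>" "x \<in> U" "\<phi> x = p"
        using M p by (force simp: sphere_hypersurface_def)
      interpret hypersurface_chart U "\<mu> \<circ> \<phi>" "\<nu> \<circ> \<phi>" by (rule hypersurface_chart_local_param[OF M \<nu> \<phi>(1)])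
      show ?thesis
        using y_y[OF \<phi>(2)] nu_nu[OF \<phi>(2)] nu_y[OF \<phi>(2)] \<phi>(3) sc
        by (simp add: \<eta>(2)[OF p] norm_eq_1 inner_add_left inner_add_right inner_commute[of "\<mu> p" "\<nu> p"] power2_eq_square)
    qed
    then show ?thesis by auto
  qed
  have local: "immersed_chart.lap (\<mu> \<circ> \<phi>) (\<eta> \<circ> \<phi>) x = (immersed_chart.lap (\<mu> \<circ> \<phi>) (\<eta> \<circ> \<phi>) x \<bullet> \<eta> (\<phi> x)) *\<^sub>R \<eta> (\<phi> x)
      \<longleftrightarrow> ?E1 \<phi> x \<and> ?E2 (\<phi> x)" if \<phi>: "local_param M \<mu> U \<phi>" and x: "x \<in> U" for U \<phi> x
  proof -
    interpret hypersurface_chart U "\<mu> \<circ> \<phi>" "\<nu> \<circ> \<phi>" by (rule hypersurface_chart_local_param[OF M \<nu> \<phi>])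
    note q = local_paramD[OF \<phi>]
    let ?e = "\<lambda>x. s *\<^sub>R (\<nu> \<circ> \<phi>) x + c *\<^sub>R (\<mu> \<circ> \<phi>) x"
    have eq: "(\<eta> \<circ> \<phi>) z = ?e z" if "z \<in> U" for z using \<eta>(2) q(7) that by auto
    have lap_eq: "lap (\<eta> \<circ> \<phi>) x = lap ?e x"
      by (rule lap_cong[OF smooth_map_compose[OF \<eta>(1) \<phi>] eq x])
    have H: "?n * ?H (\<phi> z) = - trA z" if "z \<in> U" for z by (rule shape_operator_chart(2)[OF M \<nu> \<phi> that])
    have sT: "smooth_on U trA" unfolding trA_def by (intro smooth_intros open_U smooth_E smooth_nu)
    have "pd (\<lambda>x. ?H (\<phi> x)) l x = - (1 / ?n) * pd trA l x" for l
    proof -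
      have "pd (\<lambda>x. ?H (\<phi> x)) l x = pd (\<lambda>x. - (1 / ?n) * trA x) l x"
        by (rule pd_cong[OF open_U x, symmetric])
           (use H in \<open>auto simp: field_simps intro!: smooth_intros open_U sT\<close>)
      also have "\<dots> = - (1 / ?n) * pd trA l x"
        by (subst pd_mult[OF smooth_on_const sT x]) (simp add: pd_const)
      finally show ?thesis .
    qed
    then have 1: "?E1 \<phi> x \<longleftrightarrow> (\<forall>l. s * pd trA l x = 0)" by simp
    have 2: "?E2 (\<phi> x) \<longleftrightarrow> s * c * (?n - sqA x) = (c\<^sup>2 - s\<^sup>2) * trA x"
      unfolding H[OF x] shape_operator_chart(3)[OF M \<nu> \<phi> x] by (auto simp: algebra_simps)
    have e: "\<eta> (\<phi> x) = s *\<^sub>R (\<nu> \<circ> \<phi>) x + c *\<^sub>R (\<mu> \<circ> \<phi>) x" using eq[OF x] by (simp only: o_apply)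
    show ?thesis
      unfolding lap_eq e 1 2 by (rule euler_lagrange_iff[OF x sc refl])
  qed
  have cover: "(\<forall>p\<in>M. ?E2 p) \<longleftrightarrow> (\<forall>U \<phi>. local_param M \<mu> U \<phi> \<longrightarrow> (\<forall>x\<in>U. ?E2 (\<phi> x)))"
  proof (intro iffI allI impI ballI)
    show "?E2 (\<phi> x)" if "\<forall>p\<in>M. ?E2 p" "local_param M \<mu> U \<phi>" "x \<in> U" for U \<phi> x
      using that local_paramD(7)[OF that(2)] by blast
    show "?E2 p" if a: "\<forall>U \<phi>. local_param M \<mu> U \<phi> \<longrightarrow> (\<forall>x\<in>U. ?E2 (\<phi> x))" and p: "p \<in> M" for p
    proof -
      obtain U \<phi> x where \<phi>: "local_param M \<mu> U \<phi>" "x \<in> U" "\<phi> x = p"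
        using M p by (force simp: sphere_hypersurface_def)
      then show ?thesis using a by blast
    qed
  qed
  have "harmonic_map M \<mu> \<eta> \<longleftrightarrow> (\<forall>U \<phi>. local_param M \<mu> U \<phi> \<longrightarrow> (\<forall>x\<in>U. ?E1 \<phi> x \<and> ?E2 (\<phi> x)))"
    unfolding harmonic_map_iff_euler_lagrange[OF M \<eta>(1) \<eta>1]
    by (intro arg_cong[where f = All] ext imp_cong refl ball_cong local)
  then show ?thesis
    unfolding cover by (simp only: ball_conj_distrib imp_conjR all_conj_distrib)
qed

text \<open>A vanishing gradient makes the mean curvature locally constant, hence constant on the connected
  space \<open>M\<close>.\<close>

lemma cmc_iff_pd_eq_0:
  fixes \<mu> :: "'m::{t2_space,second_countable_topology} \<Rightarrow> real ^ ('n::finite + 2)"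
  assumes M: "sphere_hypersurface M \<mu>" and conn: "connected M" and \<nu>: "unit_normal_section_in_sphere M \<mu> \<nu>"
  shows "cmc_hypersurface M \<mu> \<nu> \<longleftrightarrow>
    (\<forall>U \<phi>. local_param M \<mu> U \<phi> \<longrightarrow> (\<forall>x\<in>U. \<forall>l. pd (\<lambda>x. mean_curvature M \<mu> \<nu> (\<phi> x)) l x = 0))"
proof
  assume "cmc_hypersurface M \<mu> \<nu>"
  then obtain c where c: "\<And>p. p \<in> M \<Longrightarrow> mean_curvature M \<mu> \<nu> p = c" by (auto simp: cmc_hypersurface_def)
  show "\<forall>U \<phi>. local_param M \<mu> U \<phi> \<longrightarrow> (\<forall>x\<in>U. \<forall>l. pd (\<lambda>x. mean_curvature M \<mu> \<nu> (\<phi> x)) l x = 0)"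
  proof (intro allI impI ballI)
    fix U \<phi> x l assume \<phi>: "local_param M \<mu> U \<phi>" and x: "x \<in> U"
    have "pd (\<lambda>x. c) l x = pd (\<lambda>x. mean_curvature M \<mu> \<nu> (\<phi> x)) l x"
      by (rule pd_cong[OF local_paramD(1)[OF \<phi>] x _ smooth_on_const]) (use c local_paramD(7)[OF \<phi>] in auto)
    then show "pd (\<lambda>x. mean_curvature M \<mu> \<nu> (\<phi> x)) l x = 0" by (simp add: pd_const)
  qed
next
  let ?H = "mean_curvature M \<mu> \<nu>"
  assume a: "\<forall>U \<phi>. local_param M \<mu> U \<phi> \<longrightarrow> (\<forall>x\<in>U. \<forall>l. pd (\<lambda>x. ?H (\<phi> x)) l x = 0)"
  have loc: "\<forall>\<^sub>F q in at p within M. ?H p = ?H q" if p: "p \<in> M" for p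
  proof -
    obtain U \<phi> x where \<phi>: "local_param M \<mu> U \<phi>" "x \<in> U" "\<phi> x = p"
      using M p by (force simp: sphere_hypersurface_def)
    interpret hypersurface_chart U "\<mu> \<circ> \<phi>" "\<nu> \<circ> \<phi>" by (rule hypersurface_chart_local_param[OF M \<nu> \<phi>(1)])
    have "smooth_on U (\<lambda>z. - (1 / real CARD('n)) * trA z)"
      unfolding trA_def by (intro smooth_intros open_U smooth_E smooth_nu)
    then have sH: "smooth_on U (\<lambda>z. ?H (\<phi> z))"
      by (rule smooth_on_cong[OF _ open_U]) (use shape_operator_chart(2)[OF M \<nu> \<phi>(1)] in \<open>simp add: field_simps\<close>)
    obtain d where d: "d > 0" "ball x d \<subseteq> U" using open_U \<phi>(2) open_contains_ball by blast
    have "((\<lambda>z. ?H (\<phi> z)) has_derivative (\<lambda>h. 0)) (at z within ball x d)" if "z \<in> ball x d" for z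
    proof -
      have zU: "z \<in> U" using d that by blast
      note h = smooth_on_has_derivative[OF sH zU]
      have "frechet_derivative (\<lambda>z. ?H (\<phi> z)) (at z) = (\<lambda>h. 0)"
        using frechet_derivative_pd[OF h] a \<phi>(1) zU by (auto simp: fun_eq_iff)
      then show ?thesis using h by (simp add: has_derivative_at_withinI)
    qed
    then obtain k where k: "\<And>z. z \<in> ball x d \<Longrightarrow> ?H (\<phi> z) = k"
      using has_derivative_zero_constant[OF convex_ball] by metis
    have "openin (top_of_set M) (\<phi> ` ball x d)" by (rule local_param_image_openin[OF \<phi>(1) open_ball d(2)])
    then obtain T where T: "open T" "\<phi> ` ball x d = M \<inter> T" by (auto simp: openin_open)
    have pT: "p \<in> T" using T(2) \<phi>(3) d(1) by (metis IntD2 centre_in_ball imageI)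
    have eq: "?H q = k" if "q \<in> M \<inter> T" for q using that k unfolding T(2)[symmetric] by blast
    show ?thesis
      unfolding eventually_at_topological
      by (intro exI[of _ T] conjI T(1) pT ballI impI) (use eq p pT in auto)
  qed
  show "cmc_hypersurface M \<mu> \<nu>"
  proof (cases "M = {}")
    case False
    then obtain p0 where "p0 \<in> M" by blast
    then have "?H p = ?H p0" if "p \<in> M" for p
      by (rule connected_local_const[OF conn that]) (use loc in blast)
    then show ?thesis by (auto simp: cmc_hypersurface_def)
  qed (simp add: cmc_hypersurface_def)
qed

theorem theorem1p5:
  fixes M :: "'m::{t2_space,second_countable_topology} set"
    and \<mu> \<eta> \<nu> :: "'m \<Rightarrow> real ^ ('n::finite + 2)"
    and \<theta> :: real
  assumes "sphere_hypersurface M \<mu>"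
    and "connected M"
    and "orientable M \<mu>"
    and "unit_normal_section M \<mu> \<eta>"
    and "parallel_normal M \<mu> \<eta>"
    and "0 \<le> \<theta>" and "\<theta> < pi"
    and "\<forall>p\<in>M. vec_angle (\<eta> p) (\<mu> p) = \<theta>"
    and "unit_normal_section_in_sphere M \<mu> \<nu>"
    and "\<forall>p\<in>M. \<eta> p = sin \<theta> *\<^sub>R \<nu> p + cos \<theta> *\<^sub>R \<mu> p"
  shows "(\<theta> = 0 \<or> \<theta> = pi / 2 \<longrightarrow>
            (harmonic_map M \<mu> (gauss_map \<eta>) \<longleftrightarrow> minimal_hypersurface M \<mu> \<nu>)) \<and>
         (\<theta> \<noteq> 0 \<and> \<theta> \<noteq> pi / 2 \<longrightarrow>
            (harmonic_map M \<mu> (gauss_map \<eta>) \<longleftrightarrow>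
               cmc_hypersurface M \<mu> \<nu> \<and>
               (\<exists>c. \<forall>p\<in>M. shape_norm M \<mu> \<nu> p = c) \<and>
               (\<forall>p\<in>M. (shape_norm M \<mu> \<nu> p)\<^sup>2 =
                  real CARD('n) * mean_curvature M \<mu> \<nu> p * (cot \<theta> - tan \<theta>) + real CARD('n))))"
proof -
  let ?s = "sin \<theta>" and ?c = "cos \<theta>" and ?n = "real CARD('n)" and ?H = "mean_curvature M \<mu> \<nu>"
  let ?S2 = "\<lambda>p. (shape_norm M \<mu> \<nu> p)\<^sup>2"
  let ?grad = "\<forall>U \<phi>. local_param M \<mu> U \<phi> \<longrightarrow> (\<forall>x\<in>U. \<forall>l. ?s * pd (\<lambda>x. ?H (\<phi> x)) l x = 0)"
  let ?eq = "\<lambda>p. ?s * ?c * (?S2 p - ?n) = (?c\<^sup>2 - ?s\<^sup>2) * (?n * ?H p)"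
  have gm: "gauss_map \<eta> = \<eta>" by (rule ext) (simp add: gauss_map_def)
  have "smooth_map M \<mu> \<eta>" using assms(4) by (simp add: unit_normal_section_def)
  from harmonic_gauss_map_iff[OF assms(1,9) this, of ?s ?c]
  have harm: "harmonic_map M \<mu> (gauss_map \<eta>) \<longleftrightarrow> ?grad \<and> (\<forall>p\<in>M. ?eq p)"
    using assms(10) by (simp add: gm)
  note cmc = cmc_iff_pd_eq_0[OF assms(1,2,9)]
  have n: "?n > 0" by simp
  have min_cmc: "minimal_hypersurface M \<mu> \<nu> \<Longrightarrow> cmc_hypersurface M \<mu> \<nu>"
    by (auto simp: minimal_hypersurface_def cmc_hypersurface_def)
  show ?thesis
  proof (intro conjI impI)
    assume \<theta>: "\<theta> = 0 \<or> \<theta> = pi / 2"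
    have sc: "?s * ?c = 0" "?c\<^sup>2 - ?s\<^sup>2 \<noteq> 0" using \<theta> by (elim disjE; hypsubst; simp)+
    have "(\<forall>p\<in>M. ?eq p) \<longleftrightarrow> minimal_hypersurface M \<mu> \<nu>"
      unfolding minimal_hypersurface_def using sc n by auto
    moreover have "minimal_hypersurface M \<mu> \<nu> \<Longrightarrow> ?grad"
      using min_cmc cmc by simp
    ultimately show "harmonic_map M \<mu> (gauss_map \<eta>) \<longleftrightarrow> minimal_hypersurface M \<mu> \<nu>"
      using harm by blast
  next
    assume \<theta>: "\<theta> \<noteq> 0 \<and> \<theta> \<noteq> pi / 2"
    have s: "?s > 0" using \<theta> assms(6,7) by (intro sin_gt_zero) auto
    have c: "?c \<noteq> 0"
    proof
      assume "?c = 0"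
      then have "?c = cos (pi / 2)" by simp
      then show False using cos_inj_pi[of \<theta> "pi / 2"] \<theta> assms(6,7) by simp
    qed
    have grad: "?grad \<longleftrightarrow> cmc_hypersurface M \<mu> \<nu>" unfolding cmc using s by simp
    have ct: "cot \<theta> - tan \<theta> = (?c\<^sup>2 - ?s\<^sup>2) / (?s * ?c)"
      using s c by (simp add: cot_def tan_def field_simps power2_eq_square)
    have eq: "?eq p \<longleftrightarrow> ?S2 p = ?n * ?H p * (cot \<theta> - tan \<theta>) + ?n" for p
      unfolding ct using s c by (auto simp: field_simps)
    have len: "\<exists>k. \<forall>p\<in>M. shape_norm M \<mu> \<nu> p = k"
      if "cmc_hypersurface M \<mu> \<nu>" "\<forall>p\<in>M. ?S2 p = ?n * ?H p * (cot \<theta> - tan \<theta>) + ?n"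
    proof -
      obtain h where h: "\<forall>p\<in>M. ?H p = h" using \<open>cmc_hypersurface M \<mu> \<nu>\<close> by (auto simp: cmc_hypersurface_def)
      have "shape_norm M \<mu> \<nu> p = sqrt (?n * h * (cot \<theta> - tan \<theta>) + ?n)" if "p \<in> M" for p
      proof -
        have "0 \<le> shape_norm M \<mu> \<nu> p" by (simp add: shape_norm_def hs_norm_def sum_nonneg)
        then have "shape_norm M \<mu> \<nu> p = sqrt (?S2 p)" by simp
        then show ?thesis using \<open>\<forall>p\<in>M. ?S2 p = _ p\<close> h that by simp
      qed
      then show ?thesis by blast
    qed
    show "harmonic_map M \<mu> (gauss_map \<eta>) \<longleftrightarrow> cmc_hypersurface M \<mu> \<nu> \<and>
               (\<exists>c. \<forall>p\<in>M. shape_norm M \<mu> \<nu> p = c) \<and>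
               (\<forall>p\<in>M. ?S2 p = ?n * ?H p * (cot \<theta> - tan \<theta>) + ?n)"
      unfolding harm grad eq using len by blast
  qed
qed

end
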